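(* Let $p$ and $q$ be non-constant polynomials in one variable with complex coefficients, such that $p$ or $q$ has real coefficients. Let $L$ be the constant coefficient differential operator on $\mathbb{T}^1\times\mathbb{R}$ given by $$L=p(D_x)+q(D_t),\qquad D_x=-i\partial_x,\quad D_t=-i\partial_t.$$ Then $L$ is Schwartz globally hypoelliptic if and only if $$Z=\{(k,\xi)\in\mathbb{Z}\times\mathbb{R}\;|\;p(\xi)+q(k)=0\}=\emptyset.$$
   Context: $\mathbb{T}^1=\mathbb{R}/2\pi\mathbb{Z}$, with variables $(t,x)\in\mathbb{T}^1\times\mathbb{R}$. $\mathcal{S}(\mathbb{T}^1\times\mathbb{R})$ is the Fréchet space of all complex-valued $f\in C^\infty(\mathbb{T}^1\times\mathbb{R})$ such that $\|f\|_{\alpha,\beta,\gamma}:=\sup_{(t,x)}|x^\gamma\partial_t^\alpha\partial_x^\beta f(t,x)|<+\infty$ for all nonnegative integers $\alpha,\beta,\gamma$, with seminorms $p_N(f):=\sum_{\alpha+\beta+\gamma\leq N}\|f\|_{\alpha,\beta,\gamma}$. $\mathcal{S}'(\mathbb{T}^1\times\mathbb{R})$ is its topological dual; functions of at most polynomial growth in $x$, uniformly in $t$, are identified with elements of $\mathcal{S}'(\mathbb{T}^1\times\mathbb{R})$ through $f\mapsto\int uf\,dt\,dx$, and differential operators act on $\mathcal{S}'$ in the usual distributional (dual) sense. A differential operator $L:\mathcal{S}'(\mathbb{T}^1\times\mathbb{R})\to\mathcal{S}'(\mathbb{T}^1\times\mathbb{R})$ is called Schwartz globally hypoelliptic (SGH)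 if whenever $u\in\mathcal{S}'(\mathbb{T}^1\times\mathbb{R})$ and $Lu\in\mathcal{S}(\mathbb{T}^1\times\mathbb{R})$, then $u\in\mathcal{S}(\mathbb{T}^1\times\mathbb{R})$. *)

theory Defs
  imports "HOL-Analysis.Analysis" "HOL-Computational_Algebra.Polynomial"
begin

(* Functions on the cylinder (R / 2 pi Z) x R are functions of (t, x) in R x R
   that are 2 pi-periodic in t. *)

type_synonym cfun = "real \<times> real \<Rightarrow> complex"

definition periodic_t :: "cfun \<Rightarrow> bool" where
  "periodic_t f \<longleftrightarrow> (\<forall>t x. f (t + 2 * pi, x) = f (t, x))"

definition partial_t :: "cfun \<Rightarrow> cfun" where
  "partial_t f = (\<lambda>(t, x). vector_derivative (\<lambda>s. f (s, x)) (at t))"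

definition partial_x :: "cfun \<Rightarrow> cfun" where
  "partial_x f = (\<lambda>(t, x). vector_derivative (\<lambda>y. f (t, y)) (at x))"

primrec C_k :: "nat \<Rightarrow> cfun \<Rightarrow> bool" where
  "C_k 0 f \<longleftrightarrow> continuous_on UNIV f"
| "C_k (Suc k) f \<longleftrightarrow>
     continuous_on UNIV f
     \<and> (\<forall>t x. (\<lambda>s. f (s, x)) differentiable (at t))
     \<and> (\<forall>t x. (\<lambda>y. f (t, y)) differentiable (at x))
     \<and> C_k k (partial_t f) \<and> C_k k (partial_x f)"

definition C_infinity :: "cfun \<Rightarrow> bool" where
  "C_infinity f \<longleftrightarrow> (\<forall>k. C_k k f)"

definition weighted_deriv :: "nat \<Rightarrow> nat \<Rightarrow> nat \<Rightarrow> cfun \<Rightarrow> real \<times> real \<Rightarrow> real" where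
  "weighted_deriv a b c f =
     (\<lambda>(t, x). norm (of_real x ^ c * (partial_t ^^ a) ((partial_x ^^ b) f) (t, x)))"

definition schwartz :: "cfun set" where
  "schwartz = {f. periodic_t f \<and> C_infinity f \<and>
                  (\<forall>a b c. bdd_above (range (weighted_deriv a b c f)))}"

definition schwartz_norm :: "nat \<Rightarrow> nat \<Rightarrow> nat \<Rightarrow> cfun \<Rightarrow> real" where
  "schwartz_norm a b c f = (SUP z. weighted_deriv a b c f z)"

definition schwartz_seminorm :: "nat \<Rightarrow> cfun \<Rightarrow> real" where
  "schwartz_seminorm N f = (\<Sum>(a, b, c) \<in> {(a, b, c). a + b + c \<le> N}. schwartz_norm a b c f)"

(* The locally convex topology defined by the seminorms: it is generated by their balls. *)

definition schwartz_topology :: "cfun topology" where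
  "schwartz_topology = topology_generated_by
     {{g \<in> schwartz. schwartz_seminorm N (\<lambda>z. g z - f z) < r} | N f r. f \<in> schwartz \<and> 0 < r}"

(* A distribution is represented by a functional on all functions, of which only the
   values on the Schwartz space are meaningful. *)

type_synonym functional = "cfun \<Rightarrow> complex"

definition tempered_distributions :: "functional set" where
  "tempered_distributions = {u.
     (\<forall>f \<in> schwartz. \<forall>g \<in> schwartz. u (\<lambda>z. f z + g z) = u f + u g)
     \<and> (\<forall>c. \<forall>f \<in> schwartz. u (\<lambda>z. c * f z) = c * u f)
     \<and> continuous_map schwartz_topology euclidean u}"

definition functional_of_fun :: "cfun \<Rightarrow> functional" where
  "functional_of_fun f = (\<lambda>\<phi>. LINT z : {0..2 * pi} \<times> UNIV | lborel. \<phi> z * f z)"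

definition is_schwartz_function :: "functional \<Rightarrow> bool" where
  "is_schwartz_function u \<longleftrightarrow>
     (\<exists>f \<in> schwartz. \<forall>\<phi> \<in> schwartz. u \<phi> = functional_of_fun f \<phi>)"

(* D = -i d, with the distributional derivative (d u)(phi) = - u (d phi). *)

definition D_t :: "functional \<Rightarrow> functional" where
  "D_t u = (\<lambda>\<phi>. - \<i> * (- u (partial_t \<phi>)))"

definition D_x :: "functional \<Rightarrow> functional" where
  "D_x u = (\<lambda>\<phi>. - \<i> * (- u (partial_x \<phi>)))"

definition poly_operator ::
    "complex poly \<Rightarrow> (functional \<Rightarrow> functional) \<Rightarrow> functional \<Rightarrow> functional" where
  "poly_operator p A u = (\<lambda>\<phi>. \<Sum>k\<le>degree p. coeff p k * (A ^^ k) u \<phi>)"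

definition SGH :: "(functional \<Rightarrow> functional) \<Rightarrow> bool" where
  "SGH L \<longleftrightarrow> (\<forall>u \<in> tempered_distributions. is_schwartz_function (L u) \<longrightarrow> is_schwartz_function u)"

lemma topspace_schwartz_topology: "topspace schwartz_topology = schwartz"
proof
  show "topspace schwartz_topology \<subseteq> schwartz"
    unfolding schwartz_topology_def topology_generated_by_topspace by blast
  show "schwartz \<subseteq> topspace schwartz_topology"
  proof
    fix f assume f: "f \<in> schwartz"
    have "schwartz_seminorm 0 (\<lambda>z. f z - f z) = 0"
      by (simp add: schwartz_seminorm_def schwartz_norm_def weighted_deriv_def case_prod_unfold)
    then have "f \<in> {g \<in> schwartz. schwartz_seminorm 0 (\<lambda>z. g z - f z) < 1}"
      using f by simp
    moreover have "{g \<in> schwartz. schwartz_seminorm 0 (\<lambda>z. g z - f z) < 1} \<in>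
        {{g \<in> schwartz. schwartz_seminorm N (\<lambda>z. g z - f z) < r} | N f r. f \<in> schwartz \<and> 0 < r}"
      by (intro CollectI exI[of _ 0] exI[of _ f] exI[of _ "1::real"] conjI f refl) simp
    ultimately show "f \<in> topspace schwartz_topology"
      unfolding schwartz_topology_def topology_generated_by_topspace by (rule UnionI[rotated])
  qed
qed

end

theory Submission
  imports
    Defs
    "HOL-Computational_Algebra.Fundamental_Theorem_Algebra"
    "HOL-Probability.Distributions"
    "HOL-Probability.Sinc_Integral"
begin

text \<open>
Write \<open>k\<close> for the frequency in \<open>t\<close> and \<open>\<xi>\<close> for the frequency in \<open>x\<close>, so that \<open>L\<close> multiplies the
plane wave \<open>exp (i (k t + \<xi> x))\<close> by the symbol \<open>p(\<xi>) + q(k)\<close>.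

If the symbol vanishes at \<open>(k, \<xi>)\<close>, the plane wave itself is a tempered solution of \<open>Lu = 0\<close>.
It is not a Schwartz function, because its pairing with a modulated Gaussian does not change when
the Gaussian is translated to infinity, whereas the pairing of a Schwartz function with these
Gaussians tends to \<open>0\<close> (\<open>plane_wave_not_schwartz\<close>).

If the symbol has no zero, then it is bounded away from zero (\<open>symbol_bounded_below\<close>).  This is where
the realness of \<open>p\<close> or \<open>q\<close> enters: either both polynomials are real, and then the sum has a constant
sign and grows with \<open>k\<close>, or the imaginary part of the symbol comes from one polynomial in one
variable, which can be small only on a bounded set.

The lower bound makes the equation solvable inside the Schwartz space (\<open>schwartz_solvable\<close>).  A Schwartz
function is the sum of a Fourier series in \<open>t\<close> whose coefficients are Schwartz functions of \<open>x\<close>,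
rapidly decreasing in \<open>k\<close>.  For each \<open>k\<close> there remains the ordinary differential equation
\<open>(p(D\<^sub>x) + q(k)) v = f\<close>, and the polynomial \<open>p + q(k)\<close> splits into linear factors
\<open>D\<^sub>x - \<lambda>\<close>.  No \<open>\<lambda>\<close> is real, and each factor is inverted by an explicit integral whose
norm is governed by \<open>1 / \<bar>Im \<lambda>\<bar>\<close>.  The lower bound on the symbol keeps \<open>\<lambda>\<close> away from the real
axis, at a distance that shrinks at most polynomially in \<open>k\<close>, and this loss is absorbed by the rapid
decrease of the coefficients.

Regularity follows by duality (\<open>tempered_solution_is_schwartz\<close>).  The transpose of \<open>L\<close> has the symbol
\<open>p(-\<xi>) + q(-k)\<close>, which has the same lower bound.  Given \<open>Lu = f\<close> with \<open>f\<close> Schwartz, take a Schwartz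
function \<open>v\<close> with \<open>Lv = f\<close>, and for a test function \<open>\<phi>\<close> a Schwartz function \<open>\<psi>\<close> that the transpose
of \<open>L\<close> maps to \<open>\<phi>\<close>.  Then \<open>u(\<phi>) = (Lu)(\<psi>) = \<integral> f \<psi> = \<integral> (Lv) \<psi> = \<integral> v \<phi>\<close>, so \<open>u\<close> is
the function \<open>v\<close>.
\<close>

section \<open>A lower bound for the symbol\<close>

lemma poly_large:
  fixes r :: "complex poly"
  assumes "degree r > 0"
  shows "\<exists>R. \<forall>z. R \<le> norm z \<longrightarrow> d \<le> norm (poly r z)"
proof -
  obtain a s where r: "r = pCons a s" by (cases r)
  have "s \<noteq> 0" using assms by (auto simp: r)
  then show ?thesis using poly_infinity[of s d a] unfolding r by blast
qed

text \<open>
A non-constant polynomial tends to infinity, and a non-zero constant is its own lower bound.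
\<close>

lemma poly_eventually_bounded_below:
  fixes r :: "complex poly"
  assumes "r \<noteq> 0"
  shows "\<exists>R. \<exists>c>0. \<forall>z. R \<le> norm z \<longrightarrow> c \<le> norm (poly r z)"
proof (cases "degree r > 0")
  case True
  then show ?thesis using poly_large[of r 1] zero_less_one by blast
next
  case False
  then obtain a where "r = [:a:]" using degree_eq_zeroE by blast
  then show ?thesis using assms by (intro exI[of _ 0] exI[of _ "norm a"]) auto
qed

text \<open>
The polynomial whose values on the real line are the imaginary parts of the values of \<open>p\<close>.  It is
kept over the complex numbers so that the growth lemmas above apply to it.
\<close>

definition im_poly :: "complex poly \<Rightarrow> complex poly" where
  "im_poly p = map_poly (\<lambda>c. of_real (Im c)) p"

lemma poly_im_poly: "poly (im_poly p) (of_real x) = of_real (Im (poly p (of_real x)))"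
  unfolding im_poly_def by (induction p) (auto simp: map_poly_pCons)

lemma im_poly_eq_0_iff: "im_poly p = 0 \<longleftrightarrow> (\<forall>n. coeff p n \<in> \<real>)"
  by (auto simp: im_poly_def poly_eq_iff coeff_map_poly complex_is_Real_iff)

text \<open>
For a fixed frequency \<open>k\<close> the constant \<open>b\<close> is \<open>q(k)\<close>: the symbol tends to infinity with \<open>\<xi>\<close>, so
its smallest modulus is attained on a compact interval.
\<close>

lemma shifted_poly_bounded_below:
  fixes p :: "complex poly"
  assumes p: "degree p > 0" and nz: "\<And>\<xi>::real. poly p (of_real \<xi>) + b \<noteq> 0"
  shows "\<exists>c>0. \<forall>\<xi>::real. c \<le> norm (poly p (of_real \<xi>) + b)"
proof -
  obtain R where R: "\<And>z. R \<le> norm z \<Longrightarrow> 1 + norm b \<le> norm (poly p z)"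
    using poly_large[OF p] by blast
  define g where "g \<xi> = norm (poly p (of_real \<xi>) + b)" for \<xi> :: real
  have "continuous_on {- \<bar>R\<bar>..\<bar>R\<bar>} g" unfolding g_def by (intro continuous_intros)
  moreover have "{- \<bar>R\<bar>..\<bar>R\<bar>} \<noteq> {}" by simp
  ultimately obtain \<xi>0 where \<xi>0: "\<forall>\<xi>\<in>{- \<bar>R\<bar>..\<bar>R\<bar>}. g \<xi>0 \<le> g \<xi>"
    using continuous_attains_inf[OF compact_Icc] by blast
  have "min 1 (g \<xi>0) \<le> g \<xi>" for \<xi>
  proof (cases "\<bar>\<xi>\<bar> \<le> \<bar>R\<bar>")
    case True
    then have "g \<xi>0 \<le> g \<xi>" by (intro \<xi>0[rule_format]) auto
    then show ?thesis by simp
  next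
    case False
    then have "1 + norm b \<le> norm (poly p (of_real \<xi>))" by (intro R) auto
    then have "1 \<le> g \<xi>" using norm_diff_ineq[of "poly p (of_real \<xi>)" b] by (simp add: g_def)
    then show ?thesis by simp
  qed
  moreover have "g \<xi>0 > 0" unfolding g_def using nz[of \<xi>0] by (simp only: zero_less_norm_iff not_False_eq_True)
  ultimately show ?thesis unfolding g_def by (intro exI[of _ "min 1 (norm (poly p (of_real \<xi>0) + b))"]) auto
qed

lemma nonvanishing_continuous_pos:
  fixes g :: "real \<Rightarrow> real"
  assumes "continuous_on UNIV g" "\<And>x. g x \<noteq> 0" "g a > 0"
  shows "g x > 0"
proof (rule ccontr)
  assume "\<not> g x > 0"
  have "connected (range g)" by (rule connected_continuous_image[OF assms(1) connected_UNIV])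
  then have "0 \<in> range g"
    by (rule connectedD_interval[of _ "g x" "g a"]) (use \<open>\<not> g x > 0\<close> assms(3) in auto)
  then obtain y where "g y = 0" by auto
  with assms(2) show False by blast
qed

text \<open>
For a real symbol the intermediate value theorem turns the absence of zeros into a constant sign.
Since \<open>p\<close> is bounded below and non-constant, it tends to \<open>+\<infinity>\<close>; hence the symbol is positive for
every \<open>k\<close>, which bounds \<open>q\<close> from below and makes \<open>q\<close> tend to \<open>+\<infinity>\<close> as well.
\<close>

lemma positive_real_symbol_bounded_below:
  fixes p q :: "complex poly"
  assumes p: "degree p > 0" and q: "degree q > 0"
    and real: "im_poly p = 0" "im_poly q = 0"
    and nz: "\<And>(k::int) (\<xi>::real). poly p (of_real \<xi>) + poly q (of_int k) \<noteq> 0"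
    and pos: "Re (poly p 0) + Re (poly q 0) > 0"
  shows "\<exists>K. \<forall>(k::int) (\<xi>::real). K \<le> \<bar>of_int k :: real\<bar> \<longrightarrow> 1 \<le> norm (poly p (of_real \<xi>) + poly q (of_int k))"
proof -
  define a where "a \<xi> = Re (poly p (of_real \<xi>))" for \<xi> :: real
  define b where "b k = Re (poly q (of_int k))" for k :: int
  have pa: "poly p (of_real \<xi>) = of_real (a \<xi>)" for \<xi>
    using poly_im_poly[of p \<xi>] real(1) by (simp add: a_def complex_eq_iff)
  have qb: "poly q (of_int k) = of_real (b k)" for k
    using poly_im_poly[of q "of_int k"] real(2) by (simp add: b_def complex_eq_iff)
  have ab: "a \<xi> + b k \<noteq> 0" for \<xi> k
    using nz[of \<xi> k] unfolding pa qb by (metis of_real_0 of_real_add)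
  have cont: "continuous_on UNIV (\<lambda>\<xi>. a \<xi> + b k)" for k
    unfolding a_def by (intro continuous_intros)
  have a0: "a \<xi> + b 0 > 0" for \<xi>
    by (rule nonvanishing_continuous_pos[OF cont ab, of 0]) (use pos in \<open>simp add: a_def b_def\<close>)
  \<comment> \<open>Being bounded below, the values \<open>a \<xi>\<close> tend to \<open>\<infinity>\<close>, which fixes the sign for every \<open>k\<close>.\<close>
  have all: "a \<xi> + b k > 0" for \<xi> k
  proof -
    obtain R where R: "\<And>z. R \<le> norm z \<Longrightarrow> 1 + \<bar>b k\<bar> + \<bar>b 0\<bar> \<le> norm (poly p z)"
      using poly_large[OF p] by blast
    have "1 + \<bar>b k\<bar> + \<bar>b 0\<bar> \<le> \<bar>a \<bar>R\<bar>\<bar>"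
      using R[of "of_real \<bar>R\<bar>"] by (simp add: pa[of "\<bar>R\<bar>", simplified])
    then have "a \<bar>R\<bar> + b k > 0" using a0[of "\<bar>R\<bar>"] by linarith
    then show ?thesis by (rule nonvanishing_continuous_pos[OF cont ab])
  qed
  obtain K where K: "\<And>z. K \<le> norm z \<Longrightarrow> 1 + \<bar>a 0\<bar> + \<bar>b 0\<bar> \<le> norm (poly q z)"
    using poly_large[OF q] by blast
  have "1 \<le> norm (poly p (of_real \<xi>) + poly q (of_int k))" if k: "K \<le> \<bar>of_int k :: real\<bar>" for k :: int and \<xi> :: real
  proof -
    have "1 + \<bar>a 0\<bar> + \<bar>b 0\<bar> \<le> \<bar>b k\<bar>" using K[of "of_int k"] k by (simp add: qb)
    then have "1 \<le> a \<xi> + b k" using all[of 0 k] a0[of \<xi>] by linarith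
    then show ?thesis unfolding pa qb of_real_add[symmetric] norm_of_real by linarith
  qed
  then show ?thesis by blast
qed

lemma Im_poly_eq_0: "im_poly r = 0 \<Longrightarrow> Im (poly r (of_real x)) = 0"
  using poly_im_poly[of r x] by simp

text \<open>
The sign of the symbol at the origin is normalised by passing to \<open>-p\<close> and \<open>-q\<close>.
\<close>

lemma real_symbol_bounded_below:
  fixes p q :: "complex poly"
  assumes p: "degree p > 0" and q: "degree q > 0"
    and real: "im_poly p = 0" "im_poly q = 0"
    and nz: "\<And>(k::int) (\<xi>::real). poly p (of_real \<xi>) + poly q (of_int k) \<noteq> 0"
  shows "\<exists>K. \<forall>(k::int) (\<xi>::real). K \<le> \<bar>of_int k :: real\<bar> \<longrightarrow> 1 \<le> norm (poly p (of_real \<xi>) + poly q (of_int k))"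
proof (cases "Re (poly p 0) + Re (poly q 0) > 0")
  case True
  show ?thesis by (rule positive_real_symbol_bounded_below[OF p q real nz True])
next
  case False
  have "poly p 0 + poly q 0 \<noteq> 0" using nz[where k = 0 and \<xi> = 0] by simp
  moreover have "Im (poly p 0) = 0" "Im (poly q 0) = 0"
    using Im_poly_eq_0[OF real(1), of 0] Im_poly_eq_0[OF real(2), of 0] by simp_all
  ultimately have "Re (poly (- p) 0) + Re (poly (- q) 0) > 0"
    using False by (simp add: complex_eq_iff)
  moreover have im: "im_poly (- r) = - im_poly r" for r
    by (simp add: im_poly_def poly_eq_iff coeff_map_poly)
  moreover have m: "poly (- p) (of_real \<xi>) + poly (- q) (of_int k) = - (poly p (of_real \<xi>) + poly q (of_int k))"
    for \<xi> :: real and k :: int by simp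
  moreover have "poly (- p) (of_real \<xi>) + poly (- q) (of_int k) \<noteq> 0" for \<xi> :: real and k :: int
    unfolding m neg_equal_0_iff_equal by (rule nz)
  ultimately have "\<exists>K. \<forall>(k::int) (\<xi>::real). K \<le> \<bar>of_int k :: real\<bar> \<longrightarrow>
      1 \<le> norm (poly (- p) (of_real \<xi>) + poly (- q) (of_int k))"
    using p q real by (intro positive_real_symbol_bounded_below) simp_all
  then show ?thesis unfolding m norm_minus_cancel .
qed

text \<open>
The imaginary part of the symbol depends on \<open>\<xi>\<close> only and is not small for large \<open>\<xi>\<close>.  For bounded
\<open>\<xi>\<close> the growth of \<open>q\<close> wins once \<open>k\<close> is large.
\<close>

lemma nonreal_p_symbol_bounded_below:
  fixes p q :: "complex poly"
  assumes q: "degree q > 0" and im: "im_poly p \<noteq> 0" "im_poly q = 0"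
  shows "\<exists>K. \<exists>c>0. \<forall>(k::int) (\<xi>::real). K \<le> \<bar>of_int k :: real\<bar> \<longrightarrow> c \<le> norm (poly p (of_real \<xi>) + poly q (of_int k))"
proof -
  obtain R c where c: "c > 0" "\<And>z. R \<le> norm z \<Longrightarrow> c \<le> norm (poly (im_poly p) z)"
    using poly_eventually_bounded_below[OF im(1)] by blast
  have "bounded ((\<lambda>\<xi>. poly p (of_real \<xi>)) ` {- \<bar>R\<bar>..\<bar>R\<bar>})"
    by (intro compact_imp_bounded compact_continuous_image continuous_intros) auto
  then obtain B where B: "\<And>\<xi>. \<xi> \<in> {- \<bar>R\<bar>..\<bar>R\<bar>} \<Longrightarrow> norm (poly p (of_real \<xi>)) \<le> B"
    unfolding bounded_iff by blast
  obtain K where K: "\<And>z. K \<le> norm z \<Longrightarrow> 1 + B \<le> norm (poly q z)"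
    using poly_large[OF q] by blast
  have "min 1 c \<le> norm (poly p (of_real \<xi>) + poly q (of_int k))"
    if k: "K \<le> \<bar>of_int k :: real\<bar>" for k :: int and \<xi> :: real
  proof (cases "\<bar>\<xi>\<bar> \<le> \<bar>R\<bar>")
    case True
    then have "norm (poly p (of_real \<xi>)) \<le> B" by (intro B) auto
    moreover have "1 + B \<le> norm (poly q (of_int k))" using K[of "of_int k"] k by simp
    ultimately have "1 \<le> norm (poly p (of_real \<xi>) + poly q (of_int k))"
      using norm_diff_ineq[of "poly q (of_int k)" "poly p (of_real \<xi>)"] by (simp add: add.commute)
    then show ?thesis by simp
  next
    case False
    then have "c \<le> norm (poly (im_poly p) (of_real \<xi>))" by (intro c(2)) auto
    also have "\<dots> = \<bar>Im (poly p (of_real \<xi>) + poly q (of_int k))\<bar>"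
      using Im_poly_eq_0[OF im(2), of "of_int k"] by (simp add: poly_im_poly)
    also have "\<dots> \<le> norm (poly p (of_real \<xi>) + poly q (of_int k))" by (rule abs_Im_le_cmod)
    finally show ?thesis by simp
  qed
  moreover have "min 1 c > 0" using c(1) by simp
  ultimately show ?thesis by blast
qed

text \<open>
Here the imaginary part of the symbol depends on \<open>k\<close> only.
\<close>

lemma nonreal_q_symbol_bounded_below:
  fixes p q :: "complex poly"
  assumes im: "im_poly p = 0" "im_poly q \<noteq> 0"
  shows "\<exists>K. \<exists>c>0. \<forall>(k::int) (\<xi>::real). K \<le> \<bar>of_int k :: real\<bar> \<longrightarrow> c \<le> norm (poly p (of_real \<xi>) + poly q (of_int k))"
proof -
  obtain K c where c: "c > 0" "\<And>z. K \<le> norm z \<Longrightarrow> c \<le> norm (poly (im_poly q) z)"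
    using poly_eventually_bounded_below[OF im(2)] by blast
  have "c \<le> norm (poly p (of_real \<xi>) + poly q (of_int k))"
    if k: "K \<le> \<bar>of_int k :: real\<bar>" for k :: int and \<xi> :: real
  proof -
    have "c \<le> norm (poly (im_poly q) (of_real (of_int k)))" using k by (intro c(2)) simp
    also have "\<dots> = \<bar>Im (poly p (of_real \<xi>) + poly q (of_int k))\<bar>"
      unfolding poly_im_poly using Im_poly_eq_0[OF im(1), of \<xi>] by simp
    also have "\<dots> \<le> norm (poly p (of_real \<xi>) + poly q (of_int k))" by (rule abs_Im_le_cmod)
    finally show ?thesis .
  qed
  with c(1) show ?thesis by blast
qed

text \<open>
Large frequencies \<open>k\<close> are covered by the three cases above; the finitely many others
are treated one at a time.
\<close>

lemma symbol_bounded_below: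
  fixes p q :: "complex poly"
  assumes p: "degree p > 0" and q: "degree q > 0"
    and real: "(\<forall>n. coeff p n \<in> \<real>) \<or> (\<forall>n. coeff q n \<in> \<real>)"
    and nz: "\<And>(k::int) (\<xi>::real). poly p (of_real \<xi>) + poly q (of_int k) \<noteq> 0"
  shows "\<exists>c>0. \<forall>(\<xi>::real) (k::int). c \<le> norm (poly p (of_real \<xi>) + poly q (of_int k))"
proof -
  have "\<exists>K. \<exists>c>0. \<forall>(k::int) (\<xi>::real). K \<le> \<bar>of_int k :: real\<bar> \<longrightarrow> c \<le> norm (poly p (of_real \<xi>) + poly q (of_int k))"
  proof -
    consider "im_poly p = 0" "im_poly q = 0" | "im_poly p \<noteq> 0" "im_poly q = 0" | "im_poly p = 0" "im_poly q \<noteq> 0"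
      using real im_poly_eq_0_iff by blast
    then show ?thesis
    proof cases
      case 1
      obtain K where "\<forall>(k::int) (\<xi>::real). K \<le> \<bar>of_int k :: real\<bar> \<longrightarrow> 1 \<le> norm (poly p (of_real \<xi>) + poly q (of_int k))"
        using real_symbol_bounded_below[OF p q 1 nz] by blast
      then show ?thesis by (intro exI[of _ K] exI[of _ 1] conjI zero_less_one)
    qed (intro nonreal_p_symbol_bounded_below nonreal_q_symbol_bounded_below q; assumption)+
  qed
  then obtain K c where c: "c > 0"
    "\<And>(k::int) (\<xi>::real). K \<le> \<bar>of_int k :: real\<bar> \<Longrightarrow> c \<le> norm (poly p (of_real \<xi>) + poly q (of_int k))"
    by blast
  define S where "S = {- \<lceil>\<bar>K\<bar>\<rceil>..\<lceil>\<bar>K\<bar>\<rceil>}"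
  have "\<forall>k. \<exists>c>0. \<forall>\<xi>::real. c \<le> norm (poly p (of_real \<xi>) + poly q (of_int k))"
    using shifted_poly_bounded_below[OF p nz] by blast
  then obtain d where d: "\<And>k. d k > 0" "\<And>k \<xi>. d k \<le> norm (poly p (of_real \<xi>) + poly q (of_int k))"
    by metis
  define m where "m = min c (Min (d ` S))"
  have S: "finite S" "S \<noteq> {}" by (auto simp: S_def)
  have "m > 0" unfolding m_def using c(1) d(1) S by simp
  moreover have "m \<le> norm (poly p (of_real \<xi>) + poly q (of_int k))" for \<xi> :: real and k :: int
  proof (cases "k \<in> S")
    case True
    then have "Min (d ` S) \<le> d k" using S by simp
    then have "m \<le> d k" unfolding m_def by (rule min.coboundedI2)
    with d(2) show ?thesis by (rule order_trans[rotated])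
  next
    case False
    then have "\<lceil>\<bar>K\<bar>\<rceil> < \<bar>k\<bar>" unfolding S_def by auto
    then have "of_int \<lceil>\<bar>K\<bar>\<rceil> < \<bar>of_int k :: real\<bar>" by (simp only: of_int_abs[symmetric] of_int_less_iff)
    then have "K \<le> \<bar>of_int k\<bar>" using le_of_int_ceiling[of "\<bar>K\<bar>"] by linarith
    then have "c \<le> norm (poly p (of_real \<xi>) + poly q (of_int k))" by (rule c(2))
    then show ?thesis unfolding m_def by (rule min.coboundedI1)
  qed
  ultimately show ?thesis by blast
qed

section \<open>The resolvent of -i d/dx on the line\<close>

lemma power_add_le_two_power:
  fixes a b :: real
  assumes "0 \<le> a" "0 \<le> b"
  shows "(a + b) ^ c \<le> 2 ^ c * (a ^ c + b ^ c)"
proof -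
  have "(a + b) ^ c \<le> (2 * max a b) ^ c"
    using assms by (intro power_mono) auto
  also have "\<dots> = 2 ^ c * max a b ^ c" by (simp add: power_mult_distrib)
  also have "\<dots> \<le> 2 ^ c * (a ^ c + b ^ c)"
    using assms by (intro mult_left_mono) (auto simp: max_def)
  finally show ?thesis .
qed

text \<open>
One term of the exponential series.  It trades a polynomial weight for a part of the exponential
decay of the resolvent kernel.
\<close>

lemma power_le_fact_exp:
  fixes s m :: real
  assumes "0 \<le> s" "0 < m"
  shows "s ^ c \<le> fact c * (1 / m) ^ c * exp (m * s)"
proof -
  have "(\<Sum>n\<in>{c}. inverse (fact n) *\<^sub>R (m * s) ^ n) \<le> exp (m * s)"
    unfolding exp_def using assms by (intro sum_le_suminf summable_exp_generic) auto
  then show ?thesis using assms by (simp add: field_simps power_mult_distrib)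
qed

text \<open>
The bounded solution of \<open>(D\<^sub>x - l) v = g\<close> is an integral of \<open>g\<close> over a half line against an
exponential that decays at rate \<open>\<bar>Im l\<bar>\<close>.  For the weighted estimate, \<open>\<bar>x\<bar>\<close> is at most
\<open>\<bar>y\<bar>\<close> plus the distance \<open>y - x\<close> to the integration point, and powers of that distance cost half of
the decay rate.
\<close>

lemma resolvent_lower_half_plane:
  fixes g :: "real \<Rightarrow> complex" and l :: complex
  assumes l: "Im l < 0" and cont: "continuous_on UNIV g" and bdd: "bounded (range g)"
  shows "\<exists>v. (\<forall>x. (v has_vector_derivative \<i> * l * v x + \<i> * g x) (at x)) \<and>
    (\<forall>c A B x. (\<forall>y. norm (g y) \<le> A) \<longrightarrow> (\<forall>y. \<bar>y\<bar> ^ c * norm (g y) \<le> B) \<longrightarrow>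
       \<bar>x\<bar> ^ c * norm (v x) \<le> 2 ^ c * (B + A * (fact c * (2 / \<bar>Im l\<bar>) ^ c)) * (2 / \<bar>Im l\<bar>))"
proof -
  define m where "m = - Im l"
  have m: "m > 0" "\<bar>Im l\<bar> = m" using l by (auto simp: m_def)
  define h where "h y = exp (- (\<i> * l * of_real y)) * g y" for y :: real
  define H where "H x = integral {x..} h" for x :: real
  define v where "v x = - \<i> * exp (\<i> * l * of_real x) * H x" for x :: real
  have norm_h: "norm (h y) = exp (- m * y) * norm (g y)" for y
    by (simp add: h_def norm_mult m_def)
  have conth: "continuous_on A h" for A
    unfolding h_def by (intro continuous_intros continuous_on_subset[OF cont]) auto
  have maj: "r * norm (h y) \<le> K * exp (- m / 2 * x) * exp (- (m / 2) * y)"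
    if "r * norm (g y) \<le> K * exp (m / 2 * (y - x))" for r K x y
  proof -
    have "r * norm (h y) = exp (- m * y) * (r * norm (g y))" unfolding norm_h by simp
    also have "\<dots> \<le> exp (- m * y) * (K * exp (m / 2 * (y - x)))"
      using that by (intro mult_left_mono) auto
    also have "\<dots> = K * (exp (- m * y) * exp (m / 2 * (y - x)))" by simp
    also have "exp (- m * y) * exp (m / 2 * (y - x)) = exp (- m / 2 * x) * exp (- (m / 2) * y)"
      unfolding exp_add[symmetric] by (simp add: field_simps)
    finally show ?thesis by (simp add: mult.assoc)
  qed
  have majint: "((\<lambda>y. K * exp (- m / 2 * x) * exp (- (m / 2) * y)) has_integral
      K * exp (- m * x) * (2 / m)) {x..}" for K x
  proof -
    have "((\<lambda>y. K * exp (- m / 2 * x) * exp (- (m / 2) * y)) has_integral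
        K * exp (- m / 2 * x) * (exp (- (m / 2) * x) / (m / 2))) {x..}"
      using m by (intro has_integral_mult_right has_integral_exp_minus_to_infinity) auto
    moreover have "K * exp (- m / 2 * x) * (exp (- (m / 2) * x) / (m / 2)) =
        K * (exp (- m / 2 * x) * exp (- (m / 2) * x)) * (2 / m)" by simp
    moreover have "exp (- m / 2 * x) * exp (- (m / 2) * x) = exp (- m * x)"
      unfolding exp_add[symmetric] by (simp add: field_simps)
    ultimately show ?thesis by (simp only:)
  qed
  obtain A0 where A0: "\<And>y. norm (g y) \<le> A0" using bdd by (auto simp: bounded_iff)
  have int_h: "h integrable_on {x..}" for x
  proof (rule measurable_bounded_by_integrable_imp_integrable)
    show "h \<in> borel_measurable (lebesgue_on {x..})"
      by (rule continuous_imp_measurable_on_sets_lebesgue[OF conth]) auto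
    show "(\<lambda>y. A0 * exp (- m / 2 * x) * exp (- (m / 2) * y)) integrable_on {x..}"
      using majint by blast
    fix y assume y: "y \<in> {x..}"
    have "0 \<le> A0" using A0[of 0] norm_ge_zero order_trans by blast
    then have "norm (g y) \<le> A0 * exp (m / 2 * (y - x))"
      using A0[of y] m y by (intro order_trans[OF A0]) (auto simp: mult_le_cancel_left1)
    then show "norm (h y) \<le> A0 * exp (- m / 2 * x) * exp (- (m / 2) * y)"
      using maj[of 1] by simp
  qed auto
  have derH: "(H has_vector_derivative - h x) (at x)" for x
  proof -
    have eq: "H (x - 1) - integral {x - 1..z} h = H z" if "z \<in> {x - 1<..<x + 1}" for z
    proof -
      have "(h has_integral (integral {x - 1..z} h + H z)) ({x - 1..z} \<union> {z..})"
        unfolding H_def using that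
        by (intro has_integral_Un integrable_integral int_h integrable_continuous_interval conth)
           (auto intro: negligible_subset[of "{z}"])
      moreover have "{x - 1..z} \<union> {z..} = {x - 1..}" using that by auto
      ultimately show ?thesis unfolding H_def by (auto dest!: integral_unique)
    qed
    have "((\<lambda>z. integral {x - 1..z} h) has_vector_derivative h x) (at x within {x - 1..x + 1})"
      by (intro integral_has_vector_derivative conth) auto
    then have "((\<lambda>z. integral {x - 1..z} h) has_vector_derivative h x) (at x within {x - 1<..<x + 1})"
      by (rule has_vector_derivative_within_subset) auto
    then have "((\<lambda>z. integral {x - 1..z} h) has_vector_derivative h x) (at x)"
      by (subst (asm) has_vector_derivative_within_open) auto
    then have "((\<lambda>z. H (x - 1) - integral {x - 1..z} h) has_vector_derivative 0 - h x) (at x)"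
      by (intro has_vector_derivative_diff has_vector_derivative_const)
    then have "(H has_vector_derivative 0 - h x) (at x)"
      by (rule has_vector_derivative_transform_within_open[where S = "{x - 1<..<x + 1}"]) (use eq in auto)
    then show ?thesis by simp
  qed
  have "(v has_vector_derivative \<i> * l * v x + \<i> * g x) (at x)" for x
  proof -
    have E: "((\<lambda>x. - \<i> * exp (\<i> * l * of_real x)) has_vector_derivative
        \<i> * l * (- \<i> * exp (\<i> * l * of_real x))) (at x)"
      by (rule has_vector_derivative_real_field)
         (auto intro!: derivative_eq_intros simp: algebra_simps)
    have "exp (\<i> * l * of_real x) * exp (- (\<i> * l * of_real x)) = 1"
      by (simp add: exp_minus)
    then have "- \<i> * exp (\<i> * l * of_real x) * - h x = \<i> * g x"
      unfolding h_def by (simp add: mult.assoc[symmetric])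
    with has_vector_derivative_mult[OF E derH[of x]] show ?thesis
      unfolding v_def by (simp add: algebra_simps)
  qed
  moreover have "\<bar>x\<bar> ^ c * norm (v x) \<le> 2 ^ c * (B + A * (fact c * (2 / m) ^ c)) * (2 / m)"
    if A: "\<forall>y. norm (g y) \<le> A" and B: "\<forall>y. \<bar>y\<bar> ^ c * norm (g y) \<le> B" for c A B x
  proof -
    define K where "K = 2 ^ c * (B + A * (fact c * (2 / m) ^ c))"
    have A': "0 \<le> A" and B': "0 \<le> B"
      using A B norm_ge_zero order_trans mult_nonneg_nonneg zero_le_power abs_ge_zero by metis+
    have bd: "norm (\<bar>x\<bar> ^ c *\<^sub>R h y) \<le> K * exp (- m / 2 * x) * exp (- (m / 2) * y)"
      if y: "y \<in> {x..}" for y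
    proof -
      have "\<bar>x\<bar> ^ c \<le> (\<bar>y\<bar> + (y - x)) ^ c" using y by (intro power_mono) auto
      also have "\<dots> \<le> 2 ^ c * (\<bar>y\<bar> ^ c + (y - x) ^ c)"
        using y by (intro power_add_le_two_power) auto
      finally have "\<bar>x\<bar> ^ c * norm (g y) \<le> 2 ^ c * (\<bar>y\<bar> ^ c + (y - x) ^ c) * norm (g y)"
        by (intro mult_right_mono) auto
      also have "\<dots> = 2 ^ c * (\<bar>y\<bar> ^ c * norm (g y) + norm (g y) * (y - x) ^ c)"
        by (simp add: algebra_simps)
      also have "\<dots> \<le> 2 ^ c * (B * exp (m / 2 * (y - x)) +
          A * (fact c * (1 / (m / 2)) ^ c * exp (m / 2 * (y - x))))"
      proof (rule mult_left_mono[OF add_mono[OF _ mult_mono]])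
        show "\<bar>y\<bar> ^ c * norm (g y) \<le> B * exp (m / 2 * (y - x))"
          using B B' m y by (intro order_trans[OF B[rule_format]]) (auto simp: mult_le_cancel_left1)
        show "(y - x) ^ c \<le> fact c * (1 / (m / 2)) ^ c * exp (m / 2 * (y - x))"
          using y m by (intro power_le_fact_exp) auto
      qed (use A A' y in auto)
      also have "\<dots> = K * exp (m / 2 * (y - x))" by (simp add: K_def algebra_simps)
      finally have "\<bar>x\<bar> ^ c * norm (h y) \<le> K * exp (- m / 2 * x) * exp (- (m / 2) * y)" by (rule maj)
      then show ?thesis by simp
    qed
    have "norm (integral {x..} (\<lambda>y. \<bar>x\<bar> ^ c *\<^sub>R h y)) \<le>
        integral {x..} (\<lambda>y. K * exp (- m / 2 * x) * exp (- (m / 2) * y))"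
      using bd majint by (intro integral_norm_bound_integral integrable_cmul int_h) auto
    also have "\<dots> = K * exp (- m * x) * (2 / m)" by (rule integral_unique[OF majint])
    finally have "\<bar>x\<bar> ^ c * norm (H x) \<le> K * exp (- m * x) * (2 / m)"
      by (simp add: H_def)
    then have "exp (m * x) * (\<bar>x\<bar> ^ c * norm (H x)) \<le> exp (m * x) * (K * exp (- m * x) * (2 / m))"
      by (intro mult_left_mono) auto
    also have "\<dots> = K * (2 / m) * (exp (m * x) * exp (- m * x))" by simp
    also have "exp (m * x) * exp (- m * x) = 1" by (simp add: exp_minus)
    finally have "exp (m * x) * (\<bar>x\<bar> ^ c * norm (H x)) \<le> K * (2 / m)" by simp
    moreover have "norm (v x) = exp (m * x) * norm (H x)"
      by (simp add: v_def norm_mult m_def)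
    ultimately show ?thesis by (simp add: K_def mult_ac)
  qed
  ultimately show ?thesis unfolding m(2) by blast
qed

text \<open>
The upper half plane reduces to the lower one by the reflection \<open>x \<mapsto> -x\<close>.
\<close>

lemma resolvent:
  fixes g :: "real \<Rightarrow> complex" and l :: complex
  assumes l: "Im l \<noteq> 0" and cont: "continuous_on UNIV g" and bdd: "bounded (range g)"
  shows "\<exists>v. (\<forall>x. (v has_vector_derivative \<i> * l * v x + \<i> * g x) (at x)) \<and>
    (\<forall>c A B x. (\<forall>y. norm (g y) \<le> A) \<longrightarrow> (\<forall>y. \<bar>y\<bar> ^ c * norm (g y) \<le> B) \<longrightarrow>
       \<bar>x\<bar> ^ c * norm (v x) \<le> 2 ^ c * (B + A * (fact c * (2 / \<bar>Im l\<bar>) ^ c)) * (2 / \<bar>Im l\<bar>))"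
proof (cases "Im l < 0")
  case True
  then show ?thesis using resolvent_lower_half_plane[OF _ cont bdd] by blast
next
  case False
  with l have "Im (- l) < 0" by simp
  moreover have "continuous_on UNIV (\<lambda>y. - g (- y))"
    by (intro continuous_intros continuous_on_compose2[OF cont]) auto
  moreover have "bounded (range (\<lambda>y. - g (- y)))"
    using bdd by (auto simp: bounded_iff)
  ultimately obtain w where w: "\<And>x. (w has_vector_derivative \<i> * (- l) * w x + \<i> * - g (- x)) (at x)"
    and bd: "\<And>c A B x. (\<forall>y. norm (- g (- y)) \<le> A) \<Longrightarrow> (\<forall>y. \<bar>y\<bar> ^ c * norm (- g (- y)) \<le> B) \<Longrightarrow>
       \<bar>x\<bar> ^ c * norm (w x) \<le> 2 ^ c * (B + A * (fact c * (2 / \<bar>Im (- l)\<bar>) ^ c)) * (2 / \<bar>Im (- l)\<bar>)"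
    using resolvent_lower_half_plane[of "- l" "\<lambda>y. - g (- y)"] by blast
  define v where "v x = w (- x)" for x
  have "(v has_vector_derivative \<i> * l * v x + \<i> * g x) (at x)" for x
  proof -
    have "((w \<circ> uminus) has_vector_derivative (- 1) *\<^sub>R (\<i> * (- l) * w (- x) + \<i> * - g (- (- x)))) (at x)"
      using w[of "- x"] by (intro vector_diff_chain_at) (auto intro!: derivative_eq_intros)
    then show ?thesis by (simp add: v_def[abs_def] o_def algebra_simps)
  qed
  moreover have "\<bar>x\<bar> ^ c * norm (v x) \<le> 2 ^ c * (B + A * (fact c * (2 / \<bar>Im l\<bar>) ^ c)) * (2 / \<bar>Im l\<bar>)"
    if "\<forall>y. norm (g y) \<le> A" "\<forall>y. \<bar>y\<bar> ^ c * norm (g y) \<le> B" for c A B x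
    using bd[of A c B "- x"] that(1) that(2)[rule_format, of "- _"] by (simp add: v_def)
  ultimately show ?thesis by blast
qed

section \<open>Rapidly decaying families of functions on the line\<close>

definition moderate :: "(nat \<Rightarrow> complex) \<Rightarrow> bool" where
  "moderate m \<longleftrightarrow> (\<exists>C M. \<forall>n. norm (m n) \<le> C * (1 + real n) ^ M)"

lemma moderateE:
  assumes "moderate m"
  obtains C M where "1 \<le> C" "\<And>n. norm (m n) \<le> C * (1 + real n) ^ M"
proof -
  obtain C M where C: "\<And>n. norm (m n) \<le> C * (1 + real n) ^ M"
    using assms by (auto simp: moderate_def)
  have "norm (m n) \<le> max 1 C * (1 + real n) ^ M" for n
    by (rule order_trans[OF C]) (intro mult_right_mono, auto)
  then show ?thesis using that[of "max 1 C" M] by auto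
qed

lemma moderate_const [simp]: "moderate (\<lambda>n. a)"
  unfolding moderate_def by (intro exI[of _ "norm a"] exI[of _ 0]) auto

lemma moderate_mult:
  assumes "moderate m" "moderate k"
  shows "moderate (\<lambda>n. m n * k n)"
proof -
  obtain C M where C: "1 \<le> C" "\<And>n. norm (m n) \<le> C * (1 + real n) ^ M" by (metis assms(1) moderateE)
  obtain D K where D: "1 \<le> D" "\<And>n. norm (k n) \<le> D * (1 + real n) ^ K" by (metis assms(2) moderateE)
  have "norm (m n * k n) \<le> (C * D) * (1 + real n) ^ (M + K)" for n
  proof -
    have "norm (m n) * norm (k n) \<le> (C * (1 + real n) ^ M) * (D * (1 + real n) ^ K)"
      using C D by (intro mult_mono) auto
    then show ?thesis by (simp add: norm_mult power_add mult_ac)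
  qed
  then show ?thesis unfolding moderate_def by blast
qed

lemma moderate_add:
  assumes "moderate m" "moderate k"
  shows "moderate (\<lambda>n. m n + k n)"
proof -
  obtain C M where C: "1 \<le> C" "\<And>n. norm (m n) \<le> C * (1 + real n) ^ M" by (metis assms(1) moderateE)
  obtain D K where D: "1 \<le> D" "\<And>n. norm (k n) \<le> D * (1 + real n) ^ K" by (metis assms(2) moderateE)
  have "norm (m n + k n) \<le> (C + D) * (1 + real n) ^ (M + K)" for n
  proof -
    have "C * (1 + real n) ^ M \<le> C * (1 + real n) ^ (M + K)"
      "D * (1 + real n) ^ K \<le> D * (1 + real n) ^ (M + K)"
      using C D by (auto intro!: mult_left_mono power_increasing)
    with C(2)[of n] D(2)[of n] norm_triangle_ineq[of "m n" "k n"] show ?thesis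
      by (simp add: algebra_simps)
  qed
  then show ?thesis unfolding moderate_def by blast
qed

lemma moderate_poly:
  assumes "moderate m"
  shows "moderate (\<lambda>n. poly p (m n))"
  by (induction p) (auto intro!: moderate_add moderate_mult assms)

definition rapid_decay :: "(nat \<Rightarrow> real \<Rightarrow> complex) \<Rightarrow> bool" where
  "rapid_decay F \<longleftrightarrow> (\<forall>N c. \<exists>C. \<forall>n x. (1 + real n) ^ N * \<bar>x\<bar> ^ c * norm (F n x) \<le> C)"

lemma rapid_decayE:
  assumes "rapid_decay F"
  obtains C where "0 \<le> C" "\<And>n x. (1 + real n) ^ N * \<bar>x\<bar> ^ c * norm (F n x) \<le> C"
proof -
  obtain C where C: "\<And>n x. (1 + real n) ^ N * \<bar>x\<bar> ^ c * norm (F n x) \<le> C"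
    using assms unfolding rapid_decay_def by blast
  have "0 \<le> (1 + real 0) ^ N * \<bar>0\<bar> ^ c * norm (F 0 0)" by simp
  with C[of 0 0] have "0 \<le> C" by linarith
  with C show ?thesis using that by blast
qed

lemma rapid_decay_moderate_mult:
  assumes "rapid_decay F" "moderate m"
  shows "rapid_decay (\<lambda>n x. m n * F n x)"
  unfolding rapid_decay_def
proof (intro allI)
  fix N c
  obtain C M where C: "1 \<le> C" "\<And>n. norm (m n) \<le> C * (1 + real n) ^ M" by (metis assms(2) moderateE)
  obtain D where D: "0 \<le> D" "\<And>n x. (1 + real n) ^ (N + M) * \<bar>x\<bar> ^ c * norm (F n x) \<le> D"
    by (metis assms(1) rapid_decayE)
  have "(1 + real n) ^ N * \<bar>x\<bar> ^ c * norm (m n * F n x) \<le> C * D" for n x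
  proof -
    have "(1 + real n) ^ N * \<bar>x\<bar> ^ c * norm (m n * F n x) =
        norm (m n) * ((1 + real n) ^ N * \<bar>x\<bar> ^ c * norm (F n x))" by (simp add: norm_mult mult_ac)
    also have "\<dots> \<le> (C * (1 + real n) ^ M) * ((1 + real n) ^ N * \<bar>x\<bar> ^ c * norm (F n x))"
      using C by (intro mult_right_mono) auto
    also have "\<dots> = C * ((1 + real n) ^ (N + M) * \<bar>x\<bar> ^ c * norm (F n x))"
      by (simp add: power_add mult_ac)
    also have "\<dots> \<le> C * D" using C D by (intro mult_left_mono) auto
    finally show ?thesis .
  qed
  then show "\<exists>C. \<forall>n x. (1 + real n) ^ N * \<bar>x\<bar> ^ c * norm (m n * F n x) \<le> C" by blast
qed

lemma rapid_decay_add: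
  assumes "rapid_decay F" "rapid_decay G"
  shows "rapid_decay (\<lambda>n x. F n x + G n x)"
  unfolding rapid_decay_def
proof (intro allI)
  fix N c
  obtain C where C: "\<And>n x. (1 + real n) ^ N * \<bar>x\<bar> ^ c * norm (F n x) \<le> C"
    by (metis assms(1) rapid_decayE)
  obtain D where D: "\<And>n x. (1 + real n) ^ N * \<bar>x\<bar> ^ c * norm (G n x) \<le> D"
    by (metis assms(2) rapid_decayE)
  have "(1 + real n) ^ N * \<bar>x\<bar> ^ c * norm (F n x + G n x) \<le> C + D" for n x
  proof -
    have "(1 + real n) ^ N * \<bar>x\<bar> ^ c * norm (F n x + G n x) \<le>
        (1 + real n) ^ N * \<bar>x\<bar> ^ c * (norm (F n x) + norm (G n x))"
      by (intro mult_left_mono norm_triangle_ineq) auto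
    with C[of n x] D[of n x] show ?thesis by (simp add: algebra_simps)
  qed
  then show "\<exists>C. \<forall>n x. (1 + real n) ^ N * \<bar>x\<bar> ^ c * norm (F n x + G n x) \<le> C" by blast
qed

text \<open>
Families of Schwartz functions on the line whose seminorms decrease faster than any power of the index.
The coinductive form says that decay is inherited by all derivatives, so that closure
properties need only be checked for one derivative at a time.
\<close>

coinductive rapid :: "(nat \<Rightarrow> real \<Rightarrow> complex) \<Rightarrow> bool" where
  rapidI: "rapid_decay F \<Longrightarrow> (\<And>n x. (F n has_vector_derivative F' n x) (at x)) \<Longrightarrow> rapid F' \<Longrightarrow> rapid F"

lemma rapid_imp_rapid_decay: "rapid F \<Longrightarrow> rapid_decay F"
  by (erule rapid.cases) auto

lemma rapidE:
  assumes "rapid F"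
  obtains F' where "rapid F'" "\<And>n x. (F n has_vector_derivative F' n x) (at x)"
  using assms by (rule rapid.cases) blast

lemma rapid_continuous: "rapid F \<Longrightarrow> continuous_on A (F n)"
  by (meson rapidE has_vector_derivative_continuous continuous_at_imp_continuous_on)

lemma rapid_coinduct [consumes 1, case_names rapid]:
  assumes "X F"
    and "\<And>F. X F \<Longrightarrow> rapid_decay F \<and>
      (\<exists>F'. (\<forall>n x. (F n has_vector_derivative F' n x) (at x)) \<and> X F')"
  shows "rapid F"
  using assms(1)
proof (coinduction arbitrary: F rule: rapid.coinduct)
  case (rapid F)
  then show ?case using assms(2) by blast
qed

lemma rapid_moderate_mult_add:
  assumes "rapid F" "rapid G" "moderate m"
  shows "rapid (\<lambda>n x. m n * F n x + G n x)"
  using assms(1,2)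
proof (coinduction arbitrary: F G rule: rapid_coinduct)
  case (rapid F G)
  obtain F' where F': "rapid F'" "\<And>n x. (F n has_vector_derivative F' n x) (at x)"
    using rapid(1) by (rule rapidE) blast
  obtain G' where G': "rapid G'" "\<And>n x. (G n has_vector_derivative G' n x) (at x)"
    using rapid(2) by (rule rapidE) blast
  have decay: "rapid_decay (\<lambda>n x. m n * F n x + G n x)"
    using rapid assms(3) by (intro rapid_decay_add rapid_decay_moderate_mult rapid_imp_rapid_decay)
  have "((\<lambda>x. m n * F n x + G n x) has_vector_derivative m n * F' n x + G' n x) (at x)" for n x
    using F' G' by (intro has_vector_derivative_add has_vector_derivative_mult_right)
  moreover have "\<exists>F G. (\<lambda>n x. m n * F' n x + G' n x) = (\<lambda>n x. m n * F n x + G n x) \<and> rapid F \<and> rapid G"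
    using F'(1) G'(1) by (intro exI[of _ F', OF exI[of _ G']]) auto
  ultimately have "\<exists>H. (\<forall>n x. ((\<lambda>x. m n * F n x + G n x) has_vector_derivative H n x) (at x)) \<and>
        (\<exists>F G. H = (\<lambda>n x. m n * F n x + G n x) \<and> rapid F \<and> rapid G)"
    by (rule_tac x = "\<lambda>n x. m n * F' n x + G' n x" in exI) simp
  with decay show ?case by (rule conjI)
qed

lemma rapid_zero: "rapid (\<lambda>n x. 0)"
proof (rule rapid_coinduct[where X = "\<lambda>F. F = (\<lambda>n x. 0)"], rule refl)
  fix F :: "nat \<Rightarrow> real \<Rightarrow> complex"
  assume "F = (\<lambda>n x. 0)"
  then show "rapid_decay F \<and>
      (\<exists>F'. (\<forall>n x. (F n has_vector_derivative F' n x) (at x)) \<and> F' = (\<lambda>n x. 0))"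
    by (auto simp: rapid_decay_def)
qed

lemma rapid_add: "rapid F \<Longrightarrow> rapid G \<Longrightarrow> rapid (\<lambda>n x. F n x + G n x)"
  using rapid_moderate_mult_add[of F G "\<lambda>_. 1"] by simp

lemma rapid_moderate_mult: "rapid F \<Longrightarrow> moderate m \<Longrightarrow> rapid (\<lambda>n x. m n * F n x)"
  using rapid_moderate_mult_add[of F "\<lambda>n x. 0" m] rapid_zero by simp

text \<open>
A power of \<open>n\<close> is lost through \<open>1 / \<bar>Im (l n)\<bar>\<close> and absorbed by the rapid decrease of \<open>G\<close>.
The derivatives of \<open>V\<close> are controlled by the equation itself, which expresses \<open>V'\<close> by \<open>V\<close> and
\<open>G\<close>: the combinations \<open>m V + F\<close> with moderate \<open>m\<close> and rapid \<open>F\<close> are closed under differentiation.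
\<close>

lemma rapid_resolvent:
  assumes G: "rapid G" and l: "moderate l" and Im: "\<And>n. Im (l n) \<noteq> 0"
    and invIm: "moderate (\<lambda>n. of_real (1 / Im (l n)))"
  shows "\<exists>V. rapid V \<and> (\<forall>n x. (V n has_vector_derivative \<i> * l n * V n x + \<i> * G n x) (at x))"
proof -
  have "bounded (range (G n))" for n
  proof -
    obtain C where "\<And>n x. (1 + real n) ^ 0 * \<bar>x\<bar> ^ 0 * norm (G n x) \<le> C"
      by (metis rapid_imp_rapid_decay[OF G] rapid_decayE)
    then show ?thesis by (auto simp: bounded_iff)
  qed
  then have "\<forall>n. \<exists>v. (\<forall>x. (v has_vector_derivative \<i> * l n * v x + \<i> * G n x) (at x)) \<and>
    (\<forall>c A B x. (\<forall>y. norm (G n y) \<le> A) \<longrightarrow> (\<forall>y. \<bar>y\<bar> ^ c * norm (G n y) \<le> B) \<longrightarrow>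
       \<bar>x\<bar> ^ c * norm (v x) \<le> 2 ^ c * (B + A * (fact c * (2 / \<bar>Im (l n)\<bar>) ^ c)) * (2 / \<bar>Im (l n)\<bar>))"
    using resolvent[OF Im rapid_continuous[OF G]] by blast
  then obtain V where V: "\<And>n x. (V n has_vector_derivative \<i> * l n * V n x + \<i> * G n x) (at x)"
    and bd: "\<And>n c A B x. (\<forall>y. norm (G n y) \<le> A) \<Longrightarrow> (\<forall>y. \<bar>y\<bar> ^ c * norm (G n y) \<le> B) \<Longrightarrow>
       \<bar>x\<bar> ^ c * norm (V n x) \<le> 2 ^ c * (B + A * (fact c * (2 / \<bar>Im (l n)\<bar>) ^ c)) * (2 / \<bar>Im (l n)\<bar>)"
    by metis
  have decV: "rapid_decay V"
    unfolding rapid_decay_def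
  proof (intro allI)
    fix N c
    obtain C M where C: "1 \<le> C" "\<And>n. norm (of_real (1 / Im (l n)) :: complex) \<le> C * (1 + real n) ^ M"
      by (metis invIm moderateE)
    define N' where "N' = N + M * c + M"
    obtain A where A: "0 \<le> A" "\<And>n x. (1 + real n) ^ N' * \<bar>x\<bar> ^ 0 * norm (G n x) \<le> A"
      by (metis rapid_imp_rapid_decay[OF G] rapid_decayE)
    obtain B where B: "0 \<le> B" "\<And>n x. (1 + real n) ^ N' * \<bar>x\<bar> ^ c * norm (G n x) \<le> B"
      by (metis rapid_imp_rapid_decay[OF G] rapid_decayE)
    have "(1 + real n) ^ N * \<bar>x\<bar> ^ c * norm (V n x) \<le> 2 ^ c * (B + A * (fact c * (2 * C) ^ c)) * (2 * C)" for n x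
    proof -
      define y where "y = 1 + real n"
      have y: "1 \<le> y" by (simp add: y_def)
      have r: "2 / \<bar>Im (l n)\<bar> \<le> 2 * C * y ^ M"
        using C(2)[of n] by (simp add: y_def norm_divide)
      have "\<bar>x\<bar> ^ c * norm (V n x) \<le>
          2 ^ c * (B / y ^ N' + A / y ^ N' * (fact c * (2 / \<bar>Im (l n)\<bar>) ^ c)) * (2 / \<bar>Im (l n)\<bar>)"
        using A(2)[of n] B(2)[of n] y
        by (intro bd) (auto simp: field_simps y_def)
      also have "\<dots> \<le> 2 ^ c * (B / y ^ N' + A / y ^ N' * (fact c * (2 * C * y ^ M) ^ c)) * (2 * C * y ^ M)"
        using r A B C y by (intro mult_mono add_mono power_mono order_refl) (auto intro!: mult_nonneg_nonneg add_nonneg_nonneg)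
      also have "\<dots> = 2 ^ c * (B + A * (fact c * ((2 * C) ^ c * y ^ (M * c)))) * (2 * C) * (y ^ M / y ^ N')"
        by (simp add: power_mult_distrib power_mult add_divide_distrib algebra_simps)
      also have "\<dots> \<le> 2 ^ c * (B * y ^ (M * c) + A * (fact c * ((2 * C) ^ c * y ^ (M * c)))) * (2 * C) * (y ^ M / y ^ N')"
        using A B C y by (intro mult_mono add_mono order_refl)
          (auto intro!: mult_nonneg_nonneg add_nonneg_nonneg simp: mult_le_cancel_left1)
      also have "\<dots> = 2 ^ c * (B + A * (fact c * (2 * C) ^ c)) * (2 * C) * (y ^ (M * c + M) / y ^ N')"
        by (simp add: power_add add_divide_distrib algebra_simps)
      finally have "y ^ N * (\<bar>x\<bar> ^ c * norm (V n x)) \<le>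
          y ^ N * (2 ^ c * (B + A * (fact c * (2 * C) ^ c)) * (2 * C) * (y ^ (M * c + M) / y ^ N'))"
        using y by (intro mult_left_mono) auto
      also have "\<dots> = 2 ^ c * (B + A * (fact c * (2 * C) ^ c)) * (2 * C) * (y ^ N * y ^ (M * c + M) / y ^ N')"
        by simp
      also have "y ^ N * y ^ (M * c + M) / y ^ N' = 1"
        using y unfolding N'_def power_add[symmetric] by (simp add: add.assoc)
      finally show ?thesis by (simp add: y_def mult.assoc)
    qed
    then show "\<exists>C. \<forall>n x. (1 + real n) ^ N * \<bar>x\<bar> ^ c * norm (V n x) \<le> C" by blast
  qed
  have closed: "rapid (\<lambda>n x. m n * V n x + F n x)" if "moderate m" "rapid F" for m F
    using that
  proof (coinduction arbitrary: m F rule: rapid_coinduct)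
    case (rapid m F)
    obtain F' where F': "rapid F'" "\<And>n x. (F n has_vector_derivative F' n x) (at x)"
      using rapid(2) by (rule rapidE) blast
    have "rapid_decay (\<lambda>n x. m n * V n x + F n x)"
      by (rule rapid_decay_add[OF rapid_decay_moderate_mult[OF decV rapid(1)] rapid_imp_rapid_decay[OF rapid(2)]])
    moreover have "((\<lambda>x. m n * V n x + F n x) has_vector_derivative
        (m n * (\<i> * l n)) * V n x + (m n * \<i> * G n x + F' n x)) (at x)" for n x
    proof -
      have "((\<lambda>x. m n * V n x + F n x) has_vector_derivative
          m n * (\<i> * l n * V n x + \<i> * G n x) + F' n x) (at x)"
        using V F' by (intro has_vector_derivative_add has_vector_derivative_mult_right)
      then show ?thesis by (simp add: algebra_simps)
    qed
    moreover have "moderate (\<lambda>n. m n * (\<i> * l n))" "moderate (\<lambda>n. m n * \<i>)"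
      using rapid l by (auto intro!: moderate_mult)
    ultimately show ?case using F'(1) G
      by (intro conjI exI[of _ "\<lambda>n x. (m n * (\<i> * l n)) * V n x + (m n * \<i> * G n x + F' n x)"])
         (auto intro!: exI[of _ "\<lambda>n. m n * (\<i> * l n)"] exI[of _ "\<lambda>n x. m n * \<i> * G n x + F' n x"]
            rapid_moderate_mult_add)
  qed
  show ?thesis using closed[of "\<lambda>_. 1" "\<lambda>n x. 0"] rapid_zero V by auto
qed

section \<open>Constant coefficient equations for families on the line\<close>

definition D1 :: "(real \<Rightarrow> complex) \<Rightarrow> real \<Rightarrow> complex" where
  "D1 g = (\<lambda>x. - \<i> * vector_derivative g (at x))"

definition poly_D1 :: "complex poly \<Rightarrow> (real \<Rightarrow> complex) \<Rightarrow> real \<Rightarrow> complex" where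
  "poly_D1 p g = (\<lambda>x. \<Sum>j\<le>degree p. coeff p j * (D1 ^^ j) g x)"

lemma poly_D1_eq_sum:
  assumes "degree p \<le> N"
  shows "poly_D1 p g x = (\<Sum>j\<le>N. coeff p j * (D1 ^^ j) g x)"
  unfolding poly_D1_def by (rule sum.mono_neutral_left) (use assms in \<open>auto simp: coeff_eq_0\<close>)

lemma poly_D1_add: "poly_D1 (p + q) g x = poly_D1 p g x + poly_D1 q g x"
proof -
  define N where "N = max (degree p) (degree q)"
  have "degree p \<le> N" "degree q \<le> N" "degree (p + q) \<le> N"
    unfolding N_def by (auto intro: degree_add_le_max)
  then show ?thesis by (simp add: poly_D1_eq_sum[of _ N] sum.distrib algebra_simps)
qed

lemma poly_D1_const: "poly_D1 [:a:] g x = a * g x"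
  by (simp add: poly_D1_def)

lemma poly_D1_smult: "poly_D1 (smult a p) g x = a * poly_D1 p g x"
proof -
  have "poly_D1 (smult a p) g x = (\<Sum>j\<le>degree p. coeff (smult a p) j * (D1 ^^ j) g x)"
    by (rule poly_D1_eq_sum) (rule degree_smult_le)
  then show ?thesis by (simp add: poly_D1_def sum_distrib_left mult_ac)
qed

lemma D1_lincomb:
  assumes "v differentiable (at x)" "w differentiable (at x)"
  shows "D1 (\<lambda>x. v x - l * w x) x = D1 v x - l * D1 w x"
proof -
  have "((\<lambda>x. v x - l * w x) has_vector_derivative
      vector_derivative v (at x) - l * vector_derivative w (at x)) (at x)"
    using assms by (intro has_vector_derivative_diff has_vector_derivative_mult_right)
      (simp_all add: vector_derivative_works)
  then show ?thesis by (simp add: D1_def vector_derivative_at algebra_simps)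
qed

lemma D1_funpow_linear_factor:
  assumes "\<And>j x. (D1 ^^ j) v differentiable (at x)"
  shows "(D1 ^^ j) (\<lambda>x. D1 v x - l * v x) = (\<lambda>x. (D1 ^^ Suc j) v x - l * (D1 ^^ j) v x)"
proof (induction j)
  case (Suc j)
  then have "(D1 ^^ Suc j) (\<lambda>x. D1 v x - l * v x) = D1 (\<lambda>x. (D1 ^^ Suc j) v x - l * (D1 ^^ j) v x)"
    by simp
  also have "\<dots> = (\<lambda>x. D1 ((D1 ^^ Suc j) v) x - l * D1 ((D1 ^^ j) v) x)"
    by (intro ext D1_lincomb assms)
  finally show ?case by simp
qed simp

text \<open>
Splitting off a linear factor of the polynomial means applying \<open>D1 - l\<close> first.
\<close>

lemma poly_D1_linear_factor:
  assumes "\<And>j x. (D1 ^^ j) v differentiable (at x)"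
  shows "poly_D1 ([:- l, 1:] * p) v x = poly_D1 p (\<lambda>x. D1 v x - l * v x) x"
proof -
  have "poly_D1 (pCons 0 p) v x = (\<Sum>j\<le>Suc (degree p). coeff (pCons 0 p) j * (D1 ^^ j) v x)"
    by (rule poly_D1_eq_sum) (rule degree_pCons_le)
  also have "\<dots> = (\<Sum>j\<le>degree p. coeff p j * (D1 ^^ Suc j) v x)"
    by (subst sum.atMost_Suc_shift) simp
  finally have "poly_D1 (smult (- l) p + pCons 0 p) v x =
      (\<Sum>j\<le>degree p. coeff p j * (D1 ^^ Suc j) v x) - l * (\<Sum>j\<le>degree p. coeff p j * (D1 ^^ j) v x)"
    by (simp only: poly_D1_add poly_D1_smult) (simp add: poly_D1_def)
  also have "\<dots> = (\<Sum>j\<le>degree p. coeff p j * ((D1 ^^ Suc j) v x - l * (D1 ^^ j) v x))"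
    by (simp add: algebra_simps sum_subtractf sum_distrib_left)
  also have "\<dots> = poly_D1 p (\<lambda>x. D1 v x - l * v x) x"
    unfolding poly_D1_def D1_funpow_linear_factor[OF assms] ..
  finally show ?thesis by simp
qed

lemma rapid_D1:
  assumes "rapid F"
  shows "rapid (\<lambda>n. D1 (F n))"
proof -
  obtain F' where F': "rapid F'" "\<And>n x. (F n has_vector_derivative F' n x) (at x)"
    using assms by (rule rapidE) blast
  have "(\<lambda>n. D1 (F n)) = (\<lambda>n x. - \<i> * F' n x)"
    using F'(2) by (auto simp: D1_def fun_eq_iff vector_derivative_at)
  then show ?thesis using rapid_moderate_mult[OF F'(1), of "\<lambda>_. - \<i>"] by simp
qed

lemma rapid_D1_funpow: "rapid F \<Longrightarrow> rapid (\<lambda>n. (D1 ^^ j) (F n))"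
  by (induction j) (auto dest: rapid_D1)

lemma rapid_differentiable: "rapid F \<Longrightarrow> F n differentiable (at x)"
  by (meson rapidE differentiableI_vector)

text \<open>
The linear factors are inverted one after the other by resolvents.
\<close>

lemma poly_D1_factored_solvable:
  fixes ls :: "nat \<Rightarrow> complex list"
  assumes "rapid f" "\<And>n. length (ls n) = d"
    and "\<And>n l. l \<in> set (ls n) \<Longrightarrow> Im l \<noteq> 0"
    and "\<And>n l. l \<in> set (ls n) \<Longrightarrow> norm l \<le> C * (1 + real n) ^ M"
    and "\<And>n l. l \<in> set (ls n) \<Longrightarrow> 1 / \<bar>Im l\<bar> \<le> C * (1 + real n) ^ M"
  shows "\<exists>V. rapid V \<and> (\<forall>n x. poly_D1 (\<Prod>l\<leftarrow>ls n. [:- l, 1:]) (V n) x = f n x)"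
  using assms
proof (induction d arbitrary: ls)
  case 0
  then have "ls n = []" for n by simp
  then show ?case using \<open>rapid f\<close> by (intro exI[of _ f]) (simp add: poly_D1_def)
next
  case (Suc d)
  define l where "l n = hd (ls n)" for n
  define ls' where "ls' n = tl (ls n)" for n
  have ls: "ls n = l n # ls' n" for n
    using Suc.prems(2)[of n] by (cases "ls n") (auto simp: l_def ls'_def)
  have "\<exists>V. rapid V \<and> (\<forall>n x. poly_D1 (\<Prod>l\<leftarrow>ls' n. [:- l, 1:]) (V n) x = f n x)"
    by (rule Suc.IH) (use Suc.prems ls in auto)
  then obtain W where W: "rapid W" "\<And>n x. poly_D1 (\<Prod>l\<leftarrow>ls' n. [:- l, 1:]) (W n) x = f n x"
    by blast
  have l: "Im (l n) \<noteq> 0" "norm (l n) \<le> C * (1 + real n) ^ M" "1 / \<bar>Im (l n)\<bar> \<le> C * (1 + real n) ^ M" for n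
    using Suc.prems(3-5)[of "l n" n] ls by auto
  have "\<exists>V. rapid V \<and> (\<forall>n x. (V n has_vector_derivative \<i> * l n * V n x + \<i> * W n x) (at x))"
  proof (rule rapid_resolvent[OF W(1)])
    show "moderate l" using l(2) by (auto simp: moderate_def)
    show "moderate (\<lambda>n. of_real (1 / Im (l n)))"
      unfolding moderate_def using l(3) by (intro exI[of _ C] exI[of _ M]) (auto simp: norm_divide)
  qed (rule l(1))
  then obtain V where V: "rapid V" "\<And>n x. (V n has_vector_derivative \<i> * l n * V n x + \<i> * W n x) (at x)"
    by blast
  have "(\<lambda>x. D1 (V n) x - l n * V n x) = W n" for n
    unfolding D1_def vector_derivative_at[OF V(2)] by (simp add: fun_eq_iff algebra_simps)
  moreover have "(D1 ^^ j) (V n) differentiable (at x)" for j n x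
    by (rule rapid_differentiable[OF rapid_D1_funpow[OF V(1)]])
  ultimately have "poly_D1 (\<Prod>l\<leftarrow>ls n. [:- l, 1:]) (V n) x = f n x" for n x
    using W(2) by (simp add: ls poly_D1_linear_factor del: mult_pCons_left)
  with V(1) show ?case by blast
qed

text \<open>
A quantitative mean value estimate, used to compare the symbol at a root with the symbol at the
real part of that root; the constant term \<open>q(k)\<close> cancels in the difference.
\<close>

lemma poly_difference_bound:
  fixes p :: "complex poly"
  shows "\<exists>C\<ge>0. \<forall>z w R. norm z \<le> R \<longrightarrow> norm w \<le> R \<longrightarrow>
    norm (poly p z - poly p w) \<le> C * (1 + R) ^ degree p * norm (z - w)"
proof (induction p)
  case (pCons a p)
  show ?case
  proof (cases "p = 0")
    case False
    obtain C where C: "C \<ge> 0" "\<And>z w R. norm z \<le> R \<Longrightarrow> norm w \<le> R \<Longrightarrow>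
      norm (poly p z - poly p w) \<le> C * (1 + R) ^ degree p * norm (z - w)"
      using pCons.IH by blast
    define K where "K = norm (poly p 0) + C"
    have "norm (poly (pCons a p) z - poly (pCons a p) w) \<le> (C + K) * (1 + R) ^ Suc (degree p) * norm (z - w)"
      if zw: "norm z \<le> R" "norm w \<le> R" for z w R
    proof -
      have R: "0 \<le> R" using zw norm_ge_zero order_trans by blast
      have "norm (poly p w) \<le> norm (poly p 0) + norm (poly p w - poly p 0)"
        using norm_triangle_ineq[of "poly p 0" "poly p w - poly p 0"] by simp
      also have "norm (poly p w - poly p 0) \<le> C * (1 + R) ^ degree p * norm (w - 0)"
        using zw R by (intro C) auto
      also have "\<dots> \<le> C * (1 + R) ^ degree p * (1 + R)"
        using zw R C by (intro mult_left_mono) auto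
      also have "norm (poly p 0) \<le> norm (poly p 0) * (1 + R) ^ Suc (degree p)"
        using R one_le_power[of "1 + R" "Suc (degree p)"] by (simp add: mult_le_cancel_left1 del: power_Suc)
      finally have w: "norm (poly p w) \<le> K * (1 + R) ^ Suc (degree p)"
        by (simp add: K_def algebra_simps)
      have "poly (pCons a p) z - poly (pCons a p) w = z * (poly p z - poly p w) + (z - w) * poly p w"
        by (simp add: algebra_simps)
      also have "norm \<dots> \<le> norm z * norm (poly p z - poly p w) + norm (z - w) * norm (poly p w)"
        by (metis norm_triangle_ineq norm_mult)
      also have "\<dots> \<le> (1 + R) * (C * (1 + R) ^ degree p * norm (z - w)) +
          norm (z - w) * (K * (1 + R) ^ Suc (degree p))"
        using zw R C w by (intro add_mono mult_mono) auto
      finally show ?thesis by (simp add: algebra_simps)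
    qed
    moreover have "0 \<le> C + K" using C by (simp add: K_def)
    ultimately show ?thesis using False by (intro exI[of _ "C + K"]) auto
  qed (auto intro: exI[of _ 0])
qed (auto intro: exI[of _ 0])

text \<open>
Cauchy's bound for the roots, uniform in the constant term.
\<close>

lemma poly_root_bound:
  fixes p :: "complex poly"
  assumes "degree p > 0"
  shows "\<exists>C. \<forall>b z. poly p z + b = 0 \<longrightarrow> norm z \<le> C * (1 + norm b)"
proof -
  obtain d where d: "degree p = Suc d" using assms by (cases "degree p") auto
  define a where "a = lead_coeff p"
  have a: "a \<noteq> 0" using assms by (auto simp: a_def)
  define S where "S = (\<Sum>i\<le>d. norm (coeff p i))"
  have S: "0 \<le> S" unfolding S_def by (intro sum_nonneg) auto
  have "norm z \<le> (1 + (S + 1) / norm a) * (1 + norm b)" if z: "poly p z + b = 0" for b z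
  proof (cases "norm z \<le> 1")
    case True
    have "1 * 1 \<le> (1 + (S + 1) / norm a) * (1 + norm b)"
      using S by (intro mult_mono) auto
    with True show ?thesis by linarith
  next
    case False
    then have z1: "1 \<le> norm z" by simp
    have "poly p z = (\<Sum>i\<le>d. coeff p i * z ^ i) + a * z ^ Suc d"
      unfolding poly_altdef d a_def by simp
    with z have "a * z ^ Suc d = - (b + (\<Sum>i\<le>d. coeff p i * z ^ i))"
      by (simp only: eq_neg_iff_add_eq_0 add_ac)
    then have "norm a * norm z ^ Suc d = norm (b + (\<Sum>i\<le>d. coeff p i * z ^ i))"
      by (metis norm_minus_cancel norm_mult norm_power)
    also have "\<dots> \<le> norm b + (\<Sum>i\<le>d. norm (coeff p i * z ^ i))"
      by (intro norm_triangle_le add_left_mono norm_sum)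
    also have "\<dots> \<le> norm b * norm z ^ d + (\<Sum>i\<le>d. norm (coeff p i) * norm z ^ d)"
    proof (intro add_mono sum_mono)
      have "norm b * 1 \<le> norm b * norm z ^ d"
        using one_le_power[OF z1, of d] by (intro mult_left_mono) auto
      then show "norm b \<le> norm b * norm z ^ d" by simp
      show "norm (coeff p i * z ^ i) \<le> norm (coeff p i) * norm z ^ d" if "i \<in> {..d}" for i
        unfolding norm_mult norm_power using that z1
        by (intro mult_left_mono power_increasing) auto
    qed
    also have "\<dots> = (norm b + S) * norm z ^ d"
      by (simp only: S_def distrib_right sum_distrib_right)
    finally have "(norm a * norm z) * norm z ^ d \<le> (norm b + S) * norm z ^ d"
      by (simp only: power_Suc mult.assoc)
    moreover have "0 < norm z ^ d" using z1 by (intro zero_less_power) linarith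
    ultimately have "norm a * norm z \<le> norm b + S" by (rule mult_right_le_imp_le)
    then have "norm z \<le> (norm b + S) / norm a" using a by (simp add: field_simps)
    also have "\<dots> \<le> (S + 1) * (1 + norm b) / norm a"
      using S by (intro divide_right_mono) (auto simp: algebra_simps)
    also have "\<dots> \<le> (1 + (S + 1) / norm a) * (1 + norm b)" by (simp add: algebra_simps)
    finally show ?thesis .
  qed
  then show ?thesis by blast
qed

text \<open>
The roots of \<open>p + b n\<close> grow at most polynomially in \<open>n\<close>, and by the lower bound on the
symbol their distance to the real axis shrinks at most polynomially.
\<close>

lemma poly_D1_family_solvable:
  fixes p :: "complex poly"
  assumes p: "degree p > 0" and b: "moderate b" and f: "rapid f" and c: "c > 0"
    and lower: "\<And>n \<xi>. c \<le> norm (poly p (of_real \<xi>) + b n)"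
  shows "\<exists>V. rapid V \<and> (\<forall>n x. poly_D1 p (V n) x + b n * V n x = f n x)"
proof -
  define a where "a = lead_coeff p"
  have a: "a \<noteq> 0" using p by (auto simp: a_def)
  define P where "P n = p + [:b n:]" for n
  have deg: "degree (P n) = degree p" "lead_coeff (P n) = a" for n
    using p by (auto simp: P_def a_def degree_add_eq_left coeff_eq_0)
  have "\<exists>xs. length xs = degree p \<and> P n = smult a (\<Prod>x\<leftarrow>xs. [:- x, 1:])" for n
  proof -
    have "P n \<noteq> 0" using deg(1)[of n] p by auto
    then obtain A where A: "size A = degree p" "P n = smult a (\<Prod>x\<in>#A. [:- x, 1:])"
      using alg_closed_imp_factorization[of "P n"] deg by auto
    obtain xs where "A = mset xs" using ex_mset by metis
    with A show ?thesis by (intro exI[of _ xs]) (simp flip: prod_mset_prod_list)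
  qed
  then obtain ls where ls: "\<And>n. length (ls n) = degree p"
    "\<And>n. P n = smult a (\<Prod>x\<leftarrow>ls n. [:- x, 1:])" by metis
  have root: "poly p l + b n = 0" if "l \<in> set (ls n)" for l n
  proof -
    have "poly (\<Prod>x\<leftarrow>xs. [:- x, 1:]) l = 0" if "l \<in> set xs" for xs
      using that by (induction xs) auto
    with that have "poly (P n) l = 0" by (simp add: ls(2))
    then show ?thesis by (simp add: P_def)
  qed
  obtain R0 where R0: "\<And>b z. poly p z + b = 0 \<Longrightarrow> norm z \<le> R0 * (1 + norm b)"
    using poly_root_bound[OF p] by blast
  have R0_nonneg: "0 \<le> R0"
  proof -
    have "norm (0 :: complex) \<le> R0 * (1 + norm (- poly p 0))" by (rule R0) simp
    moreover have "0 < 1 + norm (- poly p 0)" by (simp add: add_pos_nonneg)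
    ultimately show ?thesis by (metis norm_zero zero_le_mult_iff not_less)
  qed
  obtain B M where B: "1 \<le> B" "\<And>n. norm (b n) \<le> B * (1 + real n) ^ M"
    by (metis b moderateE)
  define R where "R n = 2 * R0 * B * (1 + real n) ^ M" for n
  have R: "norm l \<le> R n" if "l \<in> set (ls n)" for l n
  proof -
    have "norm l \<le> R0 * (1 + norm (b n))" using R0 root[OF that] by blast
    also have "\<dots> \<le> R0 * (B * (1 + real n) ^ M + B * (1 + real n) ^ M)"
    proof (intro mult_left_mono add_mono R0_nonneg B)
      have "1 * 1 \<le> B * (1 + real n) ^ M" using B(1) by (intro mult_mono) auto
      then show "1 \<le> B * (1 + real n) ^ M" by simp
    qed
    finally show ?thesis by (simp add: R_def)
  qed
  obtain K where K: "0 \<le> K" "\<And>z w R. norm z \<le> R \<Longrightarrow> norm w \<le> R \<Longrightarrow>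
      norm (poly p z - poly p w) \<le> K * (1 + R) ^ degree p * norm (z - w)"
    using poly_difference_bound[of p] by blast
  \<comment> \<open>A root close to the real axis would make the symbol small at its real part.\<close>
  have Im: "c \<le> K * (1 + R n) ^ degree p * \<bar>Im l\<bar>" if "l \<in> set (ls n)" for l n
  proof -
    have "c \<le> norm (poly p (of_real (Re l)) - poly p l)"
      using lower[of "Re l" n] root[OF that] by (simp add: add_eq_0_iff2)
    also have "\<dots> \<le> K * (1 + R n) ^ degree p * norm (of_real (Re l) - l)"
      using R[OF that] abs_Re_le_cmod[of l] by (intro K) auto
    also have "norm (of_real (Re l) - l) = \<bar>Im l\<bar>"
      by (simp add: cmod_def)
    finally show ?thesis .
  qed
  define C where "C = 2 * R0 * B + K / c * (1 + 2 * R0 * B) ^ degree p"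
  have "\<exists>W. rapid W \<and> (\<forall>n x. poly_D1 (\<Prod>l\<leftarrow>ls n. [:- l, 1:]) (W n) x = (1 / a) * f n x)"
  proof (rule poly_D1_factored_solvable[where C = C and M = "M * Suc (degree p)"])
    show "rapid (\<lambda>n x. (1 / a) * f n x)" by (intro rapid_moderate_mult f moderate_const)
    fix n l assume l: "l \<in> set (ls n)"
    define y where "y = 1 + real n"
    have y: "1 \<le> y" by (simp add: y_def)
    show nz: "Im l \<noteq> 0" using Im[OF l] c by auto
    have RB: "0 \<le> R0 * B" using R0_nonneg B by auto
    have y1: "y ^ M \<le> y ^ (M * Suc (degree p))" "y ^ (M * degree p) \<le> y ^ (M * Suc (degree p))"
      using y by (auto intro!: power_increasing)
    have "norm l \<le> (2 * R0 * B) * y ^ (M * Suc (degree p))"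
      using R0_nonneg B(1) y1 by (intro order_trans[OF R[OF l]]) (auto simp: R_def y_def intro!: mult_left_mono)
    also have "\<dots> \<le> C * y ^ (M * Suc (degree p))"
      using RB K c y unfolding C_def by (intro mult_right_mono) auto
    finally show "norm l \<le> C * (1 + real n) ^ (M * Suc (degree p))" by (simp add: y_def)
    have "0 \<le> R n" using R0_nonneg B(1) by (simp add: R_def)
    moreover have "1 + R n \<le> (1 + 2 * R0 * B) * y ^ M"
      using one_le_power[OF y, of M] by (simp add: R_def y_def algebra_simps)
    ultimately have "(1 + R n) ^ degree p \<le> ((1 + 2 * R0 * B) * y ^ M) ^ degree p"
      by (intro power_mono) auto
    also have "\<dots> = (1 + 2 * R0 * B) ^ degree p * y ^ (M * degree p)"
      by (simp add: power_mult_distrib power_mult)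
    also have "\<dots> \<le> (1 + 2 * R0 * B) ^ degree p * y ^ (M * Suc (degree p))"
      using RB y1(2) by (intro mult_left_mono) (auto simp: mult.assoc)
    finally have Rn: "(1 + R n) ^ degree p \<le> (1 + 2 * R0 * B) ^ degree p * y ^ (M * Suc (degree p))" .
    have "1 / \<bar>Im l\<bar> \<le> K / c * (1 + R n) ^ degree p"
      using Im[OF l] nz c by (simp add: field_simps)
    also have "\<dots> \<le> K / c * ((1 + 2 * R0 * B) ^ degree p * y ^ (M * Suc (degree p)))"
      using K c by (intro mult_left_mono Rn) auto
    also have "\<dots> = (K / c * (1 + 2 * R0 * B) ^ degree p) * y ^ (M * Suc (degree p))"
      by (simp only: mult.assoc)
    also have "\<dots> \<le> C * y ^ (M * Suc (degree p))"
      unfolding C_def using R0_nonneg B(1) y by (intro mult_right_mono) auto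
    finally show "1 / \<bar>Im l\<bar> \<le> C * (1 + real n) ^ (M * Suc (degree p))"
      by (simp only: y_def)
  qed (rule ls(1))
  then obtain W where W: "rapid W" "\<And>n x. poly_D1 (\<Prod>l\<leftarrow>ls n. [:- l, 1:]) (W n) x = (1 / a) * f n x"
    by blast
  have "poly_D1 p (W n) x + b n * W n x = f n x" for n x
  proof -
    have "poly_D1 p (W n) x + b n * W n x = poly_D1 (P n) (W n) x"
      by (simp add: P_def poly_D1_add poly_D1_const)
    also have "\<dots> = f n x" using a by (simp add: ls(2) poly_D1_smult W(2))
    finally show ?thesis .
  qed
  with W(1) show ?thesis by blast
qed

section \<open>Uniqueness of Fourier coefficients\<close>

definition coeffs_vanish :: "(real \<Rightarrow> complex) \<Rightarrow> bool" where
  "coeffs_vanish h \<longleftrightarrow> continuous_on UNIV h \<and>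
     (\<forall>k::int. integral {0..2 * pi} (\<lambda>t. cis (of_int k * t) * h t) = 0)"

lemma continuous_on_cis_mult:
  "continuous_on UNIV h \<Longrightarrow> continuous_on A (\<lambda>t. cis (a * t) * h t)"
  by (intro continuous_intros) (auto intro: continuous_on_subset)

lemma coeffs_vanish_lincomb:
  assumes "coeffs_vanish h" "coeffs_vanish h'"
  shows "coeffs_vanish (\<lambda>t. a * h t + b * h' t)"
  unfolding coeffs_vanish_def
proof (intro conjI allI)
  have c: "continuous_on UNIV h" "continuous_on UNIV h'" using assms by (auto simp: coeffs_vanish_def)
  then show "continuous_on UNIV (\<lambda>t. a * h t + b * h' t)" by (intro continuous_intros)
  fix k :: int
  have "integral {0..2 * pi} (\<lambda>t. a * (cis (of_int k * t) * h t) + b * (cis (of_int k * t) * h' t)) = 0"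
    using assms c
    by (subst integral_add)
       (auto simp: coeffs_vanish_def intro!: integrable_continuous_interval continuous_intros continuous_on_cis_mult
          intro: continuous_on_subset)
  then show "integral {0..2 * pi} (\<lambda>t. cis (of_int k * t) * (a * h t + b * h' t)) = 0"
    by (simp add: algebra_simps)
qed

lemma coeffs_vanish_shift:
  assumes "coeffs_vanish h"
  shows "coeffs_vanish (\<lambda>t. cis (of_int m * t) * h t)"
  unfolding coeffs_vanish_def
proof (intro conjI allI)
  show "continuous_on UNIV (\<lambda>t. cis (of_int m * t) * h t)"
    using assms by (intro continuous_on_cis_mult) (auto simp: coeffs_vanish_def)
  fix k :: int
  have "cis (of_int k * t) * (cis (of_int m * t) * h t) = cis (of_int (k + m) * t) * h t" for t
    unfolding mult.assoc[symmetric] cis_mult by (simp add: algebra_simps)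
  then show "integral {0..2 * pi} (\<lambda>t. cis (of_int k * t) * (cis (of_int m * t) * h t)) = 0"
    using assms unfolding coeffs_vanish_def by presburger
qed

text \<open>
Multiplication by \<open>cos\<close> and \<open>sin\<close> only shifts and combines the coefficients, so it preserves
their vanishing; polynomials in \<open>cos\<close> and \<open>sin\<close> follow by induction.
\<close>

lemma coeffs_vanish_real_polynomial:
  fixes q :: "complex \<Rightarrow> real"
  assumes "real_polynomial_function q" "coeffs_vanish h"
  shows "coeffs_vanish (\<lambda>t. of_real (q (cis t)) * h t)"
  using assms
proof (induction arbitrary: h rule: real_polynomial_function.induct)
  case (linear q)
  interpret bounded_linear q by fact
  have q: "q (cis t) = cos t * q 1 + sin t * q \<i>" for t
  proof -
    have "cis t = cos t *\<^sub>R 1 + sin t *\<^sub>R \<i>" by (simp add: complex_eq_iff)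
    then show ?thesis by (simp only: add scale real_scaleR_def)
  qed
  define a where "a = (of_real (q 1) - \<i> * of_real (q \<i>)) / 2"
  define b where "b = (of_real (q 1) + \<i> * of_real (q \<i>)) / 2"
  have "of_real (q (cis t)) * h t =
      a * (cis (of_int 1 * t) * h t) + b * (cis (of_int (- 1) * t) * h t)" for t
    unfolding q a_def b_def by (simp add: complex_eq_iff algebra_simps add_divide_distrib diff_divide_distrib)
  then show ?case
    using coeffs_vanish_lincomb[OF coeffs_vanish_shift[OF linear.prems] coeffs_vanish_shift[OF linear.prems], of a 1 b "- 1"]
    by presburger
next
  case (const c)
  then show ?case using coeffs_vanish_lincomb[of h h "of_real c" 0] by simp
next
  case (add f g)
  then show ?case
    using coeffs_vanish_lincomb[of "\<lambda>t. of_real (f (cis t)) * h t" "\<lambda>t. of_real (g (cis t)) * h t" 1 1]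
    by (simp add: algebra_simps)
next
  case (mult f g)
  then show ?case
    using mult.IH(1)[OF mult.IH(2)[OF mult.prems]] by (simp add: mult.assoc)
qed

lemma periodic_representative:
  fixes g :: "real \<Rightarrow> 'a"
  assumes "\<And>t. g (t + 2 * pi) = g t"
  shows "\<exists>s\<in>{0..2 * pi}. g s = g t"
proof -
  have n: "g (s + 2 * pi * real n) = g s" for s n
  proof (induction n)
    case (Suc n)
    have "g (s + 2 * pi * real (Suc n)) = g (s + 2 * pi * real n + 2 * pi)" by (simp add: algebra_simps)
    with Suc show ?case by (simp add: assms)
  qed simp
  have i: "g (s + 2 * pi * of_int k) = g s" for s and k :: int
  proof (cases "0 \<le> k")
    case True
    then show ?thesis using n[of s "nat k"] by simp
  next
    case False
    then show ?thesis using n[of "s + 2 * pi * of_int k" "nat (- k)"] by simp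
  qed
  define k where "k = \<lfloor>t / (2 * pi)\<rfloor>"
  have "of_int k \<le> t / (2 * pi)" "t / (2 * pi) < of_int k + 1" by (auto simp: k_def)
  then have "0 \<le> t - 2 * pi * of_int k" "t - 2 * pi * of_int k \<le> 2 * pi"
    by (auto simp: field_simps)
  moreover have "g (t - 2 * pi * of_int k) = g t"
    using i[of t "- k"] by simp
  ultimately show ?thesis by (intro bexI[of _ "t - 2 * pi * of_int k"]) auto
qed

text \<open>
The function on the circle has a compact graph, the continuous image of the graph of \<open>g\<close> over an
interval, and a map into a compact space with closed graph is continuous.
\<close>

lemma periodic_factors_through_circle:
  fixes g :: "real \<Rightarrow> complex"
  assumes cont: "continuous_on UNIV g" and per: "g (2 * pi) = g 0"
  shows "\<exists>G. continuous_on (sphere 0 1) G \<and> (\<forall>t\<in>{0..2 * pi}. G (cis t) = g t)"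
proof -
  define G where "G z = g (Arg2pi z)" for z
  have G: "G (cis t) = g t" if "t \<in> {0..2 * pi}" for t
  proof (cases "t = 2 * pi")
    case True
    then show ?thesis using per Arg2pi_unique[of 1 0 1] by (simp add: G_def)
  next
    case False
    then have "Arg2pi (cis t) = t"
      using that by (intro Arg2pi_unique[of 1]) (auto simp: cis_conv_exp)
    then show ?thesis by (simp add: G_def)
  qed
  have circle: "sphere 0 1 = cis ` {0..2 * pi}"
  proof (intro equalityI subsetI)
    fix z :: complex assume "z \<in> sphere 0 1"
    then have "z = cis (Arg2pi z)" using Arg2pi_eq[of z] by (simp add: cis_conv_exp)
    moreover have "Arg2pi z \<in> {0..2 * pi}" using Arg2pi[of z] by auto
    ultimately show "z \<in> cis ` {0..2 * pi}" by blast
  qed auto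
  have graph: "(\<lambda>z. (z, G z)) ` sphere 0 1 = (\<lambda>t. (cis t, g t)) ` {0..2 * pi}"
    unfolding circle image_image using G by (intro image_cong) auto
  have cg: "continuous_on {0..2 * pi} g" by (rule continuous_on_subset[OF cont]) auto
  have ct: "compact (g ` {0..2 * pi})" by (rule compact_continuous_image[OF cg]) auto
  have "compact ((\<lambda>t. (cis t, g t)) ` {0..2 * pi})"
    by (intro compact_continuous_image continuous_intros cg) auto
  then have "closed ((\<lambda>z. (z, G z)) ` sphere 0 1)"
    unfolding graph by (rule compact_imp_closed)
  moreover have sub: "G \<in> sphere 0 1 \<rightarrow> g ` {0..2 * pi}" unfolding circle using G by auto
  ultimately have "closedin (top_of_set (sphere 0 1 \<times> g ` {0..2 * pi})) ((\<lambda>z. (z, G z)) ` sphere 0 1)"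
    by (intro closed_subset) auto
  then have "continuous_on (sphere 0 1) G"
    using continuous_closed_graph_eq[OF ct sub] by blast
  with G show ?thesis by blast
qed

text \<open>
By the Stone-Weierstrass theorem \<open>g\<close> is a uniform limit of polynomials in \<open>cos\<close> and \<open>sin\<close>, to all of
which it is orthogonal.  Hence \<open>g\<close> is orthogonal to itself.
\<close>

lemma coeffs_vanish_imp_zero:
  assumes g: "coeffs_vanish g" and per: "\<And>t. g (t + 2 * pi) = g t"
  shows "g t = 0"
proof -
  have cont: "continuous_on A g" for A using g by (auto simp: coeffs_vanish_def intro: continuous_on_subset)
  obtain G where G: "continuous_on (sphere 0 1) G" "\<And>t. t \<in> {0..2 * pi} \<Longrightarrow> G (cis t) = g t"
    using periodic_factors_through_circle[OF cont] per[of 0] by auto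
  obtain A where A: "\<And>t. t \<in> {0..2 * pi} \<Longrightarrow> norm (g t) \<le> A"
    using compact_imp_bounded[OF compact_continuous_image[OF cont[of "{0..2 * pi}"]]]
    unfolding bounded_iff by blast
  have A0: "0 \<le> A" using A[of 0] order_trans[OF norm_ge_zero] by auto
  let ?J = "integral {0..2 * pi} (\<lambda>t. cnj (g t) * g t)"
  have J: "norm ?J \<le> e" if "e > 0" for e
  proof -
    define d where "d = e / (2 * pi * (A + 1))"
    have d: "d > 0" using that A0 by (simp add: d_def)
    obtain P where P: "polynomial_function P" "\<And>z. z \<in> sphere 0 1 \<Longrightarrow> norm (G z - P z) < d"
      using Stone_Weierstrass_polynomial_function[OF _ G(1) d] by auto
    have re: "real_polynomial_function (\<lambda>z. Re (P z))" and im: "real_polynomial_function (\<lambda>z. Im (P z))"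
      using P(1) bounded_linear_Re bounded_linear_Im unfolding polynomial_function_def o_def by auto
    have "coeffs_vanish (\<lambda>t. 1 * (of_real (Re (P (cis t))) * g t) + - \<i> * (of_real (Im (P (cis t))) * g t))"
      by (rule coeffs_vanish_lincomb[OF coeffs_vanish_real_polynomial[OF re g] coeffs_vanish_real_polynomial[OF im g]])
    moreover have "1 * (of_real (Re (P (cis t))) * g t) + - \<i> * (of_real (Im (P (cis t))) * g t) =
        cnj (P (cis t)) * g t" for t
      by (simp add: complex_eq_iff)
    ultimately have van: "coeffs_vanish (\<lambda>t. cnj (P (cis t)) * g t)" by simp
    then have "integral {0..2 * pi} (\<lambda>t. cis (of_int 0 * t) * (cnj (P (cis t)) * g t)) = 0"
      unfolding coeffs_vanish_def by blast
    then have int0: "integral {0..2 * pi} (\<lambda>t. cnj (P (cis t)) * g t) = 0" by simp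
    have cont': "continuous_on {0..2 * pi} (\<lambda>t. cnj (P (cis t)) * g t)"
      using van by (auto simp: coeffs_vanish_def intro: continuous_on_subset)
    have "?J = integral {0..2 * pi} (\<lambda>t. cnj (g t) * g t - cnj (P (cis t)) * g t)"
      by (subst integral_diff)
         (auto simp: int0 intro!: integrable_continuous_interval cont' continuous_intros cont)
    also have "norm \<dots> \<le> integral {0..2 * pi} (\<lambda>t. d * (A + 1))"
    proof (rule integral_norm_bound_integral)
      fix t :: real assume t: "t \<in> {0..2 * pi}"
      have "cnj (g t) * g t - cnj (P (cis t)) * g t = cnj (G (cis t) - P (cis t)) * g t"
        using G(2)[OF t] by (simp add: algebra_simps)
      also have "norm \<dots> \<le> d * (A + 1)"
        unfolding norm_mult complex_mod_cnj using A[OF t] A0 P(2)[of "cis t"] d by (intro mult_mono) auto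
      finally show "norm (cnj (g t) * g t - cnj (P (cis t)) * g t) \<le> d * (A + 1)" .
    qed (auto intro!: integrable_continuous_interval continuous_on_diff cont' continuous_intros cont)
    also have "\<dots> = e" using A0 by (simp add: d_def)
    finally show ?thesis .
  qed
  \<comment> \<open>The integral of \<open>\<bar>g\<bar>\<^sup>2\<close> vanishes, and its integrand is continuous.\<close>
  have "norm ?J \<le> 0" by (rule field_le_epsilon) (use J in simp)
  then have J0: "?J = 0" by simp
  have "?J = of_real (integral {0..2 * pi} (\<lambda>t. (norm (g t))\<^sup>2))"
  proof -
    have "((\<lambda>t. complex_of_real ((norm (g t))\<^sup>2)) has_integral
        of_real (integral {0..2 * pi} (\<lambda>t. (norm (g t))\<^sup>2))) {0..2 * pi}"
      by (intro has_integral_of_real integrable_integral integrable_continuous_interval continuous_intros cont)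
    moreover have "complex_of_real ((norm (g t))\<^sup>2) = cnj (g t) * g t" for t
      unfolding complex_norm_square by (rule mult.commute)
    ultimately show ?thesis by (simp add: integral_unique)
  qed
  then have "integral {0..2 * pi} (\<lambda>t. (norm (g t))\<^sup>2) = 0" using J0 by simp
  then have "\<forall>s\<in>{0..2 * pi}. (norm (g s))\<^sup>2 = 0"
    by (subst (asm) integral_eq_0_iff) (auto intro!: continuous_intros cont)
  moreover obtain s where "s \<in> {0..2 * pi}" "g s = g t"
    using periodic_representative[of g t, OF per] by auto
  ultimately show ?thesis by auto
qed

section \<open>Schwartz functions on the cylinder as Fourier series\<close>

lemma C_infinityD:
  assumes "C_infinity f"
  shows "continuous_on UNIV f" "(\<lambda>s. f (s, x)) differentiable (at t)" "(\<lambda>y. f (t, y)) differentiable (at x)"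
    "C_infinity (partial_t f)" "C_infinity (partial_x f)"
proof -
  have "C_k (Suc k) f" for k using assms by (auto simp: C_infinity_def simp del: C_k.simps)
  then show "continuous_on UNIV f" "(\<lambda>s. f (s, x)) differentiable (at t)" "(\<lambda>y. f (t, y)) differentiable (at x)"
    "C_infinity (partial_t f)" "C_infinity (partial_x f)"
    unfolding C_infinity_def by auto
qed

lemma C_infinity_has_partials:
  assumes "C_infinity f"
  shows "((\<lambda>s. f (s, x)) has_vector_derivative partial_t f (t, x)) (at t)"
    "((\<lambda>y. f (t, y)) has_vector_derivative partial_x f (t, x)) (at x)"
  using C_infinityD(2,3)[OF assms] by (simp_all add: partial_t_def partial_x_def vector_derivative_works)

lemma periodic_t_partial:
  assumes "periodic_t f"
  shows "periodic_t (partial_t f)" "periodic_t (partial_x f)"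
proof -
  have shift: "(\<lambda>s. f (s + 2 * pi, x)) = (\<lambda>s. f (s, x))" for x
    using assms by (simp add: periodic_t_def)
  have "vector_derivative (\<lambda>s. f (s, x)) (at (t + 2 * pi)) = vector_derivative (\<lambda>s. f (s, x)) (at t)" for t x
  proof -
    have "((\<lambda>s. f (s, x)) has_vector_derivative d) (at (t + 2 * pi)) \<longleftrightarrow>
        ((\<lambda>s. f (s, x)) has_vector_derivative d) (at t)" for d
    proof
      assume "((\<lambda>s. f (s, x)) has_vector_derivative d) (at (t + 2 * pi))"
      then have "(((\<lambda>s. f (s, x)) \<circ> (\<lambda>s. s + 2 * pi)) has_vector_derivative 1 *\<^sub>R d) (at t)"
        by (intro vector_diff_chain_at) (auto intro!: derivative_eq_intros)
      then show "((\<lambda>s. f (s, x)) has_vector_derivative d) (at t)" by (simp add: o_def shift)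
    next
      assume "((\<lambda>s. f (s, x)) has_vector_derivative d) (at t)"
      then have "(((\<lambda>s. f (s, x)) \<circ> (\<lambda>s. s - 2 * pi)) has_vector_derivative 1 *\<^sub>R d) (at (t + 2 * pi))"
        by (intro vector_diff_chain_at) (auto intro!: derivative_eq_intros)
      moreover have "(\<lambda>s. f (s - 2 * pi, x)) = (\<lambda>s. f (s, x))"
      proof
        fix s show "f (s - 2 * pi, x) = f (s, x)" using fun_cong[OF shift[of x], of "s - 2 * pi"] by simp
      qed
      ultimately show "((\<lambda>s. f (s, x)) has_vector_derivative d) (at (t + 2 * pi))" by (simp add: o_def)
    qed
    then show ?thesis by (simp add: vector_derivative_def)
  qed
  then show "periodic_t (partial_t f)" by (simp add: periodic_t_def partial_t_def)
  show "periodic_t (partial_x f)" using assms by (simp add: periodic_t_def partial_x_def)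
qed

lemma schwartzD:
  assumes "f \<in> schwartz"
  shows "periodic_t f" "C_infinity f"
    "\<exists>C\<ge>0. \<forall>t x. \<bar>x\<bar> ^ c * norm ((partial_t ^^ a) ((partial_x ^^ b) f) (t, x)) \<le> C"
proof -
  show "periodic_t f" "C_infinity f" using assms by (auto simp: schwartz_def)
  have "bdd_above (range (weighted_deriv a b c f))" using assms by (simp add: schwartz_def)
  then obtain C where C: "\<And>z. weighted_deriv a b c f z \<le> C" by (auto simp: bdd_above_def)
  have "\<bar>x\<bar> ^ c * norm ((partial_t ^^ a) ((partial_x ^^ b) f) (t, x)) \<le> max 0 C" for t x
    using C[of "(t, x)"] by (simp add: weighted_deriv_def norm_mult norm_power)
  then show "\<exists>C\<ge>0. \<forall>t x. \<bar>x\<bar> ^ c * norm ((partial_t ^^ a) ((partial_x ^^ b) f) (t, x)) \<le> C"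
    by (intro exI[of _ "max 0 C"]) auto
qed

lemma schwartz_partial_x:
  assumes "f \<in> schwartz"
  shows "partial_x f \<in> schwartz"
proof -
  have "weighted_deriv a b c (partial_x f) = weighted_deriv a (Suc b) c f" for a b c
    by (simp only: weighted_deriv_def funpow_Suc_right o_apply)
  then show ?thesis
    using assms by (simp add: schwartz_def periodic_t_partial C_infinityD)
qed

text \<open>
A family of decaying functions that is closed under both partial derivatives consists of
Schwartz functions: every mixed derivative of a member is again a member, hence bounded with any weight.
\<close>

lemma schwartz_coinduct:
  assumes i: "I i"
    and per: "\<And>i. I i \<Longrightarrow> periodic_t (G i)" and cont: "\<And>i. I i \<Longrightarrow> continuous_on UNIV (G i)"
    and decay: "\<And>i c. I i \<Longrightarrow> \<exists>C. \<forall>t x. \<bar>x\<bar> ^ c * norm (G i (t, x)) \<le> C"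
    and dt: "\<And>i. I i \<Longrightarrow> \<exists>j. I j \<and> (\<forall>t x. ((\<lambda>s. G i (s, x)) has_vector_derivative G j (t, x)) (at t))"
    and dx: "\<And>i. I i \<Longrightarrow> \<exists>j. I j \<and> (\<forall>t x. ((\<lambda>y. G i (t, y)) has_vector_derivative G j (t, x)) (at x))"
  shows "G i \<in> schwartz"
proof -
  have diff: "(\<lambda>s. G i (s, x)) differentiable (at t)" "(\<lambda>y. G i (t, y)) differentiable (at x)" if "I i" for i t x
    using dt[OF that] dx[OF that] differentiableI_vector by blast+
  have pt: "\<exists>j. I j \<and> partial_t (G i) = G j" if i: "I i" for i
  proof -
    obtain j where "I j" "\<And>t x. ((\<lambda>s. G i (s, x)) has_vector_derivative G j (t, x)) (at t)"
      using dt[OF i] by blast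
    then show ?thesis by (auto simp: partial_t_def fun_eq_iff intro!: exI[of _ j] vector_derivative_at)
  qed
  have px: "\<exists>j. I j \<and> partial_x (G i) = G j" if i: "I i" for i
  proof -
    obtain j where "I j" "\<And>t x. ((\<lambda>y. G i (t, y)) has_vector_derivative G j (t, x)) (at x)"
      using dx[OF i] by blast
    then show ?thesis by (auto simp: partial_x_def fun_eq_iff intro!: exI[of _ j] vector_derivative_at)
  qed
  have "C_k k (G i)" if "I i" for k i
    using that
  proof (induction k arbitrary: i)
    case (Suc k)
    then show ?case using pt[OF Suc.prems] px[OF Suc.prems] cont diff by auto
  qed (simp add: cont)
  then have "C_infinity (G i)" using i by (simp add: C_infinity_def)
  moreover have iter: "\<exists>j. I j \<and> (partial_t ^^ a) ((partial_x ^^ b) (G i)) = G j" for a b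
  proof (induction a)
    case 0
    show ?case
    proof (induction b)
      case (Suc b)
      then show ?case using px by auto
    qed (use i in auto)
  next
    case (Suc a)
    then show ?case using pt by auto
  qed
  have "bdd_above (range (weighted_deriv a b c (G i)))" for a b c
  proof -
    obtain j where j: "I j" "(partial_t ^^ a) ((partial_x ^^ b) (G i)) = G j" using iter by blast
    obtain C where "\<And>t x. \<bar>x\<bar> ^ c * norm (G j (t, x)) \<le> C" using decay[OF j(1)] by blast
    then show ?thesis
      by (intro bdd_aboveI[of _ C]) (auto simp: weighted_deriv_def j(2) norm_mult norm_power)
  qed
  ultimately show ?thesis using per[OF i] by (simp add: schwartz_def)
qed

lemma cis_of_int_periodic: "cis (of_int k * (t + 2 * pi)) = cis (of_int k * t)"
proof -
  have "cis (of_int k * (t + 2 * pi)) = cis (of_int k * t) * cis (2 * pi * of_int k)"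
    unfolding cis_mult by (simp add: algebra_simps)
  then show ?thesis by simp
qed

text \<open>
The Fourier modes are enumerated by the natural numbers, so that series over the integers become
ordinary series; \<open>n\<close> and \<open>\<bar>freq n\<bar>\<close> are comparable.
\<close>

definition freq :: "nat \<Rightarrow> real" where "freq n = of_int (int_decode n)"

lemma freq_bounds: "\<bar>freq n\<bar> \<le> real n" "1 + real n \<le> 2 * (1 + \<bar>freq n\<bar>)"
proof -
  have "int_decode n = (if even n then int (n div 2) else - int (n div 2) - 1)"
    by (simp add: int_decode_def sum_decode_def)
  then show "\<bar>freq n\<bar> \<le> real n" "1 + real n \<le> 2 * (1 + \<bar>freq n\<bar>)"
    unfolding freq_def by (auto elim!: evenE oddE)
qed

lemma moderate_freq: "moderate (\<lambda>n. of_real (freq n))"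
  unfolding moderate_def by (intro exI[of _ 1]) (use freq_bounds(1) in \<open>auto intro!: exI[of _ 1] order_trans[OF freq_bounds(1)]\<close>)

definition synth :: "(nat \<Rightarrow> real \<Rightarrow> complex) \<Rightarrow> cfun" where
  "synth F = (\<lambda>(t, x). \<Sum>n. cis (freq n * t) * F n x)"

definition majorant :: "nat \<Rightarrow> real" where "majorant n = 1 / (1 + real n)\<^sup>2"

lemma summable_majorant: "summable majorant"
proof -
  have "summable (\<lambda>n. inverse (real (Suc n) ^ 2))"
    by (subst summable_Suc_iff) (intro inverse_power_summable, simp)
  then show ?thesis by (simp add: majorant_def[abs_def] inverse_eq_divide add.commute)
qed

lemma rapid_decay_majorant:
  assumes "rapid_decay F"
  shows "\<exists>C\<ge>0. \<forall>n x. \<bar>x\<bar> ^ c * norm (F n x) \<le> C * majorant n"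
proof -
  obtain C where C: "0 \<le> C" "\<And>n x. (1 + real n) ^ 2 * \<bar>x\<bar> ^ c * norm (F n x) \<le> C"
    by (metis assms rapid_decayE)
  have "\<bar>x\<bar> ^ c * norm (F n x) \<le> C * majorant n" for n x
    using C(2)[of n x] by (simp add: majorant_def field_simps)
  with C(1) show ?thesis by blast
qed

lemma synth_term_majorant:
  assumes "rapid_decay F"
  obtains C where "\<And>n t x. norm (cis (freq n * t) * F n x) \<le> C * majorant n" "summable (\<lambda>n. C * majorant n)"
proof -
  obtain C where "\<And>n x. \<bar>x\<bar> ^ 0 * norm (F n x) \<le> C * majorant n"
    using rapid_decay_majorant[OF assms, of 0] by blast
  then show ?thesis using that[of C] summable_majorant by (simp add: norm_mult summable_mult)
qed

lemma synth_sums: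
  assumes "rapid_decay F"
  shows "(\<lambda>n. cis (freq n * t) * F n x) sums synth F (t, x)"
proof -
  obtain C where C: "\<And>n t x. norm (cis (freq n * t) * F n x) \<le> C * majorant n" "summable (\<lambda>n. C * majorant n)"
    using synth_term_majorant[OF assms] by blast
  have "summable (\<lambda>n. cis (freq n * t) * F n x)"
    by (rule summable_comparison_test'[OF C(2)]) (rule C(1))
  then show ?thesis by (simp add: synth_def summable_sums)
qed

lemma synth_continuous:
  assumes "rapid F"
  shows "continuous_on UNIV (synth F)"
proof -
  obtain C where C: "\<And>n t x. norm (cis (freq n * t) * F n x) \<le> C * majorant n" "summable (\<lambda>n. C * majorant n)"
    using synth_term_majorant[OF rapid_imp_rapid_decay[OF assms]] by blast
  have "uniform_limit UNIV (\<lambda>N z. \<Sum>n<N. cis (freq n * fst z) * F n (snd z))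
      (\<lambda>z. \<Sum>n. cis (freq n * fst z) * F n (snd z)) sequentially"
    by (rule Weierstrass_m_test[OF _ C(2)]) (rule C(1))
  then have "continuous_on UNIV (\<lambda>z. \<Sum>n. cis (freq n * fst z) * F n (snd z))"
    by (rule uniform_limit_theorem[rotated])
       (auto intro!: always_eventually continuous_intros continuous_on_compose2[OF rapid_continuous[OF assms, of UNIV]])
  then show ?thesis by (simp add: synth_def case_prod_unfold)
qed

lemma has_vector_derivative_suminf:
  fixes f :: "nat \<Rightarrow> real \<Rightarrow> complex"
  assumes der: "\<And>n x. (f n has_vector_derivative f' n x) (at x)"
    and bd: "\<And>n x. norm (f' n x) \<le> M n" and M: "summable M"
    and sf: "\<And>x. summable (\<lambda>n. f n x)"
  shows "((\<lambda>x. \<Sum>n. f n x) has_vector_derivative (\<Sum>n. f' n x)) (at x)"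
proof -
  have ul: "uniform_limit UNIV (\<lambda>N x. \<Sum>n<N. f' n x) (\<lambda>x. \<Sum>n. f' n x) sequentially"
    by (rule Weierstrass_m_test[OF bd M])
  have "\<exists>g. \<forall>x\<in>UNIV. (\<lambda>n. f n x) sums g x \<and>
      (g has_derivative (\<lambda>h. h *\<^sub>R (\<Sum>n. f' n x))) (at x within UNIV)"
  proof (rule has_derivative_series[where f' = "\<lambda>n x h. h *\<^sub>R f' n x"])
    show "(f n has_derivative (\<lambda>h. h *\<^sub>R f' n x)) (at x within UNIV)" for n x
      using der[of n x] by (simp add: has_vector_derivative_def)
    fix e :: real assume "e > 0"
    then have "\<forall>\<^sub>F N in sequentially. \<forall>x\<in>UNIV. dist (\<Sum>n<N. f' n x) (\<Sum>n. f' n x) < e"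
      using ul by (auto simp: uniform_limit_iff)
    then show "\<forall>\<^sub>F N in sequentially. \<forall>x\<in>UNIV. \<forall>h.
        norm ((\<Sum>i<N. h *\<^sub>R f' i x) - h *\<^sub>R (\<Sum>n. f' n x)) \<le> e * norm h"
    proof eventually_elim
      case (elim N)
      have "norm ((\<Sum>i<N. h *\<^sub>R f' i x) - h *\<^sub>R (\<Sum>n. f' n x)) \<le> e * norm h" for x h
      proof -
        have "norm ((\<Sum>i<N. h *\<^sub>R f' i x) - h *\<^sub>R (\<Sum>n. f' n x)) = \<bar>h\<bar> * dist (\<Sum>n<N. f' n x) (\<Sum>n. f' n x)"
          by (simp add: dist_norm scaleR_right_diff_distrib[symmetric] scaleR_sum_right[symmetric])
        also have "\<dots> \<le> \<bar>h\<bar> * e" using elim by (intro mult_left_mono) (auto intro: less_imp_le)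
        finally show ?thesis by (simp add: mult.commute)
      qed
      then show ?case by blast
    qed
  qed (auto intro: summable_sums sf)
  then obtain g where g: "\<And>x. (\<lambda>n. f n x) sums g x"
    "\<And>x. (g has_derivative (\<lambda>h. h *\<^sub>R (\<Sum>n. f' n x))) (at x)" by auto
  have "g = (\<lambda>x. \<Sum>n. f n x)" using g(1) by (auto simp: sums_iff)
  with g(2) show ?thesis by (simp add: has_vector_derivative_def)
qed

lemma synth_has_partial_t:
  assumes "rapid F"
  shows "((\<lambda>s. synth F (s, x)) has_vector_derivative synth (\<lambda>n x. (\<i> * freq n) * F n x) (t, x)) (at t)"
proof -
  have m: "moderate (\<lambda>n. \<i> * freq n)" by (intro moderate_mult moderate_const moderate_freq)
  obtain C where C: "\<And>n t x. norm (cis (freq n * t) * ((\<i> * freq n) * F n x)) \<le> C * majorant n" "summable (\<lambda>n. C * majorant n)"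
    using synth_term_majorant[OF rapid_imp_rapid_decay[OF rapid_moderate_mult[OF assms m]]] by blast
  have "((\<lambda>s. \<Sum>n. cis (freq n * s) * F n x) has_vector_derivative
      (\<Sum>n. cis (freq n * t) * ((\<i> * freq n) * F n x))) (at t)"
  proof (rule has_vector_derivative_suminf[OF _ C])
    show "((\<lambda>s. cis (freq n * s) * F n x) has_vector_derivative cis (freq n * s) * ((\<i> * freq n) * F n x)) (at s)" for n s
    proof -
      have "((\<lambda>s. cis (freq n * s)) has_vector_derivative freq n *\<^sub>R (\<i> * cis (freq n * s))) (at s)"
        unfolding has_vector_derivative_def
        by (auto intro!: derivative_eq_intros simp: scaleR_conv_of_real)
      from has_vector_derivative_mult_left[OF this, of "F n x"] show ?thesis
        by (simp add: scaleR_conv_of_real mult_ac)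
    qed
    show "summable (\<lambda>n. cis (freq n * s) * F n x)" for s
      using synth_sums[OF rapid_imp_rapid_decay[OF assms]] sums_summable by blast
  qed
  then show ?thesis by (simp add: synth_def)
qed

lemma synth_has_partial_x:
  assumes F: "rapid F" "rapid F'" and der: "\<And>n x. (F n has_vector_derivative F' n x) (at x)"
  shows "((\<lambda>y. synth F (t, y)) has_vector_derivative synth F' (t, x)) (at x)"
proof -
  obtain C where C: "\<And>n t x. norm (cis (freq n * t) * F' n x) \<le> C * majorant n" "summable (\<lambda>n. C * majorant n)"
    using synth_term_majorant[OF rapid_imp_rapid_decay[OF F(2)]] by blast
  have "((\<lambda>y. \<Sum>n. cis (freq n * t) * F n y) has_vector_derivative (\<Sum>n. cis (freq n * t) * F' n x)) (at x)"
  proof (rule has_vector_derivative_suminf[OF _ C])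
    show "((\<lambda>y. cis (freq n * t) * F n y) has_vector_derivative cis (freq n * t) * F' n y) (at y)" for n y
      by (intro has_vector_derivative_mult_right der)
    show "summable (\<lambda>n. cis (freq n * t) * F n y)" for y
      using synth_sums[OF rapid_imp_rapid_decay[OF F(1)]] sums_summable by blast
  qed
  then show ?thesis by (simp add: synth_def)
qed

lemma partial_t_synth:
  "rapid F \<Longrightarrow> partial_t (synth F) = synth (\<lambda>n x. (\<i> * freq n) * F n x)"
  by (auto simp: partial_t_def fun_eq_iff intro!: vector_derivative_at synth_has_partial_t)

lemma partial_x_synth:
  "rapid F \<Longrightarrow> rapid F' \<Longrightarrow> (\<And>n x. (F n has_vector_derivative F' n x) (at x)) \<Longrightarrow> partial_x (synth F) = synth F'"
  by (auto simp: partial_x_def fun_eq_iff intro!: vector_derivative_at synth_has_partial_x)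

text \<open>
The sums of rapid families form a class closed under the partial derivatives: \<open>\<partial>\<^sub>t\<close> multiplies the family
by the moderate sequence \<open>i freq n\<close>, and \<open>\<partial>\<^sub>x\<close> differentiates its members.
\<close>

lemma synth_in_schwartz:
  assumes "rapid F"
  shows "synth F \<in> schwartz"
proof (rule schwartz_coinduct[where I = rapid and G = synth, OF assms])
  fix F :: "nat \<Rightarrow> real \<Rightarrow> complex"
  assume F: "rapid F"
  show "periodic_t (synth F)"
    unfolding periodic_t_def synth_def freq_def by (simp add: cis_of_int_periodic)
  show "continuous_on UNIV (synth F)" by (rule synth_continuous[OF F])
  show "\<exists>C. \<forall>t x. \<bar>x\<bar> ^ c * norm (synth F (t, x)) \<le> C" for c
  proof -
    obtain C where C: "\<And>n x. \<bar>x\<bar> ^ c * norm (F n x) \<le> C * majorant n"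
      using rapid_decay_majorant[OF rapid_imp_rapid_decay[OF F]] by blast
    have "\<bar>x\<bar> ^ c * norm (synth F (t, x)) \<le> (\<Sum>n. C * majorant n)" for t x
    proof -
      have s: "(\<lambda>n. of_real (\<bar>x\<bar> ^ c) * (cis (freq n * t) * F n x)) sums (of_real (\<bar>x\<bar> ^ c) * synth F (t, x))"
        by (intro sums_mult synth_sums rapid_imp_rapid_decay[OF F])
      have "norm (\<Sum>n. of_real (\<bar>x\<bar> ^ c) * (cis (freq n * t) * F n x)) \<le> (\<Sum>n. C * majorant n)"
        by (rule norm_suminf_le) (use C in \<open>auto simp: norm_mult norm_power intro: summable_mult summable_majorant\<close>)
      then show ?thesis using s by (simp add: sums_iff norm_mult norm_power)
    qed
    then show ?thesis by blast
  qed
  have "rapid (\<lambda>n x. (\<i> * freq n) * F n x)"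
    by (intro rapid_moderate_mult[OF F] moderate_mult moderate_const moderate_freq)
  with synth_has_partial_t[OF F]
  show "\<exists>G. rapid G \<and> (\<forall>t x. ((\<lambda>s. synth F (s, x)) has_vector_derivative synth G (t, x)) (at t))" by blast
  obtain F' where F': "rapid F'" "\<And>n x. (F n has_vector_derivative F' n x) (at x)"
    using F by (rule rapidE) blast
  with synth_has_partial_x[OF F F']
  show "\<exists>G. rapid G \<and> (\<forall>t x. ((\<lambda>y. synth F (t, y)) has_vector_derivative synth G (t, x)) (at x))" by blast
qed

definition coef :: "cfun \<Rightarrow> nat \<Rightarrow> real \<Rightarrow> complex" where
  "coef f n x = integral {0..2 * pi} (\<lambda>t. cis (- freq n * t) * f (t, x)) / (2 * pi)"

lemma continuous_on_slices:
  assumes "continuous_on UNIV f"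
  shows "continuous_on A (\<lambda>t. f (t, x))" "continuous_on A (\<lambda>y. f (t, y))"
  by (auto intro!: continuous_on_compose2[OF assms] continuous_intros)

lemma cis_freq_2pi: "cis (freq n * (2 * pi)) = 1" "cis (- freq n * (2 * pi)) = 1"
proof -
  show "cis (freq n * (2 * pi)) = 1" for n
    using cis_multiple_2pi[of "freq n"] by (simp add: freq_def mult_ac)
  then show "cis (- freq n * (2 * pi)) = 1"
    by (metis cis_cnj complex_cnj_one mult_minus_left)
qed

lemma cis_has_vector_derivative:
  "((\<lambda>s. cis (a * s)) has_vector_derivative (\<i> * a) * cis (a * t)) (at t within A)"
  unfolding has_vector_derivative_def
  by (auto intro!: derivative_eq_intros simp: scaleR_conv_of_real)

lemma coef_partial_t:
  assumes "periodic_t f" "C_infinity f"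
  shows "coef (partial_t f) n x = \<i> * freq n * coef f n x"
proof -
  note c = C_infinityD(1)[OF assms(2)] C_infinityD(1)[OF C_infinityD(4)[OF assms(2)]]
  have "((\<lambda>t. cis (- freq n * t) * partial_t f (t, x) + (- \<i> * freq n) * (cis (- freq n * t) * f (t, x)))
      has_integral cis (- freq n * (2 * pi)) * f (2 * pi, x) - cis (- freq n * 0) * f (0, x)) {0..2 * pi}"
  proof (rule fundamental_theorem_of_calculus)
    fix t
    have "((\<lambda>s. cis (- freq n * s) * f (s, x)) has_vector_derivative
        cis (- freq n * t) * partial_t f (t, x) + (\<i> * of_real (- freq n)) * cis (- freq n * t) * f (t, x))
        (at t within {0..2 * pi})"
      by (intro has_vector_derivative_mult cis_has_vector_derivative
          has_vector_derivative_at_within[OF C_infinity_has_partials(1)[OF assms(2)]])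
    moreover have "(\<i> * of_real (- freq n)) * cis (- freq n * t) * f (t, x) =
        (- \<i> * freq n) * (cis (- freq n * t) * f (t, x))"
      by (simp only: mult.assoc of_real_minus mult_minus_left mult_minus_right)
    ultimately show "((\<lambda>s. cis (- freq n * s) * f (s, x)) has_vector_derivative
        cis (- freq n * t) * partial_t f (t, x) + (- \<i> * freq n) * (cis (- freq n * t) * f (t, x))) (at t within {0..2 * pi})"
      by (simp only:)
  qed simp
  moreover have per: "f (2 * pi, x) = f (0, x)"
    using assms(1)[unfolded periodic_t_def, rule_format, of 0 x] by simp
  have "cis (- freq n * (2 * pi)) * f (2 * pi, x) - cis (- freq n * 0) * f (0, x) = 0"
    unfolding cis_freq_2pi per by simp
  ultimately have "integral {0..2 * pi} (\<lambda>t. cis (- freq n * t) * partial_t f (t, x) +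
      (- \<i> * freq n) * (cis (- freq n * t) * f (t, x))) = 0"
    by (simp only: integral_unique)
  also have "integral {0..2 * pi} (\<lambda>t. cis (- freq n * t) * partial_t f (t, x) +
      (- \<i> * freq n) * (cis (- freq n * t) * f (t, x))) =
    integral {0..2 * pi} (\<lambda>t. cis (- freq n * t) * partial_t f (t, x)) +
      (- \<i> * freq n) * integral {0..2 * pi} (\<lambda>t. cis (- freq n * t) * f (t, x))"
    unfolding integral_mult_right[symmetric]
    by (intro integral_add integrable_continuous_interval continuous_intros
        continuous_on_slices(1)[OF c(1)] continuous_on_slices(1)[OF c(2)])
  finally have "integral {0..2 * pi} (\<lambda>t. cis (- freq n * t) * partial_t f (t, x)) =
      \<i> * freq n * integral {0..2 * pi} (\<lambda>t. cis (- freq n * t) * f (t, x))"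
    by (simp only: mult_minus_left add_uminus_conv_diff right_minus_eq)
  then show ?thesis by (simp only: coef_def times_divide_eq_right)
qed

lemma coef_partial_t_funpow:
  assumes "periodic_t f" "C_infinity f"
  shows "periodic_t ((partial_t ^^ a) f)" "C_infinity ((partial_t ^^ a) f)"
    "coef ((partial_t ^^ a) f) n x = (\<i> * freq n) ^ a * coef f n x"
proof (induction a)
  case (Suc a)
  {
    case 1
    then show ?case using Suc periodic_t_partial(1) by simp
  next
    case 2
    then show ?case using Suc C_infinityD(4) by simp
  next
    case 3
    then show ?case using coef_partial_t[OF Suc(1,2)] Suc(3) by simp
  }
qed (use assms in simp_all)

lemma norm_coef_le:
  assumes "continuous_on UNIV f" "\<And>t. r * norm (f (t, x)) \<le> C" "0 \<le> r"
  shows "r * norm (coef f n x) \<le> C"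
proof -
  have "norm (integral {0..2 * pi} (\<lambda>t. of_real r * (cis (- freq n * t) * f (t, x)))) \<le>
      integral {0..2 * pi} (\<lambda>t. C)"
    using assms
    by (intro integral_norm_bound_integral integrable_continuous_interval continuous_intros continuous_on_slices)
       (auto simp: norm_mult)
  then show ?thesis using assms(3) by (simp add: coef_def norm_mult norm_divide field_simps)
qed

text \<open>
Each power of the frequency is paid for by one derivative in \<open>t\<close>.
\<close>

lemma rapid_decay_coef:
  assumes f: "f \<in> schwartz"
  shows "rapid_decay (coef f)"
  unfolding rapid_decay_def
proof (intro allI)
  fix N c
  note per = schwartzD(1)[OF f] and smooth = schwartzD(2)[OF f]
  have "\<exists>C\<ge>0. \<forall>n x. \<bar>freq n\<bar> ^ a * (\<bar>x\<bar> ^ c * norm (coef f n x)) \<le> C" for a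
  proof -
    obtain C where C: "C \<ge> 0" "\<And>t x. \<bar>x\<bar> ^ c * norm ((partial_t ^^ a) f (t, x)) \<le> C"
      using schwartzD(3)[OF f, of c a 0] by auto
    have "\<bar>x\<bar> ^ c * norm (coef ((partial_t ^^ a) f) n x) \<le> C" for n x
      by (intro norm_coef_le C C_infinityD(1) coef_partial_t_funpow(2) per smooth) auto
    then have "\<bar>freq n\<bar> ^ a * (\<bar>x\<bar> ^ c * norm (coef f n x)) \<le> C" for n x
      by (simp add: coef_partial_t_funpow(3)[OF per smooth] norm_mult norm_power mult_ac)
    with C(1) show ?thesis by blast
  qed
  then obtain C where C: "\<And>a. 0 \<le> C a" "\<And>a n x. \<bar>freq n\<bar> ^ a * (\<bar>x\<bar> ^ c * norm (coef f n x)) \<le> C a"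
    by metis
  have "(1 + real n) ^ N * \<bar>x\<bar> ^ c * norm (coef f n x) \<le> 4 ^ N * (C 0 + C N)" for n x
  proof -
    have "(1 + real n) ^ N \<le> (2 * (1 + \<bar>freq n\<bar>)) ^ N"
      by (intro power_mono freq_bounds) auto
    also have "\<dots> \<le> 2 ^ N * (2 ^ N * (1 ^ N + \<bar>freq n\<bar> ^ N))"
      unfolding power_mult_distrib by (intro mult_left_mono power_add_le_two_power) auto
    also have "\<dots> = 4 ^ N * (1 + \<bar>freq n\<bar> ^ N)"
      unfolding mult.assoc[symmetric] power_mult_distrib[symmetric] by simp
    finally have "(1 + real n) ^ N * (\<bar>x\<bar> ^ c * norm (coef f n x)) \<le>
        4 ^ N * (1 + \<bar>freq n\<bar> ^ N) * (\<bar>x\<bar> ^ c * norm (coef f n x))"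
      by (intro mult_right_mono) auto
    also have "\<dots> = 4 ^ N * (\<bar>freq n\<bar> ^ 0 * (\<bar>x\<bar> ^ c * norm (coef f n x)) + \<bar>freq n\<bar> ^ N * (\<bar>x\<bar> ^ c * norm (coef f n x)))"
      by (simp add: algebra_simps)
    also have "\<dots> \<le> 4 ^ N * (C 0 + C N)"
      by (intro mult_left_mono add_mono C) auto
    finally show ?thesis by (simp add: mult.assoc)
  qed
  then show "\<exists>C. \<forall>n x. (1 + real n) ^ N * \<bar>x\<bar> ^ c * norm (coef f n x) \<le> C" by blast
qed

lemma coef_has_derivative:
  assumes "C_infinity f"
  shows "(coef f n has_vector_derivative coef (partial_x f) n x) (at x)"
proof -
  note c = C_infinityD(1)[OF assms] C_infinityD(1)[OF C_infinityD(5)[OF assms]]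
  have "((\<lambda>y. integral (cbox 0 (2 * pi)) (\<lambda>t. cis (- freq n * t) * f (t, y))) has_vector_derivative
      integral (cbox 0 (2 * pi)) (\<lambda>t. cis (- freq n * t) * partial_x f (t, x))) (at x within UNIV)"
  proof (rule leibniz_rule_vector_derivative)
    fix y t
    show "((\<lambda>x. cis (- freq n * t) * f (t, x)) has_vector_derivative cis (- freq n * t) * partial_x f (t, y))
        (at y within UNIV)"
      by (intro has_vector_derivative_mult_right C_infinity_has_partials(2) assms)
    show "(\<lambda>t. cis (- freq n * t) * f (t, y)) integrable_on cbox 0 (2 * pi)"
      by (intro integrable_continuous continuous_intros continuous_on_slices c)
  next
    show "continuous_on (UNIV \<times> cbox 0 (2 * pi)) (\<lambda>(y, t). cis (- freq n * t) * partial_x f (t, y))"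
      unfolding case_prod_unfold
      by (intro continuous_intros continuous_on_compose2[OF c(2)]) auto
  qed auto
  then have "((\<lambda>y. integral {0..2 * pi} (\<lambda>t. cis (- freq n * t) * f (t, y)) * (1 / (2 * pi))) has_vector_derivative
      integral {0..2 * pi} (\<lambda>t. cis (- freq n * t) * partial_x f (t, x)) * (1 / (2 * pi))) (at x)"
    by (intro has_vector_derivative_mult_left) simp
  then show ?thesis by (simp add: coef_def[abs_def])
qed

lemma rapid_coef:
  assumes "f \<in> schwartz"
  shows "rapid (coef f)"
proof (rule rapid_coinduct[where X = "\<lambda>F. \<exists>f\<in>schwartz. F = coef f"])
  show "\<exists>g\<in>schwartz. coef f = coef g" using assms by blast
  fix F assume "\<exists>f\<in>schwartz. F = coef f"
  then obtain g where g: "g \<in> schwartz" "F = coef g" by blast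
  show "rapid_decay F \<and> (\<exists>F'. (\<forall>n x. (F n has_vector_derivative F' n x) (at x)) \<and> (\<exists>f\<in>schwartz. F' = coef f))"
    unfolding g(2) using rapid_decay_coef[OF g(1)] coef_has_derivative[OF schwartzD(2)[OF g(1)]]
      schwartz_partial_x[OF g(1)] by blast
qed

lemma integral_cis_int:
  "integral {0..2 * pi} (\<lambda>t. cis (of_int k * t)) = (if k = 0 then 2 * pi else 0)"
proof (cases "k = 0")
  case False
  have "((\<lambda>t. cis (of_int k * t)) has_integral
      cis (of_int k * (2 * pi)) / (\<i> * of_int k) - cis (of_int k * 0) / (\<i> * of_int k)) {0..2 * pi}"
  proof (rule fundamental_theorem_of_calculus)
    fix t
    from has_vector_derivative_mult_left[OF cis_has_vector_derivative[of "of_int k" t], of "1 / (\<i> * of_int k)"]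
    show "((\<lambda>s. cis (of_int k * s) / (\<i> * of_int k)) has_vector_derivative cis (of_int k * t)) (at t within {0..2 * pi})"
      using False by simp
  qed simp
  moreover have "cis (of_int k * (2 * pi)) = 1"
    using cis_multiple_2pi[of "of_int k"] by (simp add: mult_ac)
  ultimately show ?thesis using False by (simp add: integral_unique)
qed (simp add: scaleR_conv_of_real)

text \<open>
The series converges uniformly in \<open>t\<close>, so the integral may be taken term by term.
\<close>

lemma coef_synth:
  assumes F: "rapid F"
  shows "coef (synth F) n x = F n x"
proof -
  obtain C where C: "\<And>n t x. norm (cis (freq n * t) * F n x) \<le> C * majorant n" "summable (\<lambda>n. C * majorant n)"
    using synth_term_majorant[OF rapid_imp_rapid_decay[OF F]] by blast
  have prod: "cis (- freq n * t) * (cis (freq m * t) * F m x) =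
      cis (of_int (int_decode m - int_decode n) * t) * F m x" for m t
    unfolding mult.assoc[symmetric] cis_mult by (simp add: freq_def algebra_simps)
  have bd: "norm (cis (- freq n * t) * (cis (freq m * t) * F m x)) \<le> C * majorant m" for m t
    using C(1)[of m t x] by (simp add: norm_mult)
  have "uniform_limit {0..2 * pi} (\<lambda>N t. \<Sum>m<N. cis (- freq n * t) * (cis (freq m * t) * F m x))
      (\<lambda>t. \<Sum>m. cis (- freq n * t) * (cis (freq m * t) * F m x)) sequentially"
    by (rule Weierstrass_m_test[OF bd C(2)])
  moreover have "continuous_on {0..2 * pi} (\<lambda>t. \<Sum>m<N. cis (- freq n * t) * (cis (freq m * t) * F m x))" for N
    by (intro continuous_intros)
  ultimately obtain I J where I: "\<And>N. ((\<lambda>t. \<Sum>m<N. cis (- freq n * t) * (cis (freq m * t) * F m x)) has_integral I N) {0..2 * pi}"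
    and J: "((\<lambda>t. \<Sum>m. cis (- freq n * t) * (cis (freq m * t) * F m x)) has_integral J) {0..2 * pi}"
    and IJ: "I \<longlonglongrightarrow> J"
    by (rule uniform_limit_integral) auto
  \<comment> \<open>Only the term with \<open>m = n\<close> survives the integration.\<close>
  have "I N = 2 * pi * F n x" if "n < N" for N
  proof -
    have "I N = (\<Sum>m<N. integral {0..2 * pi} (\<lambda>t. cis (of_int (int_decode m - int_decode n) * t) * F m x))"
      unfolding integral_unique[OF I, symmetric] prod
      by (rule integral_sum) (auto intro!: integrable_continuous_interval continuous_intros)
    also have "\<dots> = (\<Sum>m<N. if m = n then 2 * pi * F n x else 0)"
      unfolding integral_mult_left integral_cis_int by (intro sum.cong refl) (simp add: int_decode_eq)
    finally show ?thesis using that by simp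
  qed
  then have "I \<longlonglongrightarrow> 2 * pi * F n x"
    by (intro tendsto_eventually eventually_mono[OF eventually_gt_at_top[of n]])
  with IJ have "J = 2 * pi * F n x" by (rule LIMSEQ_unique)
  moreover have "(\<Sum>m. cis (- freq n * t) * (cis (freq m * t) * F m x)) = cis (- freq n * t) * synth F (t, x)" for t
    using sums_mult[OF synth_sums[OF rapid_imp_rapid_decay[OF F]], of "cis (- freq n * t)"]
    by (simp add: sums_iff)
  ultimately show ?thesis using integral_unique[OF J] by (simp add: coef_def)
qed

text \<open>
Both sides have the same Fourier coefficients on each slice.
\<close>

lemma synth_coef:
  assumes f: "f \<in> schwartz"
  shows "synth (coef f) = f"
proof
  fix z
  obtain t x :: real where z: "z = (t, x)" by (cases z)
  have R: "rapid (coef f)" by (rule rapid_coef[OF f])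
  note S = synth_in_schwartz[OF R]
  note c = C_infinityD(1)[OF schwartzD(2)[OF f]] synth_continuous[OF R]
  have "coeffs_vanish (\<lambda>t. f (t, x) - synth (coef f) (t, x))"
    unfolding coeffs_vanish_def
  proof (intro conjI allI)
    show "continuous_on UNIV (\<lambda>t. f (t, x) - synth (coef f) (t, x))"
      by (intro continuous_intros continuous_on_slices c)
    fix k :: int
    define n where "n = int_encode (- k)"
    have n: "of_int k = - freq n" by (simp add: n_def freq_def)
    have "integral {0..2 * pi} (\<lambda>t. cis (- freq n * t) * (f (t, x) - synth (coef f) (t, x))) =
        integral {0..2 * pi} (\<lambda>t. cis (- freq n * t) * f (t, x)) -
        integral {0..2 * pi} (\<lambda>t. cis (- freq n * t) * synth (coef f) (t, x))"
      unfolding right_diff_distrib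
      by (intro integral_diff integrable_continuous_interval continuous_intros continuous_on_slices c)
    also have "\<dots> = 0" using coef_synth[OF R, of n x] by (simp add: coef_def)
    finally show "integral {0..2 * pi} (\<lambda>t. cis (of_int k * t) * (f (t, x) - synth (coef f) (t, x))) = 0"
      unfolding n .
  qed
  then have "f (t, x) - synth (coef f) (t, x) = 0"
    by (rule coeffs_vanish_imp_zero)
       (use schwartzD(1)[OF f] schwartzD(1)[OF S] in \<open>auto simp: periodic_t_def\<close>)
  then show "synth (coef f) z = f z" by (simp add: z)
qed

section \<open>Solving the equation in the Schwartz space\<close>

text \<open>
The differential operator \<open>p(-i d)\<close> on functions, where \<open>d\<close> is one of the two partial derivatives.
\<close>

definition poly_partial :: "complex poly \<Rightarrow> (cfun \<Rightarrow> cfun) \<Rightarrow> cfun \<Rightarrow> cfun" where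
  "poly_partial p d f = (\<lambda>z. \<Sum>j\<le>degree p. coeff p j * (- \<i>) ^ j * (d ^^ j) f z)"

lemma partial_t_funpow_synth:
  assumes "rapid F"
  shows "(partial_t ^^ j) (synth F) = synth (\<lambda>n x. (\<i> * freq n) ^ j * F n x)"
proof (induction j)
  case (Suc j)
  have "rapid (\<lambda>n x. (\<i> * freq n) ^ j * F n x)"
    using moderate_poly[OF moderate_mult[OF moderate_const[of \<i>] moderate_freq], of "monom 1 j"]
    by (intro rapid_moderate_mult[OF assms]) (simp add: poly_monom)
  then show ?case by (simp add: Suc partial_t_synth mult_ac)
qed simp

lemma synth_cmult:
  "rapid F \<Longrightarrow> synth (\<lambda>n x. a * F n x) = (\<lambda>z. a * synth F z)"
  using sums_mult[OF synth_sums[OF rapid_imp_rapid_decay], of F a]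
  by (auto simp: fun_eq_iff sums_iff synth_def mult_ac)

lemma partial_x_funpow_synth:
  assumes "rapid F"
  shows "(partial_x ^^ j) (synth F) = synth (\<lambda>n x. \<i> ^ j * (D1 ^^ j) (F n) x)"
  using assms
proof (induction j arbitrary: F)
  case (Suc j)
  have R: "rapid (\<lambda>n. (D1 ^^ j) (F n))" "rapid (\<lambda>n. D1 ((D1 ^^ j) (F n)))" "rapid (\<lambda>n. (D1 ^^ Suc j) (F n))"
    using Suc.prems by (auto intro: rapid_D1_funpow rapid_D1)
  have "(partial_x ^^ Suc j) (synth F) = partial_x (synth (\<lambda>n x. \<i> ^ j * (D1 ^^ j) (F n) x))"
    by (simp add: Suc)
  also have "\<dots> = synth (\<lambda>n x. \<i> ^ j * (\<i> * D1 ((D1 ^^ j) (F n)) x))"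
  proof (rule partial_x_synth)
    show "rapid (\<lambda>n x. \<i> ^ j * (D1 ^^ j) (F n) x)"
      "rapid (\<lambda>n x. \<i> ^ j * (\<i> * D1 ((D1 ^^ j) (F n)) x))"
      by (intro rapid_moderate_mult R moderate_const)+
    show "((\<lambda>x. \<i> ^ j * (D1 ^^ j) (F n) x) has_vector_derivative \<i> ^ j * (\<i> * D1 ((D1 ^^ j) (F n)) x)) (at x)" for n x
      using rapid_differentiable[OF R(1), of n x]
      by (intro has_vector_derivative_mult_right) (simp add: D1_def vector_derivative_works mult.assoc[symmetric])
  qed
  finally show ?case by (simp add: mult_ac)
qed simp

lemma synth_lincomb:
  fixes G :: "nat \<Rightarrow> nat \<Rightarrow> real \<Rightarrow> complex"
  assumes "\<And>j. rapid (G j)"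
  shows "(\<Sum>j\<le>N. a j * synth (G j) z) = synth (\<lambda>n x. \<Sum>j\<le>N. a j * G j n x) z"
proof -
  obtain t x :: real where z: "z = (t, x)" by (cases z)
  have "(\<lambda>n. \<Sum>j\<le>N. a j * (cis (freq n * t) * G j n x)) sums (\<Sum>j\<le>N. a j * synth (G j) (t, x))"
    by (intro sums_sum sums_mult synth_sums rapid_imp_rapid_decay assms)
  then show ?thesis by (simp add: z synth_def sums_iff sum_distrib_left mult_ac)
qed

lemma rapid_lincomb:
  fixes G :: "nat \<Rightarrow> nat \<Rightarrow> real \<Rightarrow> complex"
  assumes "\<And>j. rapid (G j)"
  shows "rapid (\<lambda>n x. \<Sum>j\<le>N. a j * G j n x)"
  by (induction N) (auto intro!: rapid_add rapid_moderate_mult assms)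

text \<open>
On Fourier coefficients the operator acts as \<open>p(D1) + q(freq n)\<close>, which is inverted for all \<open>n\<close>
at once by \<open>poly_D1_family_solvable\<close>.
\<close>

lemma schwartz_solvable:
  fixes p q :: "complex poly"
  assumes p: "degree p > 0" and c: "c > 0" and f: "f \<in> schwartz"
    and lower: "\<And>\<xi> k. c \<le> norm (poly p (of_real \<xi>) + poly q (of_int k))"
  shows "\<exists>V. rapid V \<and> (\<lambda>z. poly_partial p partial_x (synth V) z + poly_partial q partial_t (synth V) z) = f"
proof -
  have "moderate (\<lambda>n. poly q (of_real (freq n)))" by (intro moderate_poly moderate_freq)
  moreover have "c \<le> norm (poly p (of_real \<xi>) + poly q (of_real (freq n)))" for n \<xi>
    using lower[of \<xi> "int_decode n"] by (simp add: freq_def)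
  ultimately obtain V where V: "rapid V"
    "\<And>n x. poly_D1 p (V n) x + poly q (of_real (freq n)) * V n x = coef f n x"
    using poly_D1_family_solvable[OF p _ rapid_coef[OF f] c] by blast
  have i: "(- \<i>) ^ j * (\<i> ^ j * w) = w" for j w
    unfolding mult.assoc[symmetric] power_mult_distrib[symmetric] by simp
  have RX: "rapid (\<lambda>n. (D1 ^^ j) (V n))" for j by (rule rapid_D1_funpow[OF V(1)])
  have RT: "rapid (\<lambda>n x. of_real (freq n) ^ j * V n x)" for j
    using moderate_poly[OF moderate_freq, of "monom 1 j"]
    by (intro rapid_moderate_mult V(1)) (simp add: poly_monom)
  have X: "poly_partial p partial_x (synth V) z = synth (\<lambda>n. poly_D1 p (V n)) z" for z
  proof -
    have "poly_partial p partial_x (synth V) z = (\<Sum>j\<le>degree p. coeff p j * synth (\<lambda>n. (D1 ^^ j) (V n)) z)"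
      unfolding poly_partial_def partial_x_funpow_synth[OF V(1)] synth_cmult[OF RX]
      by (intro sum.cong refl) (simp only: mult.assoc i)
    then show ?thesis using synth_lincomb[OF RX] by (simp add: poly_D1_def)
  qed
  have T: "poly_partial q partial_t (synth V) z = synth (\<lambda>n x. poly q (of_real (freq n)) * V n x) z" for z
  proof -
    have "poly_partial q partial_t (synth V) z = (\<Sum>j\<le>degree q. coeff q j * synth (\<lambda>n x. of_real (freq n) ^ j * V n x) z)"
      unfolding poly_partial_def partial_t_funpow_synth[OF V(1)] power_mult_distrib mult.assoc synth_cmult[OF RT]
      by (intro sum.cong refl) (simp only: mult.assoc i)
    then show ?thesis using synth_lincomb[OF RT] by (simp only: poly_altdef sum_distrib_right mult.assoc)
  qed
  have R1: "rapid (\<lambda>n. poly_D1 p (V n))" unfolding poly_D1_def by (rule rapid_lincomb[OF RX])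
  have R2: "rapid (\<lambda>n x. poly q (of_real (freq n)) * V n x)"
    by (intro rapid_moderate_mult V(1) moderate_poly moderate_freq)
  have "synth (\<lambda>n. poly_D1 p (V n)) z + synth (\<lambda>n x. poly q (of_real (freq n)) * V n x) z = f z" for z
  proof -
    obtain t x :: real where z: "z = (t, x)" by (cases z)
    have "synth (\<lambda>n. poly_D1 p (V n)) z + synth (\<lambda>n x. poly q (of_real (freq n)) * V n x) z = synth (coef f) z"
      using sums_add[OF synth_sums[OF rapid_imp_rapid_decay[OF R1], of t x] synth_sums[OF rapid_imp_rapid_decay[OF R2], of t x]]
        synth_sums[OF rapid_imp_rapid_decay[OF rapid_coef[OF f]], of t x]
      unfolding distrib_left[symmetric] V(2) z by (rule sums_unique2)
    then show ?thesis by (simp add: synth_coef[OF f])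
  qed
  with V(1) show ?thesis by (intro exI[of _ V]) (simp add: X T)
qed

section \<open>Integration by parts on the cylinder\<close>

abbreviation cylinder :: "(real \<times> real) set" where "cylinder \<equiv> {0..2 * pi} \<times> UNIV"

text \<open>
Decay of second order in \<open>x\<close>, uniform in \<open>t\<close>, is enough for integrability on the cylinder
and for boundary terms at infinity to vanish.
\<close>

definition quad_decay :: "cfun \<Rightarrow> bool" where
  "quad_decay g \<longleftrightarrow> continuous_on UNIV g \<and> (\<exists>C. \<forall>t x. norm (g (t, x)) \<le> C * inverse (1 + x\<^sup>2))"

lemma integrable_inverse_1_plus_square_line: "integrable lborel (\<lambda>x::real. inverse (1 + x\<^sup>2))"
proof -
  have "einterval (- \<infinity>) \<infinity> = UNIV" by (auto simp: einterval_def)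
  then show ?thesis using integrable_inverse_1_plus_square by (simp add: set_integrable_def)
qed

lemma integrable_cylinder_weight:
  "integrable lborel (\<lambda>z. indicator cylinder z * inverse (1 + (snd z)\<^sup>2) :: real)"
proof -
  have m: "(\<lambda>z. indicator cylinder z * inverse (1 + (snd z)\<^sup>2) :: real) \<in> borel_measurable (lborel \<Otimes>\<^sub>M lborel)"
  proof -
    have "1 + (snd z)\<^sup>2 \<noteq> 0" for z :: "real \<times> real"
      using zero_le_power2[of "snd z"] by linarith
    then have "(\<lambda>z :: real \<times> real. inverse (1 + (snd z)\<^sup>2)) \<in> borel_measurable borel"
      by (intro borel_measurable_continuous_onI continuous_intros) auto
    moreover have "(\<lambda>z. indicator cylinder z :: real) \<in> borel_measurable borel"
      by (intro borel_measurable_indicator) (auto intro!: borel_closed closed_Times)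
    ultimately show ?thesis unfolding lborel_prod by simp
  qed
  have "integrable (lborel \<Otimes>\<^sub>M lborel) (\<lambda>z. indicator cylinder z * inverse (1 + (snd z)\<^sup>2) :: real)"
  proof (rule lborel_pair.Fubini_integrable[OF m])
    define I where "I = (\<integral>x. inverse (1 + x\<^sup>2) \<partial>(lborel :: real measure))"
    have "(\<integral>x. norm (indicator cylinder (t, x) * inverse (1 + (snd (t, x))\<^sup>2) :: real) \<partial>lborel) =
        indicator {0..2 * pi} t * I" for t
      unfolding I_def by (simp add: indicator_times flip: integral_mult_right_zero)
    then show "integrable lborel (\<lambda>t. \<integral>x. norm (indicator cylinder (t, x) * inverse (1 + (snd (t, x))\<^sup>2) :: real) \<partial>lborel)"
      by simp
    show "AE t in lborel. integrable lborel (\<lambda>x. indicator cylinder (t, x) * inverse (1 + (snd (t, x))\<^sup>2) :: real)"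
      using integrable_inverse_1_plus_square_line by (simp add: indicator_times)
  qed
  then show ?thesis by (simp add: lborel_prod)
qed

lemma quad_decay_integrable:
  assumes "quad_decay g"
  shows "set_integrable lborel cylinder g"
proof -
  obtain C where C: "\<And>t x. norm (g (t, x)) \<le> C * inverse (1 + x\<^sup>2)" and c: "continuous_on UNIV g"
    using assms by (auto simp: quad_decay_def)
  have gm: "g \<in> borel_measurable lborel" using borel_measurable_continuous_onI[OF c] by simp
  have im: "(\<lambda>z. indicator cylinder z :: real) \<in> borel_measurable lborel"
    by (intro borel_measurable_indicator) (auto intro!: borel_closed closed_Times)
  show ?thesis
    unfolding set_integrable_def
  proof (rule Bochner_Integration.integrable_bound)
    show "integrable lborel (\<lambda>z. C * (indicator cylinder z * inverse (1 + (snd z)\<^sup>2)) :: real)"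
      by (intro integrable_mult_right integrable_cylinder_weight)
    show "(\<lambda>z. indicator cylinder z *\<^sub>R g z) \<in> borel_measurable lborel"
      by (rule borel_measurable_scaleR[OF im gm])
    show "AE z in lborel. norm (indicator cylinder z *\<^sub>R g z) \<le>
        norm (C * (indicator cylinder z * inverse (1 + (snd z)\<^sup>2)) :: real)"
    proof (intro AE_I2)
      fix z :: "real \<times> real"
      obtain t x where z: "z = (t, x)" by (cases z)
      have "norm (g z) \<le> \<bar>C * inverse (1 + (snd z)\<^sup>2)\<bar>"
        using C[of t x] unfolding z by (intro order_trans[OF _ abs_ge_self]) simp
      then show "norm (indicator cylinder z *\<^sub>R g z) \<le>
          norm (C * (indicator cylinder z * inverse (1 + (snd z)\<^sup>2)) :: real)"
        by (auto simp: indicator_def)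
    qed
  qed
qed

lemma cylinder_integral_iterated:
  assumes "quad_decay g"
  shows "(LINT z:cylinder|lborel. g z) = (\<integral>t. indicator {0..2 * pi} t *\<^sub>R (\<integral>x. g (t, x) \<partial>lborel) \<partial>lborel)"
    "(LINT z:cylinder|lborel. g z) = (\<integral>x. (\<integral>t. indicator {0..2 * pi} t *\<^sub>R g (t, x) \<partial>lborel) \<partial>lborel)"
proof -
  have i: "integrable (lborel \<Otimes>\<^sub>M lborel) (\<lambda>z. indicator cylinder z *\<^sub>R g z)"
    using quad_decay_integrable[OF assms] by (simp add: set_integrable_def lborel_prod)
  have eq: "(LINT z:cylinder|lborel. g z) = integral\<^sup>L (lborel \<Otimes>\<^sub>M lborel) (\<lambda>z. indicator cylinder z *\<^sub>R g z)"
    by (simp add: set_lebesgue_integral_def lborel_prod)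
  show "(LINT z:cylinder|lborel. g z) = (\<integral>t. indicator {0..2 * pi} t *\<^sub>R (\<integral>x. g (t, x) \<partial>lborel) \<partial>lborel)"
    unfolding eq lborel_pair.integral_fst'[OF i, symmetric] by (simp add: indicator_times)
  have i': "integrable (lborel \<Otimes>\<^sub>M lborel) (case_prod (\<lambda>t x. indicator cylinder (t, x) *\<^sub>R g (t, x)))"
    using i by (simp add: case_prod_unfold)
  have eq': "(LINT z:cylinder|lborel. g z) =
      integral\<^sup>L (lborel \<Otimes>\<^sub>M lborel) (case_prod (\<lambda>t x. indicator cylinder (t, x) *\<^sub>R g (t, x)))"
    unfolding eq by (simp add: case_prod_unfold)
  show "(LINT z:cylinder|lborel. g z) = (\<integral>x. (\<integral>t. indicator {0..2 * pi} t *\<^sub>R g (t, x) \<partial>lborel) \<partial>lborel)"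
    unfolding eq' lborel_pair.integral_snd[OF i', symmetric] by (simp add: indicator_times)
qed

lemma cylinder_integral_partial_t:
  assumes g: "\<And>t x. ((\<lambda>s. g (s, x)) has_vector_derivative g' (t, x)) (at t)"
    and per: "periodic_t g" and dec: "quad_decay g'"
  shows "(LINT z:cylinder|lborel. g' z) = 0"
proof -
  have c: "continuous_on UNIV g'" using dec by (simp add: quad_decay_def)
  have "(\<integral>t. indicator {0..2 * pi} t *\<^sub>R g' (t, x) \<partial>lborel) = g (2 * pi, x) - g (0, x)" for x
    using g by (intro integral_FTC_atLeastAtMost continuous_on_slices(1)[OF c])
      (auto intro: has_vector_derivative_at_within)
  moreover have "g (2 * pi, x) = g (0, x)" for x
    using per[unfolded periodic_t_def, rule_format, of 0 x] by simp
  ultimately show ?thesis by (simp add: cylinder_integral_iterated(2)[OF dec])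
qed

text \<open>
The fundamental theorem of calculus on the whole line: the primitive vanishes at both ends.
\<close>

lemma line_integral_derivative:
  fixes F f :: "real \<Rightarrow> complex"
  assumes F: "\<And>x. (F has_vector_derivative f x) (at x)" and cf: "continuous_on UNIV f"
    and dF: "\<And>x. norm (F x) \<le> C * inverse (1 + x\<^sup>2)" and df: "\<And>x. norm (f x) \<le> D * inverse (1 + x\<^sup>2)"
  shows "(\<integral>x. f x \<partial>lborel) = 0"
proof -
  have ei: "einterval (- \<infinity>) \<infinity> = UNIV" by (auto simp: einterval_def)
  have lim: "(F \<longlongrightarrow> 0) at_infinity"
  proof (rule Lim_null_comparison)
    show "\<forall>\<^sub>F x in at_infinity. norm (F x) \<le> \<bar>C\<bar> * \<bar>inverse x\<bar>"
      unfolding eventually_at_infinity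
    proof (intro exI allI impI)
      fix x :: real assume x: "1 \<le> norm x"
      have "\<bar>x\<bar> \<le> 1 + x\<^sup>2" using x self_le_power[of "\<bar>x\<bar>" 2] by simp
      then have "inverse (1 + x\<^sup>2) \<le> inverse \<bar>x\<bar>" using x by (intro le_imp_inverse_le) auto
      then have "C * inverse (1 + x\<^sup>2) \<le> \<bar>C\<bar> * inverse \<bar>x\<bar>" by (intro mult_mono) auto
      with dF[of x] show "norm (F x) \<le> \<bar>C\<bar> * \<bar>inverse x\<bar>" by simp
    qed
    show "((\<lambda>x. \<bar>C\<bar> * \<bar>inverse x\<bar>) \<longlongrightarrow> 0) at_infinity"
      by (intro tendsto_mult_right_zero tendsto_rabs_zero tendsto_inverse_0)
  qed
  have int: "integrable lborel f"
  proof (rule Bochner_Integration.integrable_bound)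
    show "integrable lborel (\<lambda>x. D * inverse (1 + x\<^sup>2))"
      by (intro integrable_mult_right integrable_inverse_1_plus_square_line)
    show "f \<in> borel_measurable lborel" using borel_measurable_continuous_onI[OF cf] by simp
    show "AE x in lborel. norm (f x) \<le> norm (D * inverse (1 + x\<^sup>2))"
      using df by (intro AE_I2) (metis abs_ge_self order_trans real_norm_def)
  qed
  have "(LBINT x=-\<infinity>..\<infinity>. f x) = 0 - 0"
  proof (rule interval_integral_FTC_integrable)
    show "isCont f x" for x using cf by (simp add: continuous_on_eq_continuous_at)
    show "set_integrable lborel (einterval (- \<infinity>) \<infinity>) f" using int by (simp add: ei set_integrable_def)
    show "((F \<circ> real_of_ereal) \<longlongrightarrow> 0) (at_right (- \<infinity>))"
      unfolding ereal_tendsto_simps by (rule tendsto_mono[OF at_bot_le_at_infinity lim])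
    show "((F \<circ> real_of_ereal) \<longlongrightarrow> 0) (at_left \<infinity>)"
      unfolding ereal_tendsto_simps by (rule tendsto_mono[OF at_top_le_at_infinity lim])
  qed (use F in auto)
  then show ?thesis by (simp add: interval_lebesgue_integral_def ei set_lebesgue_integral_def)
qed

lemma cylinder_integral_partial_x:
  assumes g: "\<And>t x. ((\<lambda>y. g (t, y)) has_vector_derivative g' (t, x)) (at x)"
    and dec: "quad_decay g" "quad_decay g'"
  shows "(LINT z:cylinder|lborel. g' z) = 0"
proof -
  obtain C where C: "\<And>t x. norm (g (t, x)) \<le> C * inverse (1 + x\<^sup>2)" using dec(1) by (auto simp: quad_decay_def)
  obtain D where D: "\<And>t x. norm (g' (t, x)) \<le> D * inverse (1 + x\<^sup>2)" using dec(2) by (auto simp: quad_decay_def)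
  have c: "continuous_on UNIV g'" using dec by (simp add: quad_decay_def)
  have "(\<integral>x. g' (t, x) \<partial>lborel) = 0" for t
    by (rule line_integral_derivative[OF g continuous_on_slices(2)[OF c] C D])
  then show ?thesis by (simp add: cylinder_integral_iterated(1)[OF dec(2)])
qed

lemma quad_decay_mult:
  assumes "quad_decay f" "continuous_on UNIV h" "bounded (range h)"
  shows "quad_decay (\<lambda>z. f z * h z)"
proof -
  obtain C where C: "\<And>t x. norm (f (t, x)) \<le> C * inverse (1 + x\<^sup>2)" using assms(1) by (auto simp: quad_decay_def)
  obtain B where B: "\<And>z. norm (h z) \<le> B" using assms(3) by (auto simp: bounded_iff)
  have "norm (f (t, x) * h (t, x)) \<le> (C * B) * inverse (1 + x\<^sup>2)" for t x
  proof -
    have "norm (f (t, x)) * norm (h (t, x)) \<le> (C * inverse (1 + x\<^sup>2)) * B"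
      using C[of t x] B by (intro mult_mono order_trans[OF norm_ge_zero C]) auto
    then show ?thesis by (simp add: norm_mult mult_ac)
  qed
  moreover have "continuous_on UNIV (\<lambda>z. f z * h z)"
    using assms by (intro continuous_intros) (auto simp: quad_decay_def)
  ultimately show ?thesis unfolding quad_decay_def by blast
qed

lemma quad_decay_add:
  assumes "quad_decay f" "quad_decay g"
  shows "quad_decay (\<lambda>z. f z + g z)"
proof -
  obtain C where C: "\<And>t x. norm (f (t, x)) \<le> C * inverse (1 + x\<^sup>2)" using assms(1) by (auto simp: quad_decay_def)
  obtain D where D: "\<And>t x. norm (g (t, x)) \<le> D * inverse (1 + x\<^sup>2)" using assms(2) by (auto simp: quad_decay_def)
  have "norm (f (t, x) + g (t, x)) \<le> (C + D) * inverse (1 + x\<^sup>2)" for t x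
    using norm_triangle_mono[OF C[of t x] D[of t x]] by (simp add: distrib_right)
  moreover have "continuous_on UNIV (\<lambda>z. f z + g z)"
    using assms by (intro continuous_intros) (auto simp: quad_decay_def)
  ultimately show ?thesis unfolding quad_decay_def by blast
qed

lemma quad_decay_continuous: "quad_decay g \<Longrightarrow> continuous_on UNIV g"
  by (simp add: quad_decay_def)

lemma quad_decay_bounded:
  assumes "quad_decay g"
  shows "bounded (range g)"
proof -
  obtain C where C: "\<And>t x. norm (g (t, x)) \<le> C * inverse (1 + x\<^sup>2)" using assms by (auto simp: quad_decay_def)
  have "norm (g (t, x)) \<le> \<bar>C\<bar>" for t x
  proof -
    have "inverse (1 + x\<^sup>2) \<le> 1" by (simp add: inverse_le_1_iff)
    then have "C * inverse (1 + x\<^sup>2) \<le> \<bar>C\<bar> * 1" by (intro mult_mono) auto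
    with C[of t x] show ?thesis by simp
  qed
  then show ?thesis by (auto simp: bounded_iff)
qed

lemma quad_decay_sum:
  assumes "\<And>j. quad_decay (g j)"
  shows "quad_decay (\<lambda>z. \<Sum>j\<le>(N::nat). a j * g j z)"
proof -
  have c: "quad_decay (\<lambda>z. a j * g j z)" for j
    using quad_decay_mult[OF assms, of "\<lambda>_. a j" j] by (simp add: mult.commute image_constant_conv)
  show ?thesis by (induction N) (simp_all add: c quad_decay_add)
qed

text \<open>
The integral of a \<open>t\<close>-derivative over a period is zero; apply this to the product.
\<close>

lemma functional_of_fun_partial_t:
  assumes f: "periodic_t f" "C_infinity f" "quad_decay f" "quad_decay (partial_t f)"
    and h: "periodic_t h" "C_infinity h" "bounded (range h)" "bounded (range (partial_t h))"
  shows "functional_of_fun h (partial_t f) = - functional_of_fun (partial_t h) f"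
proof -
  have q: "quad_decay (\<lambda>z. f z * partial_t h z)" "quad_decay (\<lambda>z. partial_t f z * h z)"
    by (intro quad_decay_mult f h C_infinityD)+
  have "(LINT z:cylinder|lborel. f z * partial_t h z + partial_t f z * h z) = 0"
  proof (rule cylinder_integral_partial_t)
    show "((\<lambda>s. f (s, x) * h (s, x)) has_vector_derivative
        f (t, x) * partial_t h (t, x) + partial_t f (t, x) * h (t, x)) (at t)" for t x
      by (intro has_vector_derivative_mult C_infinity_has_partials f h)
    show "periodic_t (\<lambda>z. f z * h z)" using f(1) h(1) by (simp add: periodic_t_def)
    show "quad_decay (\<lambda>z. f z * partial_t h z + partial_t f z * h z)"
      using quad_decay_add q by blast
  qed
  then show ?thesis
    unfolding functional_of_fun_def
    by (subst (asm) set_integral_add) (auto intro!: quad_decay_integrable q simp: add_eq_0_iff)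
qed

text \<open>
The same argument with vanishing boundary terms at infinity in place of periodicity.
\<close>

lemma functional_of_fun_partial_x:
  assumes f: "C_infinity f" "quad_decay f" "quad_decay (partial_x f)"
    and h: "C_infinity h" "bounded (range h)" "bounded (range (partial_x h))"
  shows "functional_of_fun h (partial_x f) = - functional_of_fun (partial_x h) f"
proof -
  have q: "quad_decay (\<lambda>z. f z * partial_x h z)" "quad_decay (\<lambda>z. partial_x f z * h z)"
    by (intro quad_decay_mult f h C_infinityD)+
  have "(LINT z:cylinder|lborel. f z * partial_x h z + partial_x f z * h z) = 0"
  proof (rule cylinder_integral_partial_x)
    show "((\<lambda>y. f (t, y) * h (t, y)) has_vector_derivative
        f (t, x) * partial_x h (t, x) + partial_x f (t, x) * h (t, x)) (at x)" for t x
      by (intro has_vector_derivative_mult C_infinity_has_partials f h)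
    show "quad_decay (\<lambda>z. f z * h z)" by (intro quad_decay_mult f h C_infinityD)
    show "quad_decay (\<lambda>z. f z * partial_x h z + partial_x f z * h z)"
      using quad_decay_add q by blast
  qed
  then show ?thesis
    unfolding functional_of_fun_def
    by (subst (asm) set_integral_add) (auto intro!: quad_decay_integrable q simp: add_eq_0_iff)
qed

lemma schwartz_quad_decay:
  assumes "f \<in> schwartz"
  shows "quad_decay ((partial_t ^^ a) ((partial_x ^^ b) f))"
proof -
  define g where "g = (partial_t ^^ a) ((partial_x ^^ b) f)"
  have "C_infinity ((partial_x ^^ b) f)"
    by (induction b) (use schwartzD(2)[OF assms] in \<open>auto intro: C_infinityD\<close>)
  then have "C_infinity g" unfolding g_def by (induction a) (auto intro: C_infinityD)
  then have "continuous_on UNIV g" by (rule C_infinityD)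
  moreover obtain C where C: "\<And>t x. \<bar>x\<bar> ^ 0 * norm (g (t, x)) \<le> C" using schwartzD(3)[OF assms] unfolding g_def by blast
  moreover obtain D where D: "\<And>t x. \<bar>x\<bar> ^ 2 * norm (g (t, x)) \<le> D" using schwartzD(3)[OF assms] unfolding g_def by blast
  have "norm (g (t, x)) \<le> (C + D) * inverse (1 + x\<^sup>2)" for t x
  proof -
    have "(1 + x\<^sup>2) * norm (g (t, x)) \<le> C + D" using C[of x t] D[of x t] by (simp add: algebra_simps)
    moreover have "0 < 1 + x\<^sup>2" by (simp add: add_pos_nonneg)
    ultimately show ?thesis by (simp add: field_simps)
  qed
  ultimately show ?thesis unfolding quad_decay_def g_def by blast
qed

lemma schwartz_pure_derivatives:
  assumes "f \<in> schwartz"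
  shows "quad_decay f" "quad_decay ((partial_t ^^ j) f)" "quad_decay ((partial_x ^^ j) f)"
  using schwartz_quad_decay[OF assms, of 0 0] schwartz_quad_decay[OF assms, of j 0] schwartz_quad_decay[OF assms, of 0 j]
  by simp_all

lemma partial_funpow:
  assumes "C_infinity f"
  shows "C_infinity ((partial_t ^^ j) f)" "C_infinity ((partial_x ^^ j) f)"
    "periodic_t f \<Longrightarrow> periodic_t ((partial_t ^^ j) f)"
  by (induction j) (use assms in \<open>auto intro: C_infinityD periodic_t_partial\<close>)

text \<open>
The function \<open>h\<close> is only assumed bounded with its derivatives in \<open>t\<close>, so that both Schwartz functions
and plane waves are covered.
\<close>

lemma functional_of_fun_partial_t_funpow:
  assumes f: "f \<in> schwartz"
    and h: "periodic_t h" "C_infinity h" "\<And>j. bounded (range ((partial_t ^^ j) h))"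
  shows "functional_of_fun h ((partial_t ^^ j) f) = (- 1) ^ j * functional_of_fun ((partial_t ^^ j) h) f"
  using h
proof (induction j arbitrary: h)
  case (Suc j)
  note F = schwartzD(1,2)[OF f]
  have b: "bounded (range ((partial_t ^^ i) (partial_t h)))" for i
    using Suc.prems(3)[of "Suc i"] by (simp add: funpow_swap1)
  have "functional_of_fun h ((partial_t ^^ Suc j) f) = functional_of_fun h (partial_t ((partial_t ^^ j) f))" by simp
  also have "\<dots> = - functional_of_fun (partial_t h) ((partial_t ^^ j) f)"
    using schwartz_pure_derivatives(2)[OF f, of j] schwartz_pure_derivatives(2)[OF f, of "Suc j"]
      Suc.prems(3)[of 0] Suc.prems(3)[of 1]
    by (intro functional_of_fun_partial_t partial_funpow F Suc.prems(1,2)) simp_all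
  also have "functional_of_fun (partial_t h) ((partial_t ^^ j) f) =
      (- 1) ^ j * functional_of_fun ((partial_t ^^ j) (partial_t h)) f"
    by (rule Suc.IH) (use Suc.prems b in \<open>auto intro: periodic_t_partial C_infinityD\<close>)
  finally show ?case by (simp add: funpow_swap1)
qed simp

lemma functional_of_fun_partial_x_funpow:
  assumes f: "f \<in> schwartz"
    and h: "C_infinity h" "\<And>j. bounded (range ((partial_x ^^ j) h))"
  shows "functional_of_fun h ((partial_x ^^ j) f) = (- 1) ^ j * functional_of_fun ((partial_x ^^ j) h) f"
  using h
proof (induction j arbitrary: h)
  case (Suc j)
  note F = schwartzD(1,2)[OF f]
  have b: "bounded (range ((partial_x ^^ i) (partial_x h)))" for i
    using Suc.prems(2)[of "Suc i"] by (simp add: funpow_swap1)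
  have "functional_of_fun h ((partial_x ^^ Suc j) f) = functional_of_fun h (partial_x ((partial_x ^^ j) f))" by simp
  also have "\<dots> = - functional_of_fun (partial_x h) ((partial_x ^^ j) f)"
    using schwartz_pure_derivatives(3)[OF f, of j] schwartz_pure_derivatives(3)[OF f, of "Suc j"]
      Suc.prems(2)[of 0] Suc.prems(2)[of 1]
    by (intro functional_of_fun_partial_x partial_funpow F Suc.prems(1)) simp_all
  also have "functional_of_fun (partial_x h) ((partial_x ^^ j) f) =
      (- 1) ^ j * functional_of_fun ((partial_x ^^ j) (partial_x h)) f"
    by (rule Suc.IH) (use Suc.prems b in \<open>auto intro: C_infinityD\<close>)
  finally show ?case by (simp add: funpow_swap1)
qed simp

lemma functional_of_fun_sum_test:
  assumes "continuous_on UNIV h" "bounded (range h)" "\<And>j. quad_decay (f j)"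
  shows "functional_of_fun h (\<lambda>z. \<Sum>j\<le>N. a j * f j z) = (\<Sum>j\<le>N. a j * functional_of_fun h (f j))"
proof -
  have i: "set_integrable lborel cylinder (\<lambda>z. f j z * h z)" for j
    by (intro quad_decay_integrable quad_decay_mult assms)
  have "functional_of_fun h (\<lambda>z. \<Sum>j\<le>N. a j * f j z) = (LINT z:cylinder|lborel. \<Sum>j\<le>N. a j * (f j z * h z))"
    unfolding functional_of_fun_def by (simp add: sum_distrib_right mult.assoc)
  also have "\<dots> = (\<Sum>j\<le>N. LINT z:cylinder|lborel. a j * (f j z * h z))"
    using set_integrable_mult_right[OF i]
    unfolding set_lebesgue_integral_def set_integrable_def scaleR_sum_right
    by (intro Bochner_Integration.integral_sum) simp
  finally show ?thesis by (simp add: functional_of_fun_def)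
qed

lemma functional_of_fun_sum_fun:
  assumes "\<And>j. continuous_on UNIV (h j)" "\<And>j. bounded (range (h j))" "quad_decay f"
  shows "functional_of_fun (\<lambda>z. \<Sum>j\<le>N. a j * h j z) f = (\<Sum>j\<le>N. a j * functional_of_fun (h j) f)"
proof -
  have i: "set_integrable lborel cylinder (\<lambda>z. f z * h j z)" for j
    by (intro quad_decay_integrable quad_decay_mult assms)
  have "functional_of_fun (\<lambda>z. \<Sum>j\<le>N. a j * h j z) f = (LINT z:cylinder|lborel. \<Sum>j\<le>N. a j * (f z * h j z))"
    unfolding functional_of_fun_def by (simp add: sum_distrib_left mult_ac)
  also have "\<dots> = (\<Sum>j\<le>N. LINT z:cylinder|lborel. a j * (f z * h j z))"
    using set_integrable_mult_right[OF i]
    unfolding set_lebesgue_integral_def set_integrable_def scaleR_sum_right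
    by (intro Bochner_Integration.integral_sum) simp
  finally show ?thesis by (simp add: functional_of_fun_def)
qed

section \<open>Regularity when the symbol has no zero\<close>

lemma partial_lincomb:
  assumes "\<And>t x. (\<lambda>s. f (s, x)) differentiable (at t)" "\<And>t x. (\<lambda>s. g (s, x)) differentiable (at t)"
    "\<And>t x. (\<lambda>y. f (t, y)) differentiable (at x)" "\<And>t x. (\<lambda>y. g (t, y)) differentiable (at x)"
  shows "partial_t (\<lambda>z. f z + a * g z) = (\<lambda>z. partial_t f z + a * partial_t g z)"
    "partial_x (\<lambda>z. f z + a * g z) = (\<lambda>z. partial_x f z + a * partial_x g z)"
proof -
  have "((\<lambda>s. f (s, x) + a * g (s, x)) has_vector_derivative partial_t f (t, x) + a * partial_t g (t, x)) (at t)" for t x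
    using assms(1,2) unfolding partial_t_def
    by (auto intro!: has_vector_derivative_add has_vector_derivative_mult_right simp flip: vector_derivative_works)
  then show "partial_t (\<lambda>z. f z + a * g z) = (\<lambda>z. partial_t f z + a * partial_t g z)"
    by (simp add: partial_t_def[of "\<lambda>z. f z + a * g z"] fun_eq_iff vector_derivative_at)
  have "((\<lambda>y. f (t, y) + a * g (t, y)) has_vector_derivative partial_x f (t, x) + a * partial_x g (t, x)) (at x)" for t x
    using assms(3,4) unfolding partial_x_def
    by (auto intro!: has_vector_derivative_add has_vector_derivative_mult_right simp flip: vector_derivative_works)
  then show "partial_x (\<lambda>z. f z + a * g z) = (\<lambda>z. partial_x f z + a * partial_x g z)"
    by (simp add: partial_x_def[of "\<lambda>z. f z + a * g z"] fun_eq_iff vector_derivative_at)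
qed

lemma C_k_lincomb:
  assumes "C_k k f" "C_k k g"
  shows "C_k k (\<lambda>z. f z + a * g z)"
  using assms
proof (induction k arbitrary: f g)
  case (Suc k)
  then have d: "\<And>t x. (\<lambda>s. f (s, x)) differentiable (at t)" "\<And>t x. (\<lambda>s. g (s, x)) differentiable (at t)"
    "\<And>t x. (\<lambda>y. f (t, y)) differentiable (at x)" "\<And>t x. (\<lambda>y. g (t, y)) differentiable (at x)" by auto
  have "continuous_on UNIV (\<lambda>z. f z + a * g z)" using Suc.prems by (intro continuous_intros) auto
  moreover have "(\<lambda>s. f (s, x) + a * g (s, x)) differentiable (at t)" for t x
    by (intro differentiable_add differentiable_mult differentiable_const d)
  moreover have "(\<lambda>y. f (t, y) + a * g (t, y)) differentiable (at x)" for t x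
    by (intro differentiable_add differentiable_mult differentiable_const d)
  ultimately show ?case using Suc by (simp add: partial_lincomb[OF d])
qed (auto intro!: continuous_intros)

lemma C_infinity_lincomb: "C_infinity f \<Longrightarrow> C_infinity g \<Longrightarrow> C_infinity (\<lambda>z. f z + a * g z)"
  by (simp add: C_infinity_def C_k_lincomb)

lemma partial_funpow_lincomb:
  assumes f: "C_infinity f" and g: "C_infinity g"
  shows "(partial_t ^^ j) (\<lambda>z. f z + a * g z) = (\<lambda>z. (partial_t ^^ j) f z + a * (partial_t ^^ j) g z)"
    "(partial_x ^^ j) (\<lambda>z. f z + a * g z) = (\<lambda>z. (partial_x ^^ j) f z + a * (partial_x ^^ j) g z)"
proof -
  show "(partial_t ^^ j) (\<lambda>z. f z + a * g z) = (\<lambda>z. (partial_t ^^ j) f z + a * (partial_t ^^ j) g z)"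
  proof (induction j)
    case (Suc j)
    then show ?case
      using partial_lincomb(1)[OF C_infinityD(2)[OF partial_funpow(1)[OF f]] C_infinityD(2)[OF partial_funpow(1)[OF g]]
          C_infinityD(3)[OF partial_funpow(1)[OF f]] C_infinityD(3)[OF partial_funpow(1)[OF g]]] by simp
  qed simp
  show "(partial_x ^^ j) (\<lambda>z. f z + a * g z) = (\<lambda>z. (partial_x ^^ j) f z + a * (partial_x ^^ j) g z)"
  proof (induction j)
    case (Suc j)
    then show ?case
      using partial_lincomb(2)[OF C_infinityD(2)[OF partial_funpow(2)[OF f]] C_infinityD(2)[OF partial_funpow(2)[OF g]]
          C_infinityD(3)[OF partial_funpow(2)[OF f]] C_infinityD(3)[OF partial_funpow(2)[OF g]]] by simp
  qed simp
qed

lemma schwartz_lincomb: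
  assumes f: "f \<in> schwartz" and g: "g \<in> schwartz"
  shows "(\<lambda>z. f z + a * g z) \<in> schwartz"
  unfolding schwartz_def
proof (intro CollectI conjI allI)
  note F = schwartzD(1,2)[OF f] and G = schwartzD(1,2)[OF g]
  show "periodic_t (\<lambda>z. f z + a * g z)" using F(1) G(1) by (simp add: periodic_t_def)
  show "C_infinity (\<lambda>z. f z + a * g z)" by (rule C_infinity_lincomb[OF F(2) G(2)])
  fix i j c
  have d: "(partial_t ^^ i) ((partial_x ^^ j) (\<lambda>z. f z + a * g z)) =
      (\<lambda>z. (partial_t ^^ i) ((partial_x ^^ j) f) z + a * (partial_t ^^ i) ((partial_x ^^ j) g) z)"
    unfolding partial_funpow_lincomb(2)[OF F(2) G(2)]
    by (rule partial_funpow_lincomb(1)[OF partial_funpow(2)[OF F(2)] partial_funpow(2)[OF G(2)]])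
  obtain C where C: "\<And>t x. \<bar>x\<bar> ^ c * norm ((partial_t ^^ i) ((partial_x ^^ j) f) (t, x)) \<le> C"
    using schwartzD(3)[OF f] by blast
  obtain D where D: "\<And>t x. \<bar>x\<bar> ^ c * norm ((partial_t ^^ i) ((partial_x ^^ j) g) (t, x)) \<le> D"
    using schwartzD(3)[OF g] by blast
  show "bdd_above (range (weighted_deriv i j c (\<lambda>z. f z + a * g z)))"
  proof (rule bdd_aboveI)
    fix r assume "r \<in> range (weighted_deriv i j c (\<lambda>z. f z + a * g z))"
    then obtain t x where r: "r = weighted_deriv i j c (\<lambda>z. f z + a * g z) (t, x)" by auto
    let ?F = "(partial_t ^^ i) ((partial_x ^^ j) f) (t, x)" and ?G = "(partial_t ^^ i) ((partial_x ^^ j) g) (t, x)"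
    have "r = \<bar>x\<bar> ^ c * norm (?F + a * ?G)" by (simp add: r weighted_deriv_def d norm_mult norm_power)
    also have "\<dots> \<le> \<bar>x\<bar> ^ c * (norm ?F + norm a * norm ?G)"
      by (intro mult_left_mono order_trans[OF norm_triangle_ineq]) (auto simp: norm_mult)
    also have "\<dots> = \<bar>x\<bar> ^ c * norm ?F + norm a * (\<bar>x\<bar> ^ c * norm ?G)" by (simp add: algebra_simps)
    also have "\<dots> \<le> C + norm a * D" by (intro add_mono mult_left_mono C D) auto
    finally show "r \<le> C + norm a * D" .
  qed
qed

lemma schwartz_cmult:
  assumes "f \<in> schwartz"
  shows "(\<lambda>z. a * f z) \<in> schwartz"
  using schwartz_lincomb[OF assms assms, of "a - 1"] by (simp add: algebra_simps)

lemma schwartz_add: "f \<in> schwartz \<Longrightarrow> g \<in> schwartz \<Longrightarrow> (\<lambda>z. f z + g z) \<in> schwartz"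
  using schwartz_lincomb[of f g 1] by simp

lemma schwartz_sum:
  assumes "\<And>j. f j \<in> schwartz"
  shows "(\<lambda>z. \<Sum>j\<le>(N::nat). a j * f j z) \<in> schwartz"
  by (induction N) (auto intro!: schwartz_add schwartz_cmult assms)

lemma tempered_sum:
  assumes u: "u \<in> tempered_distributions" and f: "\<And>j. f j \<in> schwartz"
  shows "u (\<lambda>z. \<Sum>j\<le>(N::nat). a j * f j z) = (\<Sum>j\<le>N. a j * u (f j))"
proof (induction N)
  case 0
  then show ?case using u f by (simp add: tempered_distributions_def)
next
  case (Suc N)
  have "u (\<lambda>z. (\<Sum>j\<le>N. a j * f j z) + a (Suc N) * f (Suc N) z) =
      u (\<lambda>z. \<Sum>j\<le>N. a j * f j z) + u (\<lambda>z. a (Suc N) * f (Suc N) z)"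
    using u schwartz_sum[OF f] schwartz_cmult[OF f] by (simp add: tempered_distributions_def)
  also have "u (\<lambda>z. a (Suc N) * f (Suc N) z) = a (Suc N) * u (f (Suc N))"
    using u f by (simp add: tempered_distributions_def)
  finally show ?case using Suc by simp
qed

lemma D_funpow:
  "(D_x ^^ j) u \<phi> = \<i> ^ j * u ((partial_x ^^ j) \<phi>)"
  "(D_t ^^ j) u \<phi> = \<i> ^ j * u ((partial_t ^^ j) \<phi>)"
proof (induction j arbitrary: \<phi>)
  case (Suc j)
  {
    case 1
    show ?case by (simp add: D_x_def[of "(D_x ^^ j) u"] Suc(1) funpow_swap1[of partial_x])
  next
    case 2
    show ?case by (simp add: D_t_def[of "(D_t ^^ j) u"] Suc(2) funpow_swap1[of partial_t])
  }
qed simp_all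

lemma poly_operator_eq:
  "poly_operator p D_x u \<phi> = (\<Sum>j\<le>degree p. coeff p j * \<i> ^ j * u ((partial_x ^^ j) \<phi>))"
  "poly_operator p D_t u \<phi> = (\<Sum>j\<le>degree p. coeff p j * \<i> ^ j * u ((partial_t ^^ j) \<phi>))"
  by (simp_all add: poly_operator_def D_funpow mult.assoc)

text \<open>
Transposition replaces each \<open>D\<close> by \<open>-D\<close>, that is, the polynomial \<open>p(z)\<close> by \<open>p(-z)\<close>.
\<close>

definition reflect :: "complex poly \<Rightarrow> complex poly" where "reflect p = pcompose p [:0, - 1:]"

lemma reflect_properties:
  "degree (reflect p) = degree p" "poly (reflect p) z = poly p (- z)" "coeff (reflect p) j = (- 1) ^ j * coeff p j"
  by (simp_all add: reflect_def degree_pcompose poly_pcompose coeff_pcompose_linear)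

lemma poly_partial_reflect:
  "poly_partial (reflect p) d f = (\<lambda>z. \<Sum>j\<le>degree p. coeff p j * \<i> ^ j * (d ^^ j) f z)"
proof -
  have sgn: "(- 1) ^ j * (- \<i>) ^ j = \<i> ^ j" for j
    by (simp flip: power_mult_distrib)
  have "(- 1) ^ j * c * (- \<i>) ^ j * w = c * \<i> ^ j * w" for c w :: complex and j
    unfolding sgn[symmetric] by (simp only: mult_ac)
  then show ?thesis unfolding poly_partial_def reflect_properties by presburger
qed

lemma functional_of_fun_add:
  assumes "continuous_on UNIV h" "bounded (range h)" "quad_decay f" "quad_decay g"
  shows "functional_of_fun h (\<lambda>z. f z + g z) = functional_of_fun h f + functional_of_fun h g"
  unfolding functional_of_fun_def distrib_right
  by (intro set_integral_add quad_decay_integrable quad_decay_mult assms)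

lemma functional_of_fun_add_fun:
  assumes "continuous_on UNIV h" "bounded (range h)" "continuous_on UNIV k" "bounded (range k)" "quad_decay f"
  shows "functional_of_fun (\<lambda>z. h z + k z) f = functional_of_fun h f + functional_of_fun k f"
  unfolding functional_of_fun_def distrib_left
  by (intro set_integral_add quad_decay_integrable quad_decay_mult assms)

lemma quad_decay_poly_partial:
  "(\<And>j. quad_decay ((d ^^ j) f)) \<Longrightarrow> quad_decay (poly_partial p d f)"
  unfolding poly_partial_def by (rule quad_decay_sum)

lemma poly_partial_transpose:
  assumes d: "\<And>j. functional_of_fun v ((d ^^ j) f) = (- 1) ^ j * functional_of_fun ((d ^^ j) v) f"
    and v: "\<And>j. quad_decay ((d ^^ j) v)" and f: "\<And>j. quad_decay ((d ^^ j) f)"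
  shows "functional_of_fun v (poly_partial (reflect p) d f) = functional_of_fun (poly_partial p d v) f"
proof -
  have sgn: "\<i> ^ j * ((- 1) ^ j * w) = (- \<i>) ^ j * w" for j w
    by (simp add: power_minus[of \<i> j] mult_ac)
  have "functional_of_fun v (poly_partial (reflect p) d f) =
      (\<Sum>j\<le>degree p. coeff p j * \<i> ^ j * functional_of_fun v ((d ^^ j) f))"
    unfolding poly_partial_reflect using quad_decay_continuous[OF v[of 0]] quad_decay_bounded[OF v[of 0]]
    by (intro functional_of_fun_sum_test f) simp_all
  also have "\<dots> = (\<Sum>j\<le>degree p. coeff p j * (- \<i>) ^ j * functional_of_fun ((d ^^ j) v) f)"
    unfolding d mult.assoc sgn ..
  also have "\<dots> = functional_of_fun (poly_partial p d v) f"
    unfolding poly_partial_def using f[of 0]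
    by (intro functional_of_fun_sum_fun[symmetric] quad_decay_continuous quad_decay_bounded v) simp
  finally show ?thesis .
qed

lemma schwartz_transpose:
  assumes v: "v \<in> schwartz" and f: "f \<in> schwartz"
  shows "functional_of_fun v (poly_partial (reflect p) partial_x f) = functional_of_fun (poly_partial p partial_x v) f"
    "functional_of_fun v (poly_partial (reflect p) partial_t f) = functional_of_fun (poly_partial p partial_t v) f"
  by (intro poly_partial_transpose functional_of_fun_partial_x_funpow functional_of_fun_partial_t_funpow
      schwartzD(1,2)[OF v] f schwartz_pure_derivatives[OF v] schwartz_pure_derivatives[OF f] quad_decay_bounded)+

text \<open>
The duality argument: both the equation and its transpose are solved in the Schwartz space, and
the solution of the former represents \<open>u\<close>.
\<close>

lemma tempered_solution_is_schwartz:
  fixes p q :: "complex poly"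
  assumes u: "u \<in> tempered_distributions" and p: "degree p > 0" and c: "c > 0"
    and lower: "\<And>\<xi> k. c \<le> norm (poly p (of_real \<xi>) + poly q (of_int k))"
    and Lu: "is_schwartz_function (\<lambda>\<phi>. poly_operator p D_x u \<phi> + poly_operator q D_t u \<phi>)"
  shows "is_schwartz_function u"
proof -
  obtain f where f: "f \<in> schwartz"
    "\<And>\<phi>. \<phi> \<in> schwartz \<Longrightarrow> poly_operator p D_x u \<phi> + poly_operator q D_t u \<phi> = functional_of_fun f \<phi>"
    using Lu by (auto simp: is_schwartz_function_def)
  obtain V where V: "rapid V" "(\<lambda>z. poly_partial p partial_x (synth V) z + poly_partial q partial_t (synth V) z) = f"
    using schwartz_solvable[OF p c f(1) lower] by blast
  define v where "v = synth V"
  have v: "v \<in> schwartz" unfolding v_def by (rule synth_in_schwartz[OF V(1)])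
  have "u \<phi> = functional_of_fun v \<phi>" if \<phi>: "\<phi> \<in> schwartz" for \<phi>
  proof -
    have lower': "c \<le> norm (poly (reflect p) (of_real \<xi>) + poly (reflect q) (of_int k))" for \<xi> k
      using lower[of "- \<xi>" "- k"] by (simp add: reflect_properties)
    obtain W where W: "rapid W"
      "(\<lambda>z. poly_partial (reflect p) partial_x (synth W) z + poly_partial (reflect q) partial_t (synth W) z) = \<phi>"
      using schwartz_solvable[OF _ c \<phi> lower'] p by (auto simp: reflect_properties)
    define \<psi> where "\<psi> = synth W"
    have \<psi>: "\<psi> \<in> schwartz" unfolding \<psi>_def by (rule synth_in_schwartz[OF W(1)])
    have X: "(partial_x ^^ j) \<psi> \<in> schwartz" for j
      by (induction j) (auto intro: \<psi> schwartz_partial_x)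
    have T: "(partial_t ^^ j) \<psi> \<in> schwartz" for j
    proof -
      have "moderate (\<lambda>n. (\<i> * freq n) ^ j)"
        using moderate_poly[OF moderate_mult[OF moderate_const[of \<i>] moderate_freq], of "monom 1 j"]
        by (simp add: poly_monom)
      then show ?thesis unfolding \<psi>_def partial_t_funpow_synth[OF W(1)]
        by (intro synth_in_schwartz rapid_moderate_mult W(1))
    qed
    note decay = schwartz_pure_derivatives[OF v] schwartz_pure_derivatives[OF \<psi>]
    have S: "poly_partial (reflect p) partial_x \<psi> \<in> schwartz" "poly_partial (reflect q) partial_t \<psi> \<in> schwartz"
      unfolding poly_partial_reflect by (intro schwartz_sum X T)+
    have "u \<phi> = u (poly_partial (reflect p) partial_x \<psi>) + u (poly_partial (reflect q) partial_t \<psi>)"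
      using u S unfolding W(2)[symmetric] \<psi>_def[symmetric] by (simp add: tempered_distributions_def)
    also have "\<dots> = poly_operator p D_x u \<psi> + poly_operator q D_t u \<psi>"
      unfolding poly_partial_reflect poly_operator_eq tempered_sum[OF u X] tempered_sum[OF u T] ..
    also have "\<dots> = functional_of_fun f \<psi>" by (rule f(2)[OF \<psi>])
    also have "\<dots> = functional_of_fun (poly_partial p partial_x v) \<psi> + functional_of_fun (poly_partial q partial_t v) \<psi>"
      unfolding V(2)[symmetric] v_def[symmetric]
      by (intro functional_of_fun_add_fun quad_decay_continuous quad_decay_bounded quad_decay_poly_partial decay)
    also have "\<dots> = functional_of_fun v (poly_partial (reflect p) partial_x \<psi>) +
        functional_of_fun v (poly_partial (reflect q) partial_t \<psi>)"
      by (simp add: schwartz_transpose[OF v \<psi>])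
    also have "\<dots> = functional_of_fun v \<phi>"
      unfolding W(2)[symmetric] \<psi>_def[symmetric]
      by (intro functional_of_fun_add[symmetric] quad_decay_continuous quad_decay_bounded quad_decay_poly_partial decay)
    finally show ?thesis .
  qed
  with v show ?thesis unfolding is_schwartz_function_def by blast
qed

section \<open>Plane waves when the symbol has a zero\<close>

text \<open>
Suprema are only meaningful for bounded sets, so even non-negativity of a norm uses that \<open>f\<close> is a
Schwartz function.
\<close>

lemma schwartz_norm_properties:
  assumes "f \<in> schwartz"
  shows "weighted_deriv a b c f z \<le> schwartz_norm a b c f" "0 \<le> schwartz_norm a b c f"
proof -
  have "bdd_above (range (weighted_deriv a b c f))" using assms by (simp add: schwartz_def)
  then show 1: "weighted_deriv a b c f z \<le> schwartz_norm a b c f" for z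
    unfolding schwartz_norm_def by (intro cSUP_upper) auto
  have "0 \<le> weighted_deriv a b c f (0, 0)" by (simp add: weighted_deriv_def)
  then show "0 \<le> schwartz_norm a b c f" using 1 by (rule order_trans)
qed

lemma schwartz_seminorm_zero: "schwartz_seminorm N (\<lambda>z. 0) = 0"
proof -
  have "partial_t (\<lambda>z. 0) = (\<lambda>z. 0)" "partial_x (\<lambda>z. 0) = (\<lambda>z. 0)"
    by (simp_all add: partial_t_def partial_x_def fun_eq_iff)
  then have "(partial_t ^^ a) (\<lambda>z. 0) = (\<lambda>z. 0)" "(partial_x ^^ a) (\<lambda>z. 0) = (\<lambda>z. 0)" for a
    by (induction a) auto
  then show ?thesis by (simp add: schwartz_seminorm_def schwartz_norm_def weighted_deriv_def case_prod_unfold)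
qed

lemma schwartz_pointwise_bound:
  assumes f: "f \<in> schwartz"
  shows "norm (f (t, x)) \<le> schwartz_seminorm 2 f * inverse (1 + x\<^sup>2)"
proof -
  have fin: "finite {(a, b, c). a + b + c \<le> (2::nat)}"
    by (rule finite_subset[of _ "{..2} \<times> {..2} \<times> {..2}"]) auto
  have "(\<Sum>(a, b, c)\<in>{(0, 0, 0), (0, 0, 2)}. schwartz_norm a b c f) \<le> schwartz_seminorm 2 f"
    unfolding schwartz_seminorm_def
    by (rule sum_mono2[OF fin]) (auto simp: schwartz_norm_properties(2)[OF f])
  then have "schwartz_norm 0 0 0 f + schwartz_norm 0 0 2 f \<le> schwartz_seminorm 2 f" by simp
  moreover have "norm (f (t, x)) \<le> schwartz_norm 0 0 0 f"
    using schwartz_norm_properties(1)[OF f, of 0 0 0 "(t, x)"] by (simp add: weighted_deriv_def)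
  moreover have "x\<^sup>2 * norm (f (t, x)) \<le> schwartz_norm 0 0 2 f"
    using schwartz_norm_properties(1)[OF f, of 0 0 2 "(t, x)"] by (simp add: weighted_deriv_def norm_mult norm_power)
  ultimately have "(1 + x\<^sup>2) * norm (f (t, x)) \<le> schwartz_seminorm 2 f" by (simp add: algebra_simps)
  moreover have "0 < 1 + x\<^sup>2" by (simp add: add_pos_nonneg)
  ultimately show ?thesis by (simp add: field_simps)
qed

lemma functional_of_fun_bound:
  assumes h: "continuous_on UNIV h" "bounded (range h)"
  shows "\<exists>M>0. \<forall>f\<in>schwartz. norm (functional_of_fun h f) \<le> M * schwartz_seminorm 2 f"
proof -
  obtain B where B: "B > 0" "\<And>z. norm (h z) \<le> B" using h(2) by (auto simp: bounded_pos)
  define I where "I = (\<integral>z. indicator cylinder z * inverse (1 + (snd z)\<^sup>2) \<partial>(lborel :: (real \<times> real) measure))"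
  have I: "0 \<le> I" unfolding I_def by (intro integral_nonneg_AE AE_I2) (auto simp: indicator_def)
  have "norm (functional_of_fun h f) \<le> (B * (I + 1)) * schwartz_seminorm 2 f" if f: "f \<in> schwartz" for f
  proof -
    define s where "s = schwartz_seminorm 2 f"
    have s: "norm (f (t, x)) \<le> s * inverse (1 + x\<^sup>2)" for t x
      unfolding s_def by (rule schwartz_pointwise_bound[OF f])
    have s0: "0 \<le> s" using order_trans[OF norm_ge_zero s[of 0 0]] by simp
    have "norm (functional_of_fun h f) \<le>
        (\<integral>z. s * B * (indicator cylinder z * inverse (1 + (snd z)\<^sup>2)) \<partial>lborel)"
      unfolding functional_of_fun_def set_lebesgue_integral_def
    proof (rule order_trans[OF integral_norm_bound integral_mono])
      show "integrable lborel (\<lambda>z. norm (indicator cylinder z *\<^sub>R (f z * h z)))"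
        using quad_decay_integrable[OF quad_decay_mult[OF schwartz_pure_derivatives(1)[OF f] h]]
        unfolding set_integrable_def by (rule integrable_norm)
      show "integrable lborel (\<lambda>z. s * B * (indicator cylinder z * inverse (1 + (snd z)\<^sup>2)) :: real)"
        by (intro integrable_mult_right integrable_cylinder_weight)
      fix z :: "real \<times> real"
      obtain t x where z: "z = (t, x)" by (cases z)
      have "norm (f z) * norm (h z) \<le> (s * inverse (1 + x\<^sup>2)) * B"
        unfolding z using s[of t x] B s0 by (intro mult_mono) auto
      then show "norm (indicator cylinder z *\<^sub>R (f z * h z)) \<le>
          s * B * (indicator cylinder z * inverse (1 + (snd z)\<^sup>2))"
        by (auto simp: z norm_mult indicator_def mult_ac)
    qed
    also have "\<dots> = B * I * s" by (simp add: I_def)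
    also have "\<dots> \<le> B * (I + 1) * s" using B s0 by (intro mult_right_mono mult_left_mono) auto
    finally show ?thesis by (simp add: s_def)
  qed
  moreover have "0 < B * (I + 1)" using B I by auto
  ultimately show ?thesis by blast
qed

text \<open>
Continuity is checked at each point with a single ball: the functional is additive and bounded by a
multiple of one seminorm.
\<close>

lemma functional_of_fun_tempered:
  assumes h: "continuous_on UNIV h" "bounded (range h)"
  shows "functional_of_fun h \<in> tempered_distributions"
proof -
  let ?u = "functional_of_fun h"
  have add: "?u (\<lambda>z. f z + g z) = ?u f + ?u g" if "f \<in> schwartz" "g \<in> schwartz" for f g
    using that by (intro functional_of_fun_add h schwartz_pure_derivatives)
  have cmult: "?u (\<lambda>z. c * f z) = c * ?u f" for c f
    by (simp add: functional_of_fun_def mult.assoc)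
  obtain M where M: "M > 0" "\<And>f. f \<in> schwartz \<Longrightarrow> norm (?u f) \<le> M * schwartz_seminorm 2 f"
    using functional_of_fun_bound[OF h] by blast
  have "continuous_map schwartz_topology euclidean ?u"
    unfolding continuous_map_def topspace_schwartz_topology
  proof (intro conjI allI impI)
    fix U :: "complex set" assume "openin euclidean U"
    then have U: "open U" by simp
    show "openin schwartz_topology {f \<in> schwartz. ?u f \<in> U}"
    proof (subst openin_subopen, intro ballI)
      fix f assume "f \<in> {f \<in> schwartz. ?u f \<in> U}"
      then have f: "f \<in> schwartz" "?u f \<in> U" by auto
      obtain e where e: "e > 0" "\<And>w. dist w (?u f) < e \<Longrightarrow> w \<in> U"
        using U f(2) unfolding open_dist by blast
      define T where "T = {g \<in> schwartz. schwartz_seminorm 2 (\<lambda>z. g z - f z) < e / M}"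
      have r: "e / M > 0" using e M by simp
      have "openin schwartz_topology T"
        unfolding schwartz_topology_def T_def
        by (rule topology_generated_by_Basis) (use f(1) r in blast)
      moreover have "f \<in> T" using f(1) r by (simp add: T_def schwartz_seminorm_zero)
      moreover have "T \<subseteq> {f \<in> schwartz. ?u f \<in> U}"
      proof
        fix g assume g: "g \<in> T"
        then have gs: "g \<in> schwartz" by (simp add: T_def)
        have d: "(\<lambda>z. g z - f z) \<in> schwartz" using schwartz_lincomb[OF gs f(1), of "- 1"] by simp
        have "?u g - ?u f = ?u (\<lambda>z. g z - f z)"
          using add[OF d f(1)] by simp
        then have "dist (?u g) (?u f) \<le> M * schwartz_seminorm 2 (\<lambda>z. g z - f z)"
          using M(2)[OF d] by (simp add: dist_norm)
        also have "\<dots> < M * (e / M)" using g M(1) by (intro mult_strict_left_mono) (auto simp: T_def)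
        finally have "dist (?u g) (?u f) < e" using M(1) by simp
        then show "g \<in> {f \<in> schwartz. ?u f \<in> U}" using gs e(2) by simp
      qed
      ultimately show "\<exists>T. openin schwartz_topology T \<and> f \<in> T \<and> T \<subseteq> {f \<in> schwartz. ?u f \<in> U}" by blast
    qed
  qed simp
  with add cmult show ?thesis by (simp add: tempered_distributions_def)
qed

definition plane_wave :: "int \<Rightarrow> real \<Rightarrow> cfun" where
  "plane_wave k \<xi> = (\<lambda>(t, x). cis (of_int k * t + \<xi> * x))"

lemma plane_wave_has_partials:
  "((\<lambda>s. a * plane_wave k \<xi> (s, x)) has_vector_derivative (\<i> * of_int k * a) * plane_wave k \<xi> (t, x)) (at t)"
  "((\<lambda>y. a * plane_wave k \<xi> (t, y)) has_vector_derivative (\<i> * \<xi> * a) * plane_wave k \<xi> (t, x)) (at x)"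
proof -
  have e: "plane_wave k \<xi> (s, y) = cis (of_int k * s) * cis (\<xi> * y)" for s y
    by (simp add: plane_wave_def cis_mult)
  have "((\<lambda>s. (a * cis (\<xi> * x)) * cis (of_int k * s)) has_vector_derivative
      (a * cis (\<xi> * x)) * (\<i> * of_real (of_int k) * cis (of_int k * t))) (at t)"
    by (intro has_vector_derivative_mult_right cis_has_vector_derivative)
  then show "((\<lambda>s. a * plane_wave k \<xi> (s, x)) has_vector_derivative (\<i> * of_int k * a) * plane_wave k \<xi> (t, x)) (at t)"
    unfolding e by (simp add: mult_ac)
  have "((\<lambda>y. (a * cis (of_int k * t)) * cis (\<xi> * y)) has_vector_derivative
      (a * cis (of_int k * t)) * (\<i> * of_real \<xi> * cis (\<xi> * x))) (at x)"
    by (intro has_vector_derivative_mult_right cis_has_vector_derivative)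
  then show "((\<lambda>y. a * plane_wave k \<xi> (t, y)) has_vector_derivative (\<i> * \<xi> * a) * plane_wave k \<xi> (t, x)) (at x)"
    unfolding e by (simp add: mult_ac)
qed

lemma plane_wave_partials:
  "partial_t (\<lambda>z. a * plane_wave k \<xi> z) = (\<lambda>z. (\<i> * of_int k * a) * plane_wave k \<xi> z)"
  "partial_x (\<lambda>z. a * plane_wave k \<xi> z) = (\<lambda>z. (\<i> * \<xi> * a) * plane_wave k \<xi> z)"
  unfolding partial_t_def partial_x_def fun_eq_iff
  by (simp_all add: vector_derivative_at[OF plane_wave_has_partials(1)] vector_derivative_at[OF plane_wave_has_partials(2)] del: mult.assoc)

lemma plane_wave_funpow:
  "(partial_t ^^ j) (plane_wave k \<xi>) = (\<lambda>z. (\<i> * of_int k) ^ j * plane_wave k \<xi> z)"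
  "(partial_x ^^ j) (plane_wave k \<xi>) = (\<lambda>z. (\<i> * \<xi>) ^ j * plane_wave k \<xi> z)"
  by (induction j) (simp_all add: plane_wave_partials)

lemma plane_wave_continuous: "continuous_on UNIV (plane_wave k \<xi>)"
  unfolding plane_wave_def case_prod_unfold by (intro continuous_intros)

lemma norm_plane_wave: "norm (plane_wave k \<xi> z) = 1"
  by (simp add: plane_wave_def case_prod_unfold)

lemma plane_wave_C_infinity: "C_infinity (plane_wave k \<xi>)"
proof -
  have "C_k n (\<lambda>z. a * plane_wave k \<xi> z)" for n a
  proof (induction n arbitrary: a)
    case (Suc n)
    then show ?case
      unfolding C_k.simps plane_wave_partials
      by (intro conjI allI differentiableI_vector[OF plane_wave_has_partials(1)]
          differentiableI_vector[OF plane_wave_has_partials(2)] continuous_intros plane_wave_continuous)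
  qed (auto intro!: continuous_intros plane_wave_continuous)
  from this[of _ 1] show ?thesis by (simp add: C_infinity_def)
qed

lemma plane_wave_periodic: "periodic_t (plane_wave k \<xi>)"
proof -
  have "cis (of_int k * (t + 2 * pi) + \<xi> * x) = cis (of_int k * t + \<xi> * x)" for t x
    unfolding cis_mult[symmetric] cis_of_int_periodic ..
  then show ?thesis by (simp add: periodic_t_def plane_wave_def)
qed

lemma plane_wave_bounded: "bounded (range (\<lambda>z. a * plane_wave k \<xi> z))"
  by (auto simp: bounded_iff norm_mult norm_plane_wave)

lemma functional_of_fun_cmult_fun: "functional_of_fun (\<lambda>z. a * h z) f = a * functional_of_fun h f"
proof -
  have "functional_of_fun (\<lambda>z. a * h z) f = (LINT z:cylinder|lborel. a * (f z * h z))"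
    unfolding functional_of_fun_def by (simp only: mult.left_commute)
  then show ?thesis by (simp add: functional_of_fun_def)
qed

text \<open>
Each \<open>D\<close> acts on test functions as \<open>i \<partial>\<close>; moving \<open>\<partial>\<close> to the wave contributes \<open>-1\<close>, and
differentiating the wave contributes \<open>i\<close> times the frequency.  The constants combine to
\<open>i \<cdot> (-1) \<cdot> i = 1\<close>.
\<close>

lemma plane_wave_eigenfunction:
  assumes f: "f \<in> schwartz"
  shows "poly_operator p D_x (functional_of_fun (plane_wave k \<xi>)) f =
      poly p (of_real \<xi>) * functional_of_fun (plane_wave k \<xi>) f"
    "poly_operator p D_t (functional_of_fun (plane_wave k \<xi>)) f =
      poly p (of_int k) * functional_of_fun (plane_wave k \<xi>) f"
proof -
  have sgn: "\<i> ^ j * ((- 1) ^ j * ((\<i> * w) ^ j * r)) = w ^ j * r" for j and w r :: complex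
  proof -
    have "\<i> ^ j * ((- 1) ^ j * ((\<i> * w) ^ j * r)) = (\<i> * (- 1) * (\<i> * w)) ^ j * r"
      unfolding power_mult_distrib by (simp only: mult.assoc)
    then show ?thesis by simp
  qed
  have x: "functional_of_fun (plane_wave k \<xi>) ((partial_x ^^ j) f) =
      (- 1) ^ j * ((\<i> * \<xi>) ^ j * functional_of_fun (plane_wave k \<xi>) f)" for j
    using functional_of_fun_partial_x_funpow[OF f plane_wave_C_infinity]
    by (simp add: plane_wave_funpow plane_wave_bounded functional_of_fun_cmult_fun)
  have t: "functional_of_fun (plane_wave k \<xi>) ((partial_t ^^ j) f) =
      (- 1) ^ j * ((\<i> * of_int k) ^ j * functional_of_fun (plane_wave k \<xi>) f)" for j
    using functional_of_fun_partial_t_funpow[OF f plane_wave_periodic plane_wave_C_infinity]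
    by (simp add: plane_wave_funpow plane_wave_bounded functional_of_fun_cmult_fun)
  show "poly_operator p D_x (functional_of_fun (plane_wave k \<xi>)) f =
      poly p (of_real \<xi>) * functional_of_fun (plane_wave k \<xi>) f"
    "poly_operator p D_t (functional_of_fun (plane_wave k \<xi>)) f =
      poly p (of_int k) * functional_of_fun (plane_wave k \<xi>) f"
    unfolding poly_operator_eq x t mult.assoc sgn poly_altdef sum_distrib_right by simp_all
qed

text \<open>
A modulated Gaussian centred at \<open>x = m\<close>.  The polynomial factor makes the class closed under
differentiation.
\<close>

definition wave_packet :: "int \<Rightarrow> real \<Rightarrow> real \<Rightarrow> complex poly \<Rightarrow> cfun" where
  "wave_packet k \<xi> m P = (\<lambda>(t, x). cis (of_int k * t) *
     (poly P (of_real x) * (cis (\<xi> * x) * of_real (exp (- ((x - m)\<^sup>2) / 2)))))"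

lemma poly_exp_bound:
  fixes P :: "complex poly"
  shows "\<exists>K a. 0 \<le> K \<and> 0 \<le> a \<and> (\<forall>x. norm (poly P (of_real x)) \<le> K * exp (a * \<bar>x\<bar>))"
proof (induction P)
  case 0
  then show ?case by (intro exI[of _ 0]) simp
next
  case (pCons b P)
  then obtain K a where K: "0 \<le> K" "0 \<le> a" "\<And>x. norm (poly P (of_real x)) \<le> K * exp (a * \<bar>x\<bar>)" by blast
  have "norm (poly (pCons b P) (of_real x)) \<le> (norm b + K) * exp ((a + 1) * \<bar>x\<bar>)" for x
  proof -
    have "\<bar>x\<bar> \<le> exp \<bar>x\<bar>" using exp_ge_add_one_self[of "\<bar>x\<bar>"] by linarith
    then have "\<bar>x\<bar> * norm (poly P (of_real x)) \<le> exp \<bar>x\<bar> * (K * exp (a * \<bar>x\<bar>))"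
      using K by (intro mult_mono) auto
    also have "\<dots> = K * exp ((a + 1) * \<bar>x\<bar>)" by (simp add: exp_add[symmetric] algebra_simps)
    finally have 1: "norm (of_real x * poly P (of_real x)) \<le> K * exp ((a + 1) * \<bar>x\<bar>)" by (simp add: norm_mult)
    have "norm b * 1 \<le> norm b * exp ((a + 1) * \<bar>x\<bar>)" using K by (intro mult_left_mono) auto
    with 1 have "norm b + norm (of_real x * poly P (of_real x)) \<le> (norm b + K) * exp ((a + 1) * \<bar>x\<bar>)"
      by (simp add: algebra_simps)
    then show ?thesis by (simp add: order_trans[OF norm_triangle_ineq])
  qed
  then show ?case using K by (intro exI[of _ "norm b + K"] exI[of _ "a + 1"]) auto
qed

lemma gaussian_poly_bounded:
  fixes P :: "complex poly"
  shows "\<exists>C. \<forall>x. norm (poly P (of_real x)) * exp (- ((x - m)\<^sup>2) / 2) \<le> C"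
proof -
  obtain K a where K: "0 \<le> K" "0 \<le> a" "\<And>x. norm (poly P (of_real x)) \<le> K * exp (a * \<bar>x\<bar>)"
    using poly_exp_bound[of P] by blast
  have "norm (poly P (of_real x)) * exp (- ((x - m)\<^sup>2) / 2) \<le> K * exp (a * \<bar>m\<bar> + a\<^sup>2 / 2)" for x
  proof -
    have "norm (poly P (of_real x)) * exp (- ((x - m)\<^sup>2) / 2) \<le> K * exp (a * \<bar>x\<bar>) * exp (- ((x - m)\<^sup>2) / 2)"
      by (intro mult_right_mono K) auto
    also have "\<dots> = K * exp (a * \<bar>x\<bar> - (x - m)\<^sup>2 / 2)"
      by (simp only: mult.assoc exp_add[symmetric] minus_divide_left[symmetric] add_uminus_conv_diff)
    also have "\<dots> \<le> K * exp (a * \<bar>m\<bar> + a\<^sup>2 / 2)"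
    proof -
      have "a * \<bar>x\<bar> \<le> a * (\<bar>x - m\<bar> + \<bar>m\<bar>)" using K(2) by (intro mult_left_mono) auto
      then have 1: "a * \<bar>x\<bar> \<le> a * \<bar>x - m\<bar> + a * \<bar>m\<bar>" by (simp only: distrib_left)
      \<comment> \<open>Completing the square compares the linear exponent with the Gaussian.\<close>
      have "0 \<le> (a - \<bar>x - m\<bar>)\<^sup>2" by simp
      then have "2 * (a * \<bar>x - m\<bar>) \<le> a\<^sup>2 + (x - m)\<^sup>2"
        unfolding power2_diff[of a] power2_abs by linarith
      with 1 have "a * \<bar>x\<bar> - (x - m)\<^sup>2 / 2 \<le> a * \<bar>m\<bar> + a\<^sup>2 / 2" by linarith
      then show ?thesis using K(1) by (intro mult_left_mono) auto
    qed
    finally show ?thesis .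
  qed
  then show ?thesis by blast
qed

lemma wave_packet_has_partials:
  "((\<lambda>s. wave_packet k \<xi> m P (s, x)) has_vector_derivative wave_packet k \<xi> m (smult (\<i> * of_int k) P) (t, x)) (at t)"
  "((\<lambda>y. wave_packet k \<xi> m P (t, y)) has_vector_derivative
     wave_packet k \<xi> m (pderiv P + P * [:of_real m + \<i> * of_real \<xi>, - 1:]) (t, x)) (at x)"
proof -
  define w where "w = poly P (of_real x) * (cis (\<xi> * x) * of_real (exp (- ((x - m)\<^sup>2) / 2)))"
  have "((\<lambda>s. cis (of_int k * s) * w) has_vector_derivative
      \<i> * of_real (of_int k) * cis (of_int k * t) * w) (at t)"
    by (intro has_vector_derivative_mult_left cis_has_vector_derivative)
  then show "((\<lambda>s. wave_packet k \<xi> m P (s, x)) has_vector_derivative wave_packet k \<xi> m (smult (\<i> * of_int k) P) (t, x)) (at t)"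
    by (simp add: wave_packet_def w_def mult_ac)
  have P: "((\<lambda>y. poly P (of_real y)) has_vector_derivative poly (pderiv P) (of_real x)) (at x)"
    by (rule has_vector_derivative_real_field) (rule poly_DERIV)
  have E: "((\<lambda>y. complex_of_real (exp (- ((y - m)\<^sup>2) / 2))) has_vector_derivative
      of_real (- (x - m) * exp (- ((x - m)\<^sup>2) / 2))) (at x)"
  proof -
    have "((\<lambda>y. exp (- ((y - m)\<^sup>2) / 2)) has_real_derivative - (x - m) * exp (- ((x - m)\<^sup>2) / 2)) (at x)"
      by (auto intro!: derivative_eq_intros simp: field_simps)
    then show ?thesis by (rule has_vector_derivative_of_real)
  qed
  have "((\<lambda>y. cis (of_int k * t) * (poly P (of_real y) * (cis (\<xi> * y) * of_real (exp (- ((y - m)\<^sup>2) / 2)))))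
     has_vector_derivative
     cis (of_int k * t) * (poly P (of_real x) *
        (cis (\<xi> * x) * of_real (- (x - m) * exp (- ((x - m)\<^sup>2) / 2)) +
         (\<i> * of_real \<xi>) * cis (\<xi> * x) * of_real (exp (- ((x - m)\<^sup>2) / 2))) +
       poly (pderiv P) (of_real x) * (cis (\<xi> * x) * of_real (exp (- ((x - m)\<^sup>2) / 2))))) (at x)"
    by (intro has_vector_derivative_mult_right has_vector_derivative_mult P E cis_has_vector_derivative)
  then show "((\<lambda>y. wave_packet k \<xi> m P (t, y)) has_vector_derivative
     wave_packet k \<xi> m (pderiv P + P * [:of_real m + \<i> * of_real \<xi>, - 1:]) (t, x)) (at x)"
    unfolding wave_packet_def by (simp add: algebra_simps)
qed

lemma wave_packet_schwartz: "wave_packet k \<xi> m P \<in> schwartz"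
proof (rule schwartz_coinduct[where I = "\<lambda>_. True" and G = "wave_packet k \<xi> m"])
  fix P
  show "periodic_t (wave_packet k \<xi> m P)"
    unfolding wave_packet_def periodic_t_def by (simp add: cis_of_int_periodic)
  show "continuous_on UNIV (wave_packet k \<xi> m P)"
    unfolding wave_packet_def case_prod_unfold by (intro continuous_intros) auto
  show "\<exists>C. \<forall>t x. \<bar>x\<bar> ^ c * norm (wave_packet k \<xi> m P (t, x)) \<le> C" for c
  proof -
    obtain C where C: "\<And>x. norm (poly (monom 1 c * P) (of_real x)) * exp (- ((x - m)\<^sup>2) / 2) \<le> C"
      using gaussian_poly_bounded by blast
    have "\<bar>x\<bar> ^ c * norm (wave_packet k \<xi> m P (t, x)) \<le> C" for t x
      using C[of x] by (simp add: wave_packet_def norm_mult poly_monom norm_power mult.assoc)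
    then show ?thesis by blast
  qed
  show "\<exists>Q. True \<and> (\<forall>t x. ((\<lambda>s. wave_packet k \<xi> m P (s, x)) has_vector_derivative wave_packet k \<xi> m Q (t, x)) (at t))"
    using wave_packet_has_partials(1) by blast
  show "\<exists>Q. True \<and> (\<forall>t x. ((\<lambda>y. wave_packet k \<xi> m P (t, y)) has_vector_derivative wave_packet k \<xi> m Q (t, x)) (at x))"
    using wave_packet_has_partials(2) by blast
qed simp

lemma normal_density_le_1: "normal_density m 1 x \<le> 1"
proof -
  have "1 \<le> sqrt (2 * pi)" using pi_gt3 by (intro real_le_rsqrt) simp
  moreover have "exp (- ((x - m)\<^sup>2) / 2) \<le> 1" by simp
  ultimately have "exp (- ((x - m)\<^sup>2) / 2) \<le> sqrt (2 * pi)" by linarith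
  then show ?thesis by (simp add: normal_density_def)
qed

lemma normal_density_escapes: "(\<lambda>n. normal_density (real n) 1 x) \<longlonglongrightarrow> 0"
proof -
  have "filterlim (\<lambda>n. - x + real n) at_top sequentially"
    by (rule filterlim_tendsto_add_at_top[OF tendsto_const filterlim_real_sequentially])
  then have "filterlim (\<lambda>n. (- x + real n) ^ 2) at_top sequentially"
    by (rule filterlim_pow_at_top[rotated]) simp
  then have "filterlim (\<lambda>n. 1 / 2 * (- x + real n) ^ 2) at_top sequentially"
    by (rule filterlim_tendsto_pos_mult_at_top[OF tendsto_const, rotated]) simp
  then have "filterlim (\<lambda>n. - (1 / 2 * (- x + real n) ^ 2)) at_bot sequentially"
    unfolding filterlim_uminus_at_top[symmetric] .
  then have "(\<lambda>n. exp (- (1 / 2 * (- x + real n) ^ 2))) \<longlonglongrightarrow> 0"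
    by (rule filterlim_compose[OF exp_at_bot])
  then have "(\<lambda>n. 1 / sqrt (2 * pi) * exp (- (1 / 2 * (- x + real n) ^ 2))) \<longlonglongrightarrow> 1 / sqrt (2 * pi) * 0"
    by (rule tendsto_mult_left)
  moreover have "(- x + real n)\<^sup>2 = (x - real n)\<^sup>2" for n
    by (simp add: power2_commute)
  ultimately show ?thesis by (simp add: normal_density_def)
qed

text \<open>
Wave packets moving to infinity, modulated with the opposite frequencies, have constant pairing
\<open>2 \<pi>\<close> with the plane wave, while their pairing with a Schwartz function tends to \<open>0\<close> by dominated
convergence.
\<close>

lemma plane_wave_not_schwartz: "\<not> is_schwartz_function (functional_of_fun (plane_wave k \<xi>))"
proof
  assume "is_schwartz_function (functional_of_fun (plane_wave k \<xi>))"
  then obtain f where f: "f \<in> schwartz"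
    "\<And>\<phi>. \<phi> \<in> schwartz \<Longrightarrow> functional_of_fun (plane_wave k \<xi>) \<phi> = functional_of_fun f \<phi>"
    by (auto simp: is_schwartz_function_def)
  define \<phi> where "\<phi> n = wave_packet (- k) (- \<xi>) (real n) [:of_real (1 / sqrt (2 * pi)):]" for n
  have \<phi>: "\<phi> n \<in> schwartz" for n unfolding \<phi>_def by (rule wave_packet_schwartz)
  have phi_eq: "\<phi> n (t, x) = plane_wave (- k) (- \<xi>) (t, x) * of_real (normal_density (real n) 1 x)" for n t x
  proof -
    have "plane_wave (- k) (- \<xi>) (t, x) = cis (of_int (- k) * t) * cis (- \<xi> * x)"
      by (simp add: plane_wave_def cis_mult)
    then show ?thesis by (simp add: \<phi>_def wave_packet_def normal_density_def mult_ac)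
  qed
  have one: "functional_of_fun (plane_wave k \<xi>) (\<phi> n) = 2 * pi" for n
  proof -
    have prod: "\<phi> n (t, x) * plane_wave k \<xi> (t, x) = of_real (normal_density (real n) 1 x)" for t x
    proof -
      have "plane_wave (- k) (- \<xi>) (t, x) * plane_wave k \<xi> (t, x) = 1"
        by (simp add: plane_wave_def cis_mult)
      moreover have "\<phi> n (t, x) * plane_wave k \<xi> (t, x) = (plane_wave (- k) (- \<xi>) (t, x) * plane_wave k \<xi> (t, x)) *
          of_real (normal_density (real n) 1 x)"
        unfolding phi_eq by (simp only: mult_ac)
      ultimately show ?thesis by simp
    qed
    have "quad_decay (\<lambda>z. \<phi> n z * plane_wave k \<xi> z)"
      using plane_wave_bounded[of 1 k \<xi>]
      by (intro quad_decay_mult schwartz_pure_derivatives(1)[OF \<phi>] plane_wave_continuous) simp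
    then have "functional_of_fun (plane_wave k \<xi>) (\<phi> n) =
        (\<integral>t. indicator {0..2 * pi} t *\<^sub>R (\<integral>x. \<phi> n (t, x) * plane_wave k \<xi> (t, x) \<partial>lborel) \<partial>lborel)"
      unfolding functional_of_fun_def by (rule cylinder_integral_iterated)
    also have "\<dots> = (\<integral>t. indicator {0..2 * pi} t *\<^sub>R (1 :: complex) \<partial>lborel)"
      unfolding prod integral_of_real integral_normal_density by simp
    also have "\<dots> = 2 * pi" by (simp add: scaleR_conv_of_real)
    finally show ?thesis .
  qed
  have "(\<lambda>n. functional_of_fun f (\<phi> n)) \<longlonglongrightarrow> (\<integral>z. 0 \<partial>(lborel :: (real \<times> real) measure))"
    unfolding functional_of_fun_def set_lebesgue_integral_def
  proof (rule integral_dominated_convergence)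
    note fi = quad_decay_integrable[OF schwartz_pure_derivatives(1)[OF f(1)], unfolded set_integrable_def]
    show "integrable lborel (\<lambda>z. norm (indicator cylinder z *\<^sub>R f z))"
      using fi by (rule integrable_norm)
    have q: "quad_decay (\<lambda>z. \<phi> n z * f z)" for n
      by (intro quad_decay_mult quad_decay_continuous quad_decay_bounded schwartz_pure_derivatives(1)[OF \<phi>]
          schwartz_pure_derivatives(1)[OF f(1)])
    show "(\<lambda>z. indicator cylinder z *\<^sub>R (\<phi> n z * f z)) \<in> borel_measurable lborel" for n
      using quad_decay_integrable[OF q, of n] unfolding set_integrable_def by (rule borel_measurable_integrable)
    show "AE z in lborel. (\<lambda>n. indicator cylinder z *\<^sub>R (\<phi> n z * f z)) \<longlonglongrightarrow> 0"
    proof (intro AE_I2)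
      fix z :: "real \<times> real"
      obtain t x where z: "z = (t, x)" by (cases z)
      have "(\<lambda>n. plane_wave (- k) (- \<xi>) (t, x) * complex_of_real (normal_density (real n) 1 x)) \<longlonglongrightarrow>
          plane_wave (- k) (- \<xi>) (t, x) * of_real 0"
        by (intro tendsto_mult_left tendsto_of_real normal_density_escapes)
      then have "(\<lambda>n. \<phi> n z) \<longlonglongrightarrow> 0" by (simp add: z phi_eq)
      then have "(\<lambda>n. indicator cylinder z *\<^sub>R (\<phi> n z * f z)) \<longlonglongrightarrow> indicator cylinder z *\<^sub>R (0 * f z)"
        by (intro tendsto_scaleR tendsto_const tendsto_mult_right)
      then show "(\<lambda>n. indicator cylinder z *\<^sub>R (\<phi> n z * f z)) \<longlonglongrightarrow> 0" by simp
    qed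
    show "AE z in lborel. norm (indicator cylinder z *\<^sub>R (\<phi> n z * f z)) \<le> norm (indicator cylinder z *\<^sub>R f z)" for n
    proof (intro AE_I2)
      fix z :: "real \<times> real"
      obtain t x where z: "z = (t, x)" by (cases z)
      have "norm (\<phi> n z) \<le> 1" by (simp add: z phi_eq norm_mult norm_plane_wave normal_density_le_1)
      then have "norm (\<phi> n z) * norm (f z) \<le> 1 * norm (f z)" by (intro mult_right_mono) auto
      then show "norm (indicator cylinder z *\<^sub>R (\<phi> n z * f z)) \<le> norm (indicator cylinder z *\<^sub>R f z)"
        by (auto simp: norm_mult indicator_def)
    qed
  qed simp
  moreover have "functional_of_fun f (\<phi> n) = 2 * pi" for n
    using one[of n] f(2)[OF \<phi>[of n]] by simp
  ultimately have "(\<lambda>n::nat. complex_of_real (2 * pi)) \<longlonglongrightarrow> 0" by simp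
  then show False by (simp add: LIMSEQ_const_iff)
qed

section \<open>The characterisation\<close>

theorem theorem3p1:
  fixes p q :: "complex poly"
    and L :: "functional \<Rightarrow> functional"
    and Z :: "(int \<times> real) set"
  assumes "degree p > 0" and "degree q > 0"
    and "(\<forall>n. coeff p n \<in> \<real>) \<or> (\<forall>n. coeff q n \<in> \<real>)"
  defines "L \<equiv> \<lambda>u \<phi>. poly_operator p D_x u \<phi> + poly_operator q D_t u \<phi>"
    and "Z \<equiv> {(k, \<xi>). poly p (of_real \<xi>) + poly q (of_int k) = 0}"
  shows "SGH L \<longleftrightarrow> Z = {}"
proof
  assume "Z = {}"
  then have nz: "poly p (of_real \<xi>) + poly q (of_int k) \<noteq> 0" for k :: int and \<xi> :: real
    by (auto simp: Z_def)
  obtain c where c: "c > 0" "\<And>(\<xi>::real) (k::int). c \<le> norm (poly p (of_real \<xi>) + poly q (of_int k))"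
    using symbol_bounded_below[OF assms(1-3) nz] by blast
  show "SGH L"
    unfolding SGH_def L_def using tempered_solution_is_schwartz[OF _ assms(1) c] by blast
next
  assume SGH: "SGH L"
  show "Z = {}"
  proof (rule ccontr)
    assume "Z \<noteq> {}"
    then obtain k \<xi> where z: "poly p (of_real \<xi>) + poly q (of_int k) = 0" by (auto simp: Z_def)
    define u where "u = functional_of_fun (plane_wave k \<xi>)"
    have "u \<in> tempered_distributions"
      unfolding u_def using plane_wave_bounded[of 1 k \<xi>]
      by (intro functional_of_fun_tempered plane_wave_continuous) simp
    moreover have "is_schwartz_function (L u)"
    proof -
      have "L u \<phi> = functional_of_fun (\<lambda>z. 0) \<phi>" if "\<phi> \<in> schwartz" for \<phi>
      proof -
        have "L u \<phi> = (poly p (of_real \<xi>) + poly q (of_int k)) * u \<phi>"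
          by (simp add: L_def u_def plane_wave_eigenfunction[OF that] distrib_right)
        then show ?thesis by (simp add: z functional_of_fun_def)
      qed
      moreover have "(\<lambda>z. 0) \<in> schwartz"
        using schwartz_cmult[OF wave_packet_schwartz, of 0] by simp
      ultimately show ?thesis unfolding is_schwartz_function_def by blast
    qed
    ultimately have "is_schwartz_function u" using SGH by (simp add: SGH_def)
    then show False unfolding u_def using plane_wave_not_schwartz by blast
  qed
qed

end
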